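(* Let $\mathcal K$ be a field with $\mathrm{char}(\mathcal K)\neq2$ and let $M:=F_\lambda(V_T)$ be a generalised tree module over the zero-relation algebra $\Lambda=\mathcal K Q/\langle\rho\rangle$, given by a tree $T$ and a bound quiver morphism $F:T\to(Q,\rho)$, such that the pair $(M,M)$ is ghost-free. Suppose the following conditions hold: (1) for every subtree of $T$ of the form $n_1\xleftarrow{a}n\xrightarrow{b}n_2$ or $n_1\xrightarrow{a}n\xleftarrow{b}n_2$ with $n_1\neq n_2$ and satisfying $F(a)=F(b)$, and for every generalised graph map $\mathcal G$ from $M$ to $M$, $(n_1,n_2,j)$ is not a vertex of $\mathcal G$ for any $j\in\{-1,1\}$; and (2) for $n_1\neq n_2$ in $T_0$, if there exists a generalised graph map $\mathcal G$ from $M$ to $M$ such that $(n_1,n_2,j)$ is a vertex of $\mathcal G$ for some $j\in\{-1,1\}$, then there does not exist a generalised graph map $\mathcal G'$ from $M$ to $M$ containing the vertex $(n_2,n_1,j')$ for some $j'\in\{-1,1\}$. Then $M$ is indecomposable.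
   Context: **Setting.** $\mathcal K$ is a field with $\mathrm{char}(\mathcal K)\neq 2$. $Q=(Q_0,Q_1)$ is a locally finite quiver, $\rho$ is a set of paths in $Q$ of length at least $2$ such that for each $v\in Q_0$ there is $n\ge 0$ such that $\langle\rho\rangle$ contains all paths of length exceeding $n$ with source or target $v$; $\Lambda:=\mathcal K Q/\langle\rho\rangle$ is called a zero-relation algebra. Finite-dimensional left $\Lambda$-modules are identified with finite-dimensional bound $\mathcal K$-representations of $(Q,\rho)$. A tree is a finite quiver $T=(T_0,T_1,s,t)$ whose underlying undirected graph is simply connected (a tree); $T_0\subset\mathbb N$. A bound quiver morphism $F:T\to(Q,\rho)$ is a quiver morphism $T\to Q$ such that no path $p$ in $T$ has $F(p)\in\langle\rho\rangle$. The associated generalised tree module $F_\lambda(V_T)$ is the $\Lambda$-module with $\mathcal K$-basis $\{v_n\mid n\in T_0\}$, where $v_n$ lies in the vector space at the vertex $F(n)$, and each arrow $\gamma\in Q_1$ acts by $\gamma\cdot v_n=\sum_{a\in T_1,\ s(a)=n,\ F(a)=\gamma}v_{t(a)}$. The following is defined for a pair $(M_1,M_2)$ of generalised tree modules $M_i=(F_i)_\lambda(V_{T^i})$, $i=1,2$; in the claim it is applied with $T^1=T^2=T$, $F_1=F_2=F$, $M_1=M_2=M$. **Networks.** A network consists of a quiver together with a set of undirected edges forming a simple graph on the same vertex set. A subnetwork consists of subsets of the vertices, arrows and edges such that all endpoints of the chosen arrows and edges are chosen. It is connected if its underlying undirected graph is connected. A link between two vertices is an arrow (in either direction) or an edge joining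 them. The pullback network $\mathcal N[1]$ of $(M_1,M_2)$ has vertices $(n,m)\in T^1_0\times T^2_0$ with $F_1(n)=F_2(m)$; arrows $(n,m)\xrightarrow{(a,b)}(n',m')$ for arrows $n\xrightarrow{a}n'$ in $T^1$, $m\xrightarrow{b}m'$ in $T^2$ with $F_1(a)=F_2(b)$; and edge set $\mathcal E^1$ consisting of all $\{(n,m),(n',m)\}$ such that $n\neq n'$ and there are arrows $n\xleftarrow{a}n''\xrightarrow{b}n'$ in $T^1$ with $F_1(a)=F_1(b)$, and all $\{(n,m),(n,m')\}$ such that $m\ne m'$ and there are arrows $m\xrightarrow{c}m''\xleftarrow{d}m'$ in $T^2$ with $F_2(c)=F_2(d)$. The 2-covering network $\mathcal N[2]$ has vertices $(n,m,j)$ with $(n,m)\in\mathcal N[1]_0$, $j\in\{-1,1\}$; arrows $(n,m,j)\xrightarrow{(a,b,j)}(n',m',j)$ for each arrow $(n,m)\xrightarrow{(a,b)}(n',m')$ of $\mathcal N[1]$ and $j\in\{-1,1\}$; and edges $\{(n,m,j),(n',m',-j)\}$ for each $\{(n,m),(n',m')\}\in\mathcal E^1$ and $j\in\{-1,1\}$. $\pi:\mathcal N[2]\to\mathcal N[1]$ denotes the projection forgetting the sign $j$. **Properties of a subnetwork $\mathcal M=(\mathcal M_0,\mathcal M_1,\mathcal E_{\mathcal M})$ (vertices, arrows, edges) of $\mathcal N[2]$.** *Complete*: for each $(n,m,j)\in\mathcal M_0$: (1) for every arrow $n'\xrightarrow{a}n$ in $T^1$, at least one of: (1a) there is $m'\xrightarrow{b}m$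 in $T^2$ with $((n',m',j)\xrightarrow{(a,b,j)}(n,m,j))\in\mathcal M_1$; (1b) there are $n\xleftarrow{a}n'\xrightarrow{c}n''$ in $T^1$ with $F_1(a)=F_1(c)$ and $(n'',m,-j)\in\mathcal M_0$ such that $\{(n,m,j),(n'',m,-j)\}\in\mathcal E_{\mathcal M}$; (2) for every arrow $m\xrightarrow{b}m'$ in $T^2$, at least one of: (2a) there is $n\xrightarrow{a}n'$ in $T^1$ with $((n,m,j)\xrightarrow{(a,b,j)}(n',m',j))\in\mathcal M_1$; (2b) there are $m\xrightarrow{b}m'\xleftarrow{d}m''$ in $T^2$ with $F_2(b)=F_2(d)$ and $(n,m'',-j)\in\mathcal M_0$ such that $\{(n,m,j),(n,m'',-j)\}\in\mathcal E_{\mathcal M}$. *$\mathcal R[2]$-free*: there are no vertices $x,y,z$ of $\mathcal M$ such that $\mathcal M$ contains a link between $x$ and $y$ and a link between $y$ and $z$, and $\pi(x),\pi(y),\pi(z)$ are three distinct vertices of $\mathcal N[1]$ that are pairwise joined by links in $\mathcal N[1]$ (i.e. form a triangle). *Involution-free*: $(n,m,j)\in\mathcal M_0$ implies $(n,m,-j)\notin\mathcal M_0$. *Involution-invariant*: $\mathcal M_0=\pi^{-1}(\pi(\mathcal M_0))$. A *generalised graph map* from $M_1$ to $M_2$ is a non-empty connected involution-free complete $\mathcal R[2]$-free subnetwork of $\mathcal N[2]$. A *ghost* is a non-empty connected involution-invariant complete $\mathcal R[2]$-free subnetwork of $\mathcal N[2]$. The pair $(M_1,M_2)$ is *ghost-free*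 if $\mathcal N[2]$ contains no ghost. *)

theory Defs
  imports
    "Graph_Theory.Graph_Theory"
    "HOL-Library.Poly_Mapping"
begin

section \<open>Quivers with zero relations\<close>

text \<open>
  Quivers are arc-labelled digraphs (loops and parallel arrows allowed).  A path is a pair of its
  source and the list of its arrows in the order in which they are traversed, so that trivial paths
  are the pairs with empty list.
\<close>

type_synonym ('v, 'a) qpath = "'v \<times> 'a list"

definition qpaths :: "('v, 'a) pre_digraph \<Rightarrow> ('v, 'a) qpath set" where
  "qpaths Q = {(u, p). \<exists>v. pre_digraph.awalk Q u p v}"

definition qpath_source :: "('v, 'a) qpath \<Rightarrow> 'v" where
  "qpath_source p = fst p"

definition qpath_target :: "('v, 'a) pre_digraph \<Rightarrow> ('v, 'a) qpath \<Rightarrow> 'v" where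
  "qpath_target Q p = last (pre_digraph.awalk_verts Q (fst p) (snd p))"

definition locally_finite :: "('v, 'a) pre_digraph \<Rightarrow> bool" where
  "locally_finite Q \<longleftrightarrow>
     wf_digraph Q \<and> (\<forall>v \<in> verts Q. finite {a \<in> arcs Q. tail Q a = v \<or> head Q a = v})"

definition path_algebra :: "('v, 'a) pre_digraph \<Rightarrow> (('v, 'a) qpath \<Rightarrow>\<^sub>0 'k::field) set" where
  "path_algebra Q = {x. Poly_Mapping.keys x \<subseteq> qpaths Q}"

text \<open>
  Since modules are left modules, the product of two paths \<open>p\<close> and \<open>q\<close> means: first \<open>q\<close>, then \<open>p\<close>.
\<close>

definition path_mult ::
    "('v, 'a) pre_digraph \<Rightarrow> (('v, 'a) qpath \<Rightarrow>\<^sub>0 'k::field) \<Rightarrow> (('v, 'a) qpath \<Rightarrow>\<^sub>0 'k)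
      \<Rightarrow> (('v, 'a) qpath \<Rightarrow>\<^sub>0 'k)" where
  "path_mult Q x y =
     (\<Sum>p \<in> Poly_Mapping.keys x. \<Sum>q \<in> Poly_Mapping.keys y.
        if qpath_source p = qpath_target Q q
        then Poly_Mapping.single (qpath_source q, snd q @ snd p)
               (Poly_Mapping.lookup x p * Poly_Mapping.lookup y q)
        else 0)"

inductive_set path_ideal ::
    "('v, 'a) pre_digraph \<Rightarrow> ('v, 'a) qpath set \<Rightarrow> (('v, 'a) qpath \<Rightarrow>\<^sub>0 'k::field) set"
  for Q :: "('v, 'a) pre_digraph" and \<rho> :: "('v, 'a) qpath set" where
  zero: "0 \<in> path_ideal Q \<rho>"
| gen: "r \<in> \<rho> \<Longrightarrow> Poly_Mapping.single r 1 \<in> path_ideal Q \<rho>"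
| add: "x \<in> path_ideal Q \<rho> \<Longrightarrow> y \<in> path_ideal Q \<rho> \<Longrightarrow> x + y \<in> path_ideal Q \<rho>"
| left: "x \<in> path_algebra Q \<Longrightarrow> y \<in> path_ideal Q \<rho> \<Longrightarrow> path_mult Q x y \<in> path_ideal Q \<rho>"
| right: "x \<in> path_ideal Q \<rho> \<Longrightarrow> y \<in> path_algebra Q \<Longrightarrow> path_mult Q x y \<in> path_ideal Q \<rho>"

definition path_in_ideal ::
    "'k::field itself \<Rightarrow> ('v, 'a) pre_digraph \<Rightarrow> ('v, 'a) qpath set \<Rightarrow> ('v, 'a) qpath \<Rightarrow> bool" where
  "path_in_ideal K Q \<rho> p \<longleftrightarrow>
     (Poly_Mapping.single p 1 :: ('v, 'a) qpath \<Rightarrow>\<^sub>0 'k) \<in> path_ideal Q \<rho>"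

definition zero_relation_quiver ::
    "'k::field itself \<Rightarrow> ('v, 'a) pre_digraph \<Rightarrow> ('v, 'a) qpath set \<Rightarrow> bool" where
  "zero_relation_quiver K Q \<rho> \<longleftrightarrow>
     locally_finite Q \<and>
     (\<forall>p \<in> \<rho>. p \<in> qpaths Q \<and> length (snd p) \<ge> 2) \<and>
     (\<forall>v \<in> verts Q. \<exists>n. \<forall>p \<in> qpaths Q.
        length (snd p) > n \<and> (qpath_source p = v \<or> qpath_target Q p = v)
          \<longrightarrow> path_in_ideal K Q \<rho> p)"


section \<open>Bound representations\<close>

text \<open>
  All spaces of a representation are subspaces of one ambient vector space; the map belonging to
  an arrow only matters on the space at the tail of that arrow.
\<close>

record ('v, 'a, 'm) qrep =
  space :: "'v \<Rightarrow> 'm set"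
  act :: "'a \<Rightarrow> 'm \<Rightarrow> 'm"

definition bound_rep ::
    "('k::field \<Rightarrow> 'm::ab_group_add \<Rightarrow> 'm) \<Rightarrow> ('v, 'a) pre_digraph \<Rightarrow> ('v, 'a) qpath set
      \<Rightarrow> ('v, 'a, 'm) qrep \<Rightarrow> bool" where
  "bound_rep scale Q \<rho> V \<longleftrightarrow>
     vector_space scale \<and>
     (\<forall>v \<in> verts Q. module.subspace scale (space V v)) \<and>
     (\<forall>a \<in> arcs Q. \<forall>x \<in> space V (tail Q a).
        act V a x \<in> space V (head Q a) \<and>
        (\<forall>y \<in> space V (tail Q a). act V a (x + y) = act V a x + act V a y) \<and>
        (\<forall>c. act V a (scale c x) = scale c (act V a x))) \<and>
     (\<forall>(u, p) \<in> \<rho>. \<forall>x \<in> space V u. fold (act V) p x = 0)"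

definition subrep ::
    "('k::field \<Rightarrow> 'm::ab_group_add \<Rightarrow> 'm) \<Rightarrow> ('v, 'a) pre_digraph \<Rightarrow> ('v, 'a, 'm) qrep
      \<Rightarrow> ('v \<Rightarrow> 'm set) \<Rightarrow> bool" where
  "subrep scale Q V U \<longleftrightarrow>
     (\<forall>v \<in> verts Q. module.subspace scale (U v) \<and> U v \<subseteq> space V v) \<and>
     (\<forall>a \<in> arcs Q. \<forall>x \<in> U (tail Q a). act V a x \<in> U (head Q a))"

definition direct_decomposition ::
    "('k::field \<Rightarrow> 'm::ab_group_add \<Rightarrow> 'm) \<Rightarrow> ('v, 'a) pre_digraph \<Rightarrow> ('v, 'a, 'm) qrep
      \<Rightarrow> ('v \<Rightarrow> 'm set) \<Rightarrow> ('v \<Rightarrow> 'm set) \<Rightarrow> bool" where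
  "direct_decomposition scale Q V U W \<longleftrightarrow>
     subrep scale Q V U \<and> subrep scale Q V W \<and>
     (\<forall>v \<in> verts Q. space V v = {x + y |x y. x \<in> U v \<and> y \<in> W v} \<and> U v \<inter> W v = {0})"

definition indecomposable ::
    "('k::field \<Rightarrow> 'm::ab_group_add \<Rightarrow> 'm) \<Rightarrow> ('v, 'a) pre_digraph \<Rightarrow> ('v, 'a) qpath set
      \<Rightarrow> ('v, 'a, 'm) qrep \<Rightarrow> bool" where
  "indecomposable scale Q \<rho> V \<longleftrightarrow>
     bound_rep scale Q \<rho> V \<and>
     (\<exists>v \<in> verts Q. space V v \<noteq> {0}) \<and>
     (\<forall>U W. direct_decomposition scale Q V U W \<longrightarrow>
        (\<forall>v \<in> verts Q. U v = {0}) \<or> (\<forall>v \<in> verts Q. W v = {0}))"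


section \<open>Generalised tree modules\<close>

text \<open>
  The quiver whose arcs are the arrows of \<open>G\<close> together with a direction of traversal; its walks are
  the walks in the underlying undirected multigraph of \<open>G\<close>.
\<close>

definition traversals :: "('v, 'e) pre_digraph \<Rightarrow> ('v, 'e \<times> bool) pre_digraph" where
  "traversals G =
     \<lparr>verts = verts G, arcs = arcs G \<times> UNIV,
      tail = (\<lambda>(e, d). if d then tail G e else head G e),
      head = (\<lambda>(e, d). if d then head G e else tail G e)\<rparr>"

text \<open>
  The predicate \<^const>\<open>tree\<close> of the library only excludes directed cycles.  Here cycles of the
  underlying undirected multigraph are excluded, including loops and pairs of parallel or
  antiparallel arrows.  Connectedness includes that there is at least one vertex.
\<close>

definition tree_quiver :: "('n, 'e) pre_digraph \<Rightarrow> bool" where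
  "tree_quiver T \<longleftrightarrow>
     fin_digraph T \<and> connected T \<and>
     \<not> (\<exists>p. pre_digraph.cycle (traversals T) p \<and> distinct (map fst p))"

record ('n, 'e, 'v, 'a) quiver_map =
  vmap :: "'n \<Rightarrow> 'v"
  amap :: "'e \<Rightarrow> 'a"

definition quiver_morphism ::
    "('n, 'e) pre_digraph \<Rightarrow> ('v, 'a) pre_digraph \<Rightarrow> ('n, 'e, 'v, 'a) quiver_map \<Rightarrow> bool" where
  "quiver_morphism T Q F \<longleftrightarrow>
     (\<forall>n \<in> verts T. vmap F n \<in> verts Q) \<and>
     (\<forall>e \<in> arcs T. amap F e \<in> arcs Q \<and>
        tail Q (amap F e) = vmap F (tail T e) \<and> head Q (amap F e) = vmap F (head T e))"

definition map_qpath :: "('n, 'e, 'v, 'a) quiver_map \<Rightarrow> ('n, 'e) qpath \<Rightarrow> ('v, 'a) qpath" where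
  "map_qpath F p = (vmap F (fst p), map (amap F) (snd p))"

definition bound_quiver_morphism ::
    "'k::field itself \<Rightarrow> ('n, 'e) pre_digraph \<Rightarrow> ('v, 'a) pre_digraph \<Rightarrow> ('v, 'a) qpath set
      \<Rightarrow> ('n, 'e, 'v, 'a) quiver_map \<Rightarrow> bool" where
  "bound_quiver_morphism K T Q \<rho> F \<longleftrightarrow>
     quiver_morphism T Q F \<and> (\<forall>p \<in> qpaths T. \<not> path_in_ideal K Q \<rho> (map_qpath F p))"

definition pm_scale :: "'k::field \<Rightarrow> ('n \<Rightarrow>\<^sub>0 'k) \<Rightarrow> ('n \<Rightarrow>\<^sub>0 'k)" where
  "pm_scale c x = Poly_Mapping.map (\<lambda>y. c * y) x"

text \<open>
  The basis vector belonging to a vertex \<open>n\<close> of \<open>T\<close> is \<open>Poly_Mapping.single n 1\<close>.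
\<close>

definition tree_module ::
    "(nat, 'e) pre_digraph \<Rightarrow> (nat, 'e, 'v, 'a) quiver_map \<Rightarrow> ('v, 'a, nat \<Rightarrow>\<^sub>0 'k::field) qrep" where
  "tree_module T F =
     \<lparr>space = (\<lambda>v. {x. Poly_Mapping.keys x \<subseteq> {n \<in> verts T. vmap F n = v}}),
      act = (\<lambda>\<gamma> x. \<Sum>n \<in> Poly_Mapping.keys x. pm_scale (Poly_Mapping.lookup x n)
               (\<Sum>a \<in> {a \<in> arcs T. tail T a = n \<and> amap F a = \<gamma>}. Poly_Mapping.single (head T a) 1))\<rparr>"

lemma lookup_pm_scale: "Poly_Mapping.lookup (pm_scale c x) n = c * Poly_Mapping.lookup x n"
  by (simp add: pm_scale_def Poly_Mapping.map.rep_eq when_def)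

lemma vector_space_pm_scale: "vector_space pm_scale"
  by unfold_locales (auto intro!: poly_mapping_eqI simp: lookup_pm_scale lookup_add algebra_simps)

lemma lookup_act_tree_module:
  fixes x :: "nat \<Rightarrow>\<^sub>0 'k::field"
  assumes "finite (arcs T)"
  shows "Poly_Mapping.lookup (act (tree_module T F) \<gamma> x) m =
    (\<Sum>a \<in> {a \<in> arcs T. head T a = m \<and> amap F a = \<gamma>}. Poly_Mapping.lookup x (tail T a))"
proof -
  let ?A = "{a \<in> arcs T. amap F a = \<gamma>}"
  have fin: "finite ?A" using assms by simp
  have "Poly_Mapping.lookup (act (tree_module T F) \<gamma> x) m =
      (\<Sum>n \<in> Poly_Mapping.keys x. Poly_Mapping.lookup x n *
        (\<Sum>a \<in> {a \<in> arcs T. tail T a = n \<and> amap F a = \<gamma>}. if head T a = m then 1 else 0))"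
    by (simp add: tree_module_def lookup_sum lookup_pm_scale lookup_single when_def)
  also have "\<dots> = (\<Sum>n \<in> Poly_Mapping.keys x. \<Sum>a \<in> ?A.
        if tail T a = n then (if head T a = m then Poly_Mapping.lookup x n else 0) else 0)"
  proof (rule sum.cong[OF refl])
    fix n
    have eq: "{a \<in> arcs T. tail T a = n \<and> amap F a = \<gamma>} = {a \<in> ?A. tail T a = n}" by auto
    show "Poly_Mapping.lookup x n *
        (\<Sum>a \<in> {a \<in> arcs T. tail T a = n \<and> amap F a = \<gamma>}. if head T a = m then 1 else 0) =
      (\<Sum>a \<in> ?A. if tail T a = n then (if head T a = m then Poly_Mapping.lookup x n else 0) else 0)"
      unfolding eq sum.inter_filter[OF fin, symmetric] by (auto simp: sum_distrib_left intro!: sum.cong)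
  qed
  also have "\<dots> = (\<Sum>a \<in> ?A. \<Sum>n \<in> Poly_Mapping.keys x.
        if tail T a = n then (if head T a = m then Poly_Mapping.lookup x n else 0) else 0)"
    by (rule sum.swap)
  also have "\<dots> = (\<Sum>a \<in> ?A. if head T a = m then Poly_Mapping.lookup x (tail T a) else 0)"
    by (rule sum.cong[OF refl]) (auto simp: sum.delta in_keys_iff)
  also have "\<dots> = (\<Sum>a \<in> {a \<in> ?A. head T a = m}. Poly_Mapping.lookup x (tail T a))"
    by (rule sum.inter_filter[OF fin, symmetric])
  also have "{a \<in> ?A. head T a = m} = {a \<in> arcs T. head T a = m \<and> amap F a = \<gamma>}" by auto
  finally show ?thesis .
qed

lemma keys_fold_act_tree_module:
  assumes "fin_digraph T"
    and "m \<in> Poly_Mapping.keys (fold (act (tree_module T F)) p (x :: nat \<Rightarrow>\<^sub>0 'k::field))"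
    and "Poly_Mapping.keys x \<subseteq> verts T"
  shows "\<exists>n q. n \<in> Poly_Mapping.keys x \<and> pre_digraph.awalk T n q m \<and> map (amap F) q = p"
  using assms(2,3)
proof (induction p arbitrary: x)
  case Nil
  then show ?case by (auto simp: pre_digraph.awalk_def pre_digraph.cas.simps)
next
  case (Cons \<gamma> p)
  interpret fin_digraph T by fact
  let ?y = "act (tree_module T F) \<gamma> x"
  have step: "\<exists>a \<in> arcs T. head T a = k \<and> amap F a = \<gamma> \<and> tail T a \<in> Poly_Mapping.keys x"
    if k: "k \<in> Poly_Mapping.keys ?y" for k
  proof (rule ccontr)
    assume "\<not> ?thesis"
    then have "Poly_Mapping.lookup ?y k = 0"
      by (subst lookup_act_tree_module) (auto simp: in_keys_iff intro!: sum.neutral)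
    with k show False by (simp add: in_keys_iff)
  qed
  then have "Poly_Mapping.keys ?y \<subseteq> verts T" by fastforce
  with Cons.IH[of ?y] Cons.prems obtain k q where
    k: "k \<in> Poly_Mapping.keys ?y" "awalk k q m" "map (amap F) q = p" by auto
  from step[OF k(1)] obtain a where
    a: "a \<in> arcs T" "head T a = k" "amap F a = \<gamma>" "tail T a \<in> Poly_Mapping.keys x" by auto
  have "awalk (tail T a) (a # q) m" using a k by (simp add: awalk_Cons_iff)
  with a k show ?case by (intro exI[of _ "tail T a"] exI[of _ "a # q"]) auto
qed

lemma bound_rep_tree_module:
  fixes T :: "(nat, 'e) pre_digraph"
  assumes "zero_relation_quiver TYPE('k::field) Q \<rho>" and "tree_quiver T"
    and F: "bound_quiver_morphism TYPE('k) T Q \<rho> F"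
  shows "bound_rep (pm_scale :: 'k \<Rightarrow> _) Q \<rho> (tree_module T F)"
proof -
  interpret T: fin_digraph T using assms(2) by (simp add: tree_quiver_def)
  interpret pm: vector_space "pm_scale :: 'k \<Rightarrow> (nat \<Rightarrow>\<^sub>0 'k) \<Rightarrow> _" by (rule vector_space_pm_scale)
  have space: "x \<in> space (tree_module T F) v \<longleftrightarrow>
      (\<forall>n. Poly_Mapping.lookup x n \<noteq> 0 \<longrightarrow> n \<in> verts T \<and> vmap F n = v)"
    for x :: "nat \<Rightarrow>\<^sub>0 'k" and v
    by (auto simp: tree_module_def in_keys_iff)
  have hom: "amap F a \<in> arcs Q \<and> head Q (amap F a) = vmap F (head T a)" if "a \<in> arcs T" for a
    using F that by (auto simp: bound_quiver_morphism_def quiver_morphism_def)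
  have "pm.subspace (space (tree_module T F) v)" for v
    by (auto simp: pm.subspace_def space lookup_add lookup_pm_scale)
      (metis add.right_neutral)+
  moreover have "act (tree_module T F) \<gamma> x \<in> space (tree_module T F) (head Q \<gamma>)"
    for \<gamma> and x :: "nat \<Rightarrow>\<^sub>0 'k"
    unfolding space
  proof (intro allI impI)
    fix n assume "Poly_Mapping.lookup (act (tree_module T F) \<gamma> x) n \<noteq> 0"
    then obtain a where "a \<in> arcs T" "head T a = n" "amap F a = \<gamma>"
      unfolding lookup_act_tree_module[OF T.finite_arcs]
      by (auto elim!: sum.not_neutral_contains_not_neutral)
    with hom[of a] show "n \<in> verts T \<and> vmap F n = head Q \<gamma>" by auto
  qed
  moreover have "act (tree_module T F) \<gamma> (x + y) =
      act (tree_module T F) \<gamma> x + act (tree_module T F) \<gamma> y" for \<gamma> and x y :: "nat \<Rightarrow>\<^sub>0 'k"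
    by (rule poly_mapping_eqI) (simp add: lookup_act_tree_module lookup_add sum.distrib)
  moreover have "act (tree_module T F) \<gamma> (pm_scale c x) = pm_scale c (act (tree_module T F) \<gamma> x)"
    for \<gamma> c and x :: "nat \<Rightarrow>\<^sub>0 'k"
    by (rule poly_mapping_eqI)
      (simp add: lookup_act_tree_module lookup_pm_scale sum_distrib_left)
  moreover have "fold (act (tree_module T F)) p x = 0"
    if r: "(u, p) \<in> \<rho>" and x: "x \<in> space (tree_module T F) u"
    for u p and x :: "nat \<Rightarrow>\<^sub>0 'k"
  proof (rule ccontr)
    assume "fold (act (tree_module T F)) p x \<noteq> 0"
    then obtain m where "m \<in> Poly_Mapping.keys (fold (act (tree_module T F)) p x)" by fastforce
    moreover have "Poly_Mapping.keys x \<subseteq> verts T" using x by (auto simp: tree_module_def)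
    ultimately obtain n q where nq: "n \<in> Poly_Mapping.keys x" "pre_digraph.awalk T n q m"
        "map (amap F) q = p"
      using keys_fold_act_tree_module[OF T.fin_digraph] by blast
    have "vmap F n = u" using nq(1) x by (auto simp: tree_module_def)
    then have "path_in_ideal TYPE('k) Q \<rho> (map_qpath F (n, q))"
      using r nq(3) by (auto simp: path_in_ideal_def map_qpath_def intro: path_ideal.gen)
    moreover have "(n, q) \<in> qpaths T" using nq(2) by (auto simp: qpaths_def)
    ultimately show False using F by (auto simp: bound_quiver_morphism_def)
  qed
  ultimately show ?thesis
    unfolding bound_rep_def using vector_space_pm_scale by auto
qed


section \<open>Networks\<close>

record ('x, 'e) network = "('x, 'e) pre_digraph" +
  edges :: "'x set set"

definition link :: "('x, 'e) network \<Rightarrow> 'x \<Rightarrow> 'x \<Rightarrow> bool" where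
  "link N x y \<longleftrightarrow>
     (\<exists>a \<in> arcs N. (tail N a = x \<and> head N a = y) \<or> (tail N a = y \<and> head N a = x)) \<or>
     {x, y} \<in> edges N"

definition subnetwork :: "('x, 'e) network \<Rightarrow> ('x, 'e) network \<Rightarrow> bool" where
  "subnetwork M N \<longleftrightarrow>
     verts M \<subseteq> verts N \<and> arcs M \<subseteq> arcs N \<and> edges M \<subseteq> edges N \<and>
     tail M = tail N \<and> head M = head N \<and>
     (\<forall>a \<in> arcs M. tail M a \<in> verts M \<and> head M a \<in> verts M) \<and>
     (\<forall>e \<in> edges M. e \<subseteq> verts M)"

definition connected_network :: "('x, 'e) network \<Rightarrow> bool" where
  "connected_network N \<longleftrightarrow> (\<forall>x \<in> verts N. \<forall>y \<in> verts N. (link N)\<^sup>*\<^sup>* x y)"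

definition pullback_network ::
    "(nat, 'e1) pre_digraph \<Rightarrow> (nat, 'e1, 'v, 'a) quiver_map \<Rightarrow>
     (nat, 'e2) pre_digraph \<Rightarrow> (nat, 'e2, 'v, 'a) quiver_map \<Rightarrow> (nat \<times> nat, 'e1 \<times> 'e2) network"
  where
  "pullback_network T\<^sub>1 F\<^sub>1 T\<^sub>2 F\<^sub>2 =
     \<lparr>verts = {(n, m). n \<in> verts T\<^sub>1 \<and> m \<in> verts T\<^sub>2 \<and> vmap F\<^sub>1 n = vmap F\<^sub>2 m},
      arcs = {(a, b). a \<in> arcs T\<^sub>1 \<and> b \<in> arcs T\<^sub>2 \<and> amap F\<^sub>1 a = amap F\<^sub>2 b},
      tail = (\<lambda>(a, b). (tail T\<^sub>1 a, tail T\<^sub>2 b)),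
      head = (\<lambda>(a, b). (head T\<^sub>1 a, head T\<^sub>2 b)),
      edges =
        {{(n, m), (n', m)} |n n' m.
           n \<in> verts T\<^sub>1 \<and> n' \<in> verts T\<^sub>1 \<and> m \<in> verts T\<^sub>2 \<and>
           vmap F\<^sub>1 n = vmap F\<^sub>2 m \<and> vmap F\<^sub>1 n' = vmap F\<^sub>2 m \<and> n \<noteq> n' \<and>
           (\<exists>a \<in> arcs T\<^sub>1. \<exists>b \<in> arcs T\<^sub>1. tail T\<^sub>1 a = tail T\<^sub>1 b \<and>
              head T\<^sub>1 a = n \<and> head T\<^sub>1 b = n' \<and> amap F\<^sub>1 a = amap F\<^sub>1 b)} \<union>
        {{(n, m), (n, m')} |n m m'.
           n \<in> verts T\<^sub>1 \<and> m \<in> verts T\<^sub>2 \<and> m' \<in> verts T\<^sub>2 \<and>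
           vmap F\<^sub>1 n = vmap F\<^sub>2 m \<and> vmap F\<^sub>1 n = vmap F\<^sub>2 m' \<and> m \<noteq> m' \<and>
           (\<exists>c \<in> arcs T\<^sub>2. \<exists>d \<in> arcs T\<^sub>2. head T\<^sub>2 c = head T\<^sub>2 d \<and>
              tail T\<^sub>2 c = m \<and> tail T\<^sub>2 d = m' \<and> amap F\<^sub>2 c = amap F\<^sub>2 d)}\<rparr>"

definition covering_network ::
    "(nat, 'e1) pre_digraph \<Rightarrow> (nat, 'e1, 'v, 'a) quiver_map \<Rightarrow>
     (nat, 'e2) pre_digraph \<Rightarrow> (nat, 'e2, 'v, 'a) quiver_map \<Rightarrow>
     (nat \<times> nat \<times> int, 'e1 \<times> 'e2 \<times> int) network" where
  "covering_network T\<^sub>1 F\<^sub>1 T\<^sub>2 F\<^sub>2 =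
     (let N = pullback_network T\<^sub>1 F\<^sub>1 T\<^sub>2 F\<^sub>2 in
      \<lparr>verts = {(n, m, j). (n, m) \<in> verts N \<and> j \<in> {-1, 1}},
       arcs = {(a, b, j). (a, b) \<in> arcs N \<and> j \<in> {-1, 1}},
       tail = (\<lambda>(a, b, j). (tail T\<^sub>1 a, tail T\<^sub>2 b, j)),
       head = (\<lambda>(a, b, j). (head T\<^sub>1 a, head T\<^sub>2 b, j)),
       edges = {{(n, m, j), (n', m', - j)} |n m n' m' j.
                  {(n, m), (n', m')} \<in> edges N \<and> j \<in> {-1, 1}}\<rparr>)"

definition proj :: "nat \<times> nat \<times> int \<Rightarrow> nat \<times> nat" where
  "proj = (\<lambda>(n, m, j). (n, m))"

definition complete_subnetwork ::
    "(nat, 'e1) pre_digraph \<Rightarrow> (nat, 'e1, 'v, 'a) quiver_map \<Rightarrow>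
     (nat, 'e2) pre_digraph \<Rightarrow> (nat, 'e2, 'v, 'a) quiver_map \<Rightarrow>
     (nat \<times> nat \<times> int, 'e1 \<times> 'e2 \<times> int) network \<Rightarrow> bool" where
  "complete_subnetwork T\<^sub>1 F\<^sub>1 T\<^sub>2 F\<^sub>2 M \<longleftrightarrow>
     (\<forall>(n, m, j) \<in> verts M.
        (\<forall>a \<in> arcs T\<^sub>1. head T\<^sub>1 a = n \<longrightarrow>
           (\<exists>b \<in> arcs T\<^sub>2. head T\<^sub>2 b = m \<and> (a, b, j) \<in> arcs M) \<or>
           (\<exists>c \<in> arcs T\<^sub>1. tail T\<^sub>1 c = tail T\<^sub>1 a \<and> amap F\<^sub>1 a = amap F\<^sub>1 c \<and>
              (head T\<^sub>1 c, m, - j) \<in> verts M \<and>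
              {(n, m, j), (head T\<^sub>1 c, m, - j)} \<in> edges M)) \<and>
        (\<forall>b \<in> arcs T\<^sub>2. tail T\<^sub>2 b = m \<longrightarrow>
           (\<exists>a \<in> arcs T\<^sub>1. tail T\<^sub>1 a = n \<and> (a, b, j) \<in> arcs M) \<or>
           (\<exists>d \<in> arcs T\<^sub>2. head T\<^sub>2 d = head T\<^sub>2 b \<and> amap F\<^sub>2 b = amap F\<^sub>2 d \<and>
              (n, tail T\<^sub>2 d, - j) \<in> verts M \<and>
              {(n, m, j), (n, tail T\<^sub>2 d, - j)} \<in> edges M)))"

definition R2_free ::
    "(nat, 'e1) pre_digraph \<Rightarrow> (nat, 'e1, 'v, 'a) quiver_map \<Rightarrow>
     (nat, 'e2) pre_digraph \<Rightarrow> (nat, 'e2, 'v, 'a) quiver_map \<Rightarrow>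
     (nat \<times> nat \<times> int, 'e1 \<times> 'e2 \<times> int) network \<Rightarrow> bool" where
  "R2_free T\<^sub>1 F\<^sub>1 T\<^sub>2 F\<^sub>2 M \<longleftrightarrow>
     (let N = pullback_network T\<^sub>1 F\<^sub>1 T\<^sub>2 F\<^sub>2 in
      \<not> (\<exists>x \<in> verts M. \<exists>y \<in> verts M. \<exists>z \<in> verts M.
           link M x y \<and> link M y z \<and>
           proj x \<noteq> proj y \<and> proj y \<noteq> proj z \<and> proj x \<noteq> proj z \<and>
           link N (proj x) (proj y) \<and> link N (proj y) (proj z) \<and> link N (proj x) (proj z)))"

definition involution_free :: "(nat \<times> nat \<times> int, 'e) network \<Rightarrow> bool" where
  "involution_free M \<longleftrightarrow> (\<forall>(n, m, j) \<in> verts M. (n, m, - j) \<notin> verts M)"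

definition involution_invariant ::
    "(nat \<times> nat \<times> int, 'e) network \<Rightarrow> (nat \<times> nat \<times> int, 'e) network \<Rightarrow> bool" where
  "involution_invariant N M \<longleftrightarrow> verts M = {x \<in> verts N. proj x \<in> proj ` verts M}"

definition generalised_graph_map ::
    "(nat, 'e1) pre_digraph \<Rightarrow> (nat, 'e1, 'v, 'a) quiver_map \<Rightarrow>
     (nat, 'e2) pre_digraph \<Rightarrow> (nat, 'e2, 'v, 'a) quiver_map \<Rightarrow>
     (nat \<times> nat \<times> int, 'e1 \<times> 'e2 \<times> int) network \<Rightarrow> bool" where
  "generalised_graph_map T\<^sub>1 F\<^sub>1 T\<^sub>2 F\<^sub>2 M \<longleftrightarrow>
     subnetwork M (covering_network T\<^sub>1 F\<^sub>1 T\<^sub>2 F\<^sub>2) \<and> verts M \<noteq> {} \<and> connected_network M \<and>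
     involution_free M \<and> complete_subnetwork T\<^sub>1 F\<^sub>1 T\<^sub>2 F\<^sub>2 M \<and> R2_free T\<^sub>1 F\<^sub>1 T\<^sub>2 F\<^sub>2 M"

definition ghost ::
    "(nat, 'e1) pre_digraph \<Rightarrow> (nat, 'e1, 'v, 'a) quiver_map \<Rightarrow>
     (nat, 'e2) pre_digraph \<Rightarrow> (nat, 'e2, 'v, 'a) quiver_map \<Rightarrow>
     (nat \<times> nat \<times> int, 'e1 \<times> 'e2 \<times> int) network \<Rightarrow> bool" where
  "ghost T\<^sub>1 F\<^sub>1 T\<^sub>2 F\<^sub>2 M \<longleftrightarrow>
     subnetwork M (covering_network T\<^sub>1 F\<^sub>1 T\<^sub>2 F\<^sub>2) \<and> verts M \<noteq> {} \<and> connected_network M \<and>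
     involution_invariant (covering_network T\<^sub>1 F\<^sub>1 T\<^sub>2 F\<^sub>2) M \<and>
     complete_subnetwork T\<^sub>1 F\<^sub>1 T\<^sub>2 F\<^sub>2 M \<and> R2_free T\<^sub>1 F\<^sub>1 T\<^sub>2 F\<^sub>2 M"

definition ghost_free ::
    "(nat, 'e1) pre_digraph \<Rightarrow> (nat, 'e1, 'v, 'a) quiver_map \<Rightarrow>
     (nat, 'e2) pre_digraph \<Rightarrow> (nat, 'e2, 'v, 'a) quiver_map \<Rightarrow> bool" where
  "ghost_free T\<^sub>1 F\<^sub>1 T\<^sub>2 F\<^sub>2 \<longleftrightarrow> \<not> (\<exists>M. ghost T\<^sub>1 F\<^sub>1 T\<^sub>2 F\<^sub>2 M)"

end

theory Submission
  imports Defs "HOL-Library.Function_Algebras"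
begin

text \<open>
  An endomorphism of the tree module is a matrix \<open>f\<close> indexed by the vertices of \<open>T\<close>, subject to one
  linear equation for each pair of vertices \<open>p\<close>, \<open>q\<close> and each arrow \<open>\<gamma>\<close>; the coordinates occurring in
  one equation form a clique of the pullback network.  The support of an endomorphism never meets an
  equation in exactly one coordinate.  Conversely, if a non-empty set of coordinates has this
  property, then pairing off the signed coordinates of each equation yields a complete
  \<open>R[2]\<close>-free subnetwork over it.  Adding up the signs over a component gives an integral
  endomorphism with entries \<open>-1, 0, 1\<close>.  If it vanishes, the component is a ghost.
  Otherwise pairing off its positive and negative terms yields a generalised graph map inside
  its support.  So without ghosts, all endomorphisms are linear combinations of integral ones, and
  their supports are covered by generalised graph maps.

  Condition (1) then makes the diagonal of an endomorphism constant, and condition (2) makes the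
  diagonal entry multiplicative.  Over the rationals, the endomorphisms with zero diagonal form an
  algebra of matrices of trace zero, which is nilpotent; by integrality this carries over to any
  field.  Of the two projections of a direct decomposition, one has zero diagonal, hence vanishes.
\<close>

text \<open>The sign of a lift is a coefficient: the two lifts of a coordinate stand for the entries
  1 and -1. Arrows of the covering network join terms on opposite sides of an equation and keep the
  sign, edges join terms on one side and reverse it. \<open>R[2]\<close>-freeness reflects that a
  vertex has a single partner in each equation; that triangles do not mix equations is where the
  absence of cycles in \<open>T\<close> enters. The obstacle is that a component of the first
  pairing may contain both lifts of some coordinates and only one lift of others, so that it is
  neither a ghost nor a graph map. Its sign sum forgets the doubled coordinates, and a second
  pairing, carried out on that sum, can no longer produce both lifts. Entries 1 and -1 serve as
  pivots over every field; this is what reduces arbitrary endomorphisms to integral ones and lets a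
  trace argument from characteristic zero act on all of them.\<close>

lemma derangement_exists:
  assumes "finite A" "card A \<noteq> 1"
  shows "\<exists>\<sigma>. bij_betw \<sigma> A A \<and> (\<forall>x\<in>A. \<sigma> x \<noteq> x)"
proof -
  define n where "n = card A"
  obtain h where h: "bij_betw h {0..<n} A"
    using ex_bij_betw_nat_finite[OF assms(1)] n_def by blast
  define s where "s = (\<lambda>i. (i + 1) mod n)"
  have s: "s i < n" "s i \<noteq> i" if "i < n" for i
  proof -
    have "n \<ge> 2" using that assms(2) n_def by linarith
    then show "s i < n" by (simp add: s_def)
    show "s i \<noteq> i" using \<open>n \<ge> 2\<close> that by (cases "i + 1 = n") (auto simp: s_def)
  qed
  have "inj_on s {0..<n}"
  proof (rule inj_onI)
    fix i j assume "i \<in> {0..<n}" "j \<in> {0..<n}" "s i = s j"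
    then show "i = j" unfolding s_def
      by (cases "i + 1 = n"; cases "j + 1 = n") auto
  qed
  moreover have "s ` {0..<n} \<subseteq> {0..<n}" using s by auto
  ultimately have sb: "bij_betw s {0..<n} {0..<n}"
    by (simp add: bij_betw_def endo_inj_surj)
  define g where "g = inv_into {0..<n} h"
  have g: "bij_betw g A {0..<n}" unfolding g_def by (rule bij_betw_inv_into[OF h])
  have "bij_betw (h \<circ> s \<circ> g) A A"
    using bij_betw_trans[OF bij_betw_trans[OF g sb] h] by (simp add: comp_assoc)
  moreover have "(h \<circ> s \<circ> g) x \<noteq> x" if "x \<in> A" for x
  proof
    assume eq: "(h \<circ> s \<circ> g) x = x"
    have gx: "g x \<in> {0..<n}" using g that by (auto simp: bij_betw_def)
    have "h (g x) = x" unfolding g_def using h that by (simp add: bij_betw_inv_into_right)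
    with eq have "h (s (g x)) = h (g x)" by simp
    then have "s (g x) = g x" using h gx s(1)[of "g x"] by (auto simp: bij_betw_def inj_on_def)
    with s(2)[of "g x"] gx show False by simp
  qed
  ultimately show ?thesis by blast
qed

subsection \<open>Matrices over a finite index set\<close>

definition mscale :: "'k::comm_ring_1 \<Rightarrow> ('i \<Rightarrow> 'i \<Rightarrow> 'k) \<Rightarrow> ('i \<Rightarrow> 'i \<Rightarrow> 'k)" where
  "mscale c f = (\<lambda>n m. c * f n m)"

definition mmul :: "'i set \<Rightarrow> ('i \<Rightarrow> 'i \<Rightarrow> 'k::comm_ring_1) \<Rightarrow> ('i \<Rightarrow> 'i \<Rightarrow> 'k) \<Rightarrow> ('i \<Rightarrow> 'i \<Rightarrow> 'k)" where
  "mmul V f g = (\<lambda>n m. \<Sum>k\<in>V. f n k * g k m)"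

definition mone :: "'i set \<Rightarrow> 'i \<Rightarrow> 'i \<Rightarrow> 'k::comm_ring_1" where
  "mone V = (\<lambda>n m. if n = m \<and> n \<in> V then 1 else 0)"

text \<open>Matrices are total functions, so that addition is the pointwise one of function spaces.
  Vanishing outside \<open>V\<close> is therefore a separate predicate; it is what makes
  \<open>mone V\<close> neutral for \<open>mmul V\<close>.\<close>

definition supported :: "'i set \<Rightarrow> ('i \<Rightarrow> 'i \<Rightarrow> 'k::comm_ring_1) \<Rightarrow> bool" where
  "supported V f \<longleftrightarrow> (\<forall>n m. f n m \<noteq> 0 \<longrightarrow> n \<in> V \<and> m \<in> V)"

definition mpow :: "'i set \<Rightarrow> ('i \<Rightarrow> 'i \<Rightarrow> 'k::comm_ring_1) \<Rightarrow> nat \<Rightarrow> ('i \<Rightarrow> 'i \<Rightarrow> 'k)" where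
  "mpow V X k = (mmul V X ^^ k) (mone V)"

interpretation mat: vector_space "mscale :: 'k::field \<Rightarrow> ('i \<Rightarrow> 'i \<Rightarrow> 'k) \<Rightarrow> _"
  by unfold_locales (auto simp: mscale_def fun_eq_iff algebra_simps)

lemma mmul_assoc: "finite V \<Longrightarrow> mmul V (mmul V f g) h = mmul V f (mmul V g h)"
  unfolding mmul_def
  by (auto simp: fun_eq_iff sum_distrib_left sum_distrib_right mult.assoc intro: sum.swap)

lemma mmul_add_left: "mmul V (f + g) h = mmul V f h + mmul V g h"
  by (auto simp: mmul_def fun_eq_iff sum.distrib algebra_simps)

lemma mmul_add_right: "mmul V h (f + g) = mmul V h f + mmul V h g"
  by (auto simp: mmul_def fun_eq_iff sum.distrib algebra_simps)

lemma mmul_diff_right: "mmul V h (f - g) = mmul V h f - mmul V h g"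
  by (auto simp: mmul_def fun_eq_iff sum_subtractf algebra_simps)

lemma mmul_scale_left: "mmul V (mscale c f) h = mscale c (mmul V f h)"
  by (auto simp: mmul_def mscale_def fun_eq_iff sum_distrib_left mult.assoc)

lemma mmul_scale_right: "mmul V h (mscale c f) = mscale c (mmul V h f)"
  by (auto simp: mmul_def mscale_def fun_eq_iff sum_distrib_left algebra_simps)

lemma mmul_zero_left [simp]: "mmul V 0 h = 0"
  by (auto simp: mmul_def fun_eq_iff)

lemma mmul_zero_right [simp]: "mmul V h 0 = 0"
  by (auto simp: mmul_def fun_eq_iff)

lemma mmul_one_left:
  assumes "finite V" "supported V f"
  shows "mmul V (mone V) f = f"
proof (intro ext)
  fix n m
  have "mmul V (mone V) f n m = (\<Sum>k\<in>V. if k = n then f n m else 0)"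
    unfolding mmul_def mone_def by (rule sum.cong) auto
  then show "mmul V (mone V) f n m = f n m"
    using assms by (auto simp: sum.delta' supported_def)
qed

lemma mmul_one_right:
  assumes "finite V" "supported V f"
  shows "mmul V f (mone V) = f"
proof (intro ext)
  fix n m
  have "mmul V f (mone V) n m = (\<Sum>k\<in>V. if k = m then f n m else 0)"
    unfolding mmul_def mone_def by (rule sum.cong) auto
  then show "mmul V f (mone V) n m = f n m"
    using assms by (auto simp: sum.delta' supported_def)
qed

lemma supported_mone: "supported V (mone V)"
  by (auto simp: supported_def mone_def)

lemma supported_mmul: "supported V f \<Longrightarrow> supported V g \<Longrightarrow> supported V (mmul V f g)"
  unfolding supported_def mmul_def by (metis (no_types, lifting) mult_not_zero sum.neutral)

lemma mpow_0 [simp]: "mpow V X 0 = mone V" by (simp add: mpow_def)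
lemma mpow_Suc: "mpow V X (Suc k) = mmul V X (mpow V X k)" by (simp add: mpow_def)

lemma supported_mpow: "supported V X \<Longrightarrow> supported V (mpow V X k)"
  by (induction k) (auto simp: mpow_Suc supported_mmul supported_mone)

lemma mpow_add:
  assumes "finite V" "supported V X"
  shows "mpow V X (i + j) = mmul V (mpow V X i) (mpow V X j)"
  by (induction i) (auto simp: mpow_Suc assms mmul_assoc mmul_one_left supported_mpow)

text \<open>Removing the rank one idempotent through a non-zero entry clears one more column.\<close>

lemma idempotent_trace:
  fixes E :: "'i \<Rightarrow> 'i \<Rightarrow> 'k::field"
  assumes "finite V" "supported V E" "mmul V E E = E"
  shows "\<exists>r. (\<Sum>n\<in>V. E n n) = of_nat r \<and> (r = 0 \<longrightarrow> E = 0)"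
  using assms(2,3)
proof (induction "card {n \<in> V. \<exists>m. E m n \<noteq> 0}" arbitrary: E rule: less_induct)
  case less
  show ?case
  proof (cases "E = 0")
    case True
    then show ?thesis by (intro exI[of _ 0]) auto
  next
    case False
    then obtain i j where ij: "E i j \<noteq> 0" by (auto simp: fun_eq_iff)
    with less.prems have iV: "i \<in> V" "j \<in> V" by (auto simp: supported_def)
    have EE: "(\<Sum>k\<in>V. E n k * E k m) = E n m" for n m
      using less.prems(2) by (auto simp: mmul_def fun_eq_iff)
    define E' where "E' = (\<lambda>n m. E n m - E n j * E i m / E i j)"
    have supp: "supported V E'"
      using less.prems(1) unfolding supported_def E'_def by (metis diff_0 divide_eq_0_iff mult_eq_0_iff neg_equal_0_iff_equal)
    \<comment> \<open>The subtracted matrix \<open>R\<close>, with entries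
      \<open>E n j * E i m / E i j\<close>, satisfies \<open>E R = R E = R\<close> and
      \<open>R R = R\<close>, all by \<open>EE\<close>; hence \<open>E - R\<close> is
      idempotent.\<close>
    have idem: "mmul V E' E' = E'"
    proof (intro ext)
      fix n m
      have "mmul V E' E' n m =
          (\<Sum>k\<in>V. E n k * E k m) - (\<Sum>k\<in>V. E n k * E k j) * E i m / E i j
          - E n j / E i j * (\<Sum>k\<in>V. E i k * E k m)
          + E n j / E i j * E i m / E i j * (\<Sum>k\<in>V. E i k * E k j)"
        unfolding mmul_def E'_def
        by (simp add: sum_distrib_left sum_distrib_right sum_divide_distrib
            flip: sum_subtractf sum.distrib) (rule sum.cong, simp_all add: field_simps ij)
      also have "\<dots> = E' n m"
        unfolding EE E'_def using ij by (simp add: field_simps)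
      finally show "mmul V E' E' n m = E' n m" .
    qed
    have "{n \<in> V. \<exists>m. E' m n \<noteq> 0} \<subseteq> {n \<in> V. \<exists>m. E m n \<noteq> 0}"
    proof (intro subsetI CollectI conjI)
      fix x assume x: "x \<in> {n \<in> V. \<exists>m. E' m n \<noteq> 0}"
      then show "x \<in> V" by simp
      from x obtain m where "E' m x \<noteq> 0" by blast
      then have "E m x \<noteq> 0 \<or> E i x \<noteq> 0" by (auto simp: E'_def)
      then show "\<exists>m. E m x \<noteq> 0" by blast
    qed
    moreover have "j \<notin> {n \<in> V. \<exists>m. E' m n \<noteq> 0}" using ij by (auto simp: E'_def)
    moreover have "j \<in> {n \<in> V. \<exists>m. E m n \<noteq> 0}" using ij iV by auto
    ultimately have "{n \<in> V. \<exists>m. E' m n \<noteq> 0} \<subset> {n \<in> V. \<exists>m. E m n \<noteq> 0}" by blast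
    then have "card {n \<in> V. \<exists>m. E' m n \<noteq> 0} < card {n \<in> V. \<exists>m. E m n \<noteq> 0}"
      using assms(1) by (intro psubset_card_mono) auto
    from less.hyps[OF this supp idem] obtain r where r: "(\<Sum>n\<in>V. E' n n) = of_nat r" by blast
    \<comment> \<open>The trace of the subtracted matrix is the entry \<open>(i, j)\<close> of
      \<open>E E\<close> divided by \<open>E i j\<close>, that is 1. So the trace counts the
      removals.\<close>
    have "(\<Sum>n\<in>V. E' n n) = (\<Sum>n\<in>V. E n n) - (\<Sum>n\<in>V. E i n * E n j) / E i j"
      by (simp add: E'_def sum_subtractf sum_divide_distrib mult.commute)
    also have "\<dots> = (\<Sum>n\<in>V. E n n) - 1" using ij by (simp only: EE) simp
    finally have "of_nat r = (\<Sum>n\<in>V. E n n) - 1" by (simp only: r)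
    then have "(\<Sum>n\<in>V. E n n) = of_nat (Suc r)" by (simp add: algebra_simps)
    then show ?thesis by (intro exI[of _ "Suc r"]) auto
  qed
qed

section \<open>Stationary chains of subspaces\<close>

context vector_space
begin

text \<open>An index of minimal dimension works: a vector lost in the next step could be added to a
  basis of the smaller space, making it too large. One coincidence of neighbours is enough for the
  applications, as the indexing of the chain can be chosen freely.\<close>

lemma descending_chain_of_subspaces:
  assumes "finite B" and sub: "\<And>k::nat. subspace (U k)" and le: "\<And>k. U k \<subseteq> span B"
    and dec: "\<And>k. U (Suc k) \<subseteq> U k"
  shows "\<exists>k. U (Suc k) = U k"
proof -
  obtain k where k: "\<And>j. dim (U k) \<le> dim (U j)"
    using ex_has_least_nat[of "\<lambda>_. True" 0 "\<lambda>k. dim (U k)"] by auto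
  obtain C where C: "C \<subseteq> U k" "independent C" "U k \<subseteq> span C" "card C = dim (U k)"
    using basis_exists by blast
  obtain C' where C': "C' \<subseteq> U (Suc k)" "independent C'" "U (Suc k) \<subseteq> span C'" "card C' = dim (U (Suc k))"
    using basis_exists by blast
  have finC: "finite C" using independent_span_bound[OF assms(1) C(2)] C(1) le by blast
  have finC': "finite C'" using independent_span_bound[OF assms(1) C'(2)] C'(1) le by blast
  have span': "span C' = U (Suc k)" using C' sub by (metis span_minimal subset_antisym)
  have "U k \<subseteq> U (Suc k)"
  proof
    fix u assume u: "u \<in> U k"
    show "u \<in> U (Suc k)"
    proof (rule ccontr)
      assume "u \<notin> U (Suc k)"
      then have nu: "u \<notin> span C'" by (simp add: span')
      then have ind: "independent (insert u C')" using C'(2) independent_insert[of u C'] by simp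
      have "insert u C' \<subseteq> span C" using u C(3) C'(1) dec[of k] by blast
      then have "card (insert u C') \<le> card C" using independent_span_bound[OF finC ind] by blast
      moreover have "u \<notin> C'" using nu span_base by blast
      ultimately have "Suc (card C') \<le> card C" using finC' by simp
      then show False using C(4) C'(4) k[of "Suc k"] by simp
    qed
  qed
  with dec show ?thesis by blast
qed

end

definition unit_mats :: "'i set \<Rightarrow> ('i \<Rightarrow> 'i \<Rightarrow> 'k::field) set" where
  "unit_mats V = (\<lambda>(i, j) n m. if n = i \<and> m = j then 1 else 0) ` (V \<times> V)"

lemma finite_unit_mats: "finite V \<Longrightarrow> finite (unit_mats V)"
  by (simp add: unit_mats_def)

lemma sum_fun_apply2: "(\<Sum>i\<in>I. f i) n m = (\<Sum>i\<in>I. f i n m)"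
  by (induction I rule: infinite_finite_induct) auto

lemma supported_in_span:
  assumes "finite V" "supported V (f :: 'i \<Rightarrow> 'i \<Rightarrow> 'k::field)"
  shows "f \<in> mat.span (unit_mats V)"
proof -
  have "f = (\<Sum>(i,j)\<in>V\<times>V. mscale (f i j) (\<lambda>n m. if n = i \<and> m = j then 1 else 0))"
  proof (intro ext)
    fix n m
    have "(\<Sum>(i,j)\<in>V\<times>V. mscale (f i j) (\<lambda>n m. if n = i \<and> m = j then 1 else 0)) n m
        = (\<Sum>x\<in>V\<times>V. if x = (n, m) then f n m else 0)"
      unfolding sum_fun_apply2 by (rule sum.cong) (auto simp: mscale_def split: if_splits)
    also have "\<dots> = f n m" using assms by (auto simp: sum.delta' supported_def)
    finally show "f n m = (\<Sum>(i,j)\<in>V\<times>V. mscale (f i j) (\<lambda>n m. if n = i \<and> m = j then 1 else 0)) n m" by simp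
  qed
  also have "\<dots> \<in> mat.span (unit_mats V)"
  proof (intro mat.span_sum, clarify)
    fix i j assume "i \<in> V" "j \<in> V"
    then have "(\<lambda>n m. if n = i \<and> m = j then 1 else 0 :: 'k) \<in> unit_mats V"
      unfolding unit_mats_def by (intro image_eqI[of _ _ "(i, j)"]) auto
    then show "mscale (f i j) (\<lambda>n m. if n = i \<and> m = j then 1 else 0) \<in> mat.span (unit_mats V)"
      by (intro mat.span_scale mat.span_base)
  qed
  finally show ?thesis .
qed

lemma subspace_supported: "mat.subspace {f. supported V f}"
  unfolding mat.subspace_def supported_def
  by (auto simp: mscale_def) (metis add.right_neutral)+

definition mat_algebra :: "'i set \<Rightarrow> ('i \<Rightarrow> 'i \<Rightarrow> 'k::field) set \<Rightarrow> bool" where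
  "mat_algebra V A \<longleftrightarrow> mat.subspace A \<and> (\<forall>f\<in>A. supported V f) \<and> (\<forall>f\<in>A. \<forall>g\<in>A. mmul V f g \<in> A)"

text \<open>Since the spans of the high powers of \<open>X\<close> stabilise, \<open>X^s = X^(2s) Z\<close> for some polynomial \<open>Z\<close>
  in \<open>X\<close>; then \<open>X^s Z\<close> is an idempotent, of trace zero, that fixes \<open>X^s\<close>.\<close>

lemma traceless_algebra_nil:
  fixes A :: "('i \<Rightarrow> 'i \<Rightarrow> 'k::field_char_0) set"
  assumes fin: "finite V" and A: "mat_algebra V A" and tr: "\<And>f. f \<in> A \<Longrightarrow> (\<Sum>n\<in>V. f n n) = 0"
    and X: "X \<in> A"
  shows "\<exists>s. mpow V X s = 0"
proof -
  have sX: "supported V X" using A X by (auto simp: mat_algebra_def)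
  have subA: "mat.subspace A" using A by (auto simp: mat_algebra_def)
  have powA: "mpow V X (Suc i) \<in> A" for i
  proof (induction i)
    case 0 then show ?case using X by (simp add: mpow_Suc mmul_one_right fin sX)
  next
    case (Suc i) then show ?case using A X by (subst mpow_Suc) (auto simp: mat_algebra_def)
  qed
  define U where "U = (\<lambda>k. mat.span {mpow V X i |i. i \<ge> k})"
  \<comment> \<open>Along powers of two, one coincidence of neighbours already reads
    \<open>U (2 * s) = U s\<close>, and \<open>s\<close> is positive automatically.\<close>
  have "\<exists>k. U (2 ^ Suc k) = U (2 ^ k)"
  proof (rule mat.descending_chain_of_subspaces[of "unit_mats V"])
    show "finite (unit_mats V)" using fin by (rule finite_unit_mats)
    show "mat.subspace (U (2 ^ k))" for k by (simp add: U_def)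
    show "U (2 ^ k) \<subseteq> mat.span (unit_mats V)" for k
      unfolding U_def by (rule mat.span_minimal) (auto intro!: supported_in_span supported_mpow fin sX)
    show "U (2 ^ Suc k) \<subseteq> U (2 ^ k)" for k
      unfolding U_def by (rule mat.span_mono) (auto intro: order_trans)
  qed
  then obtain s where s: "U (2 * s) = U s" "s \<ge> 1"
    by (metis power_Suc one_le_numeral one_le_power)
  have "mpow V X s \<in> U s" unfolding U_def by (rule mat.span_base) auto
  then have "mpow V X s \<in> U (2 * s)" using s by simp
  moreover
  define Zs where "Zs = mat.span (range (mpow V X))"
  have "mat.span {mpow V X i |i. i \<ge> 2 * s} \<subseteq> (\<lambda>Z. mmul V (mpow V X (2 * s)) Z) ` Zs"
  proof (rule mat.span_minimal)
    show "{mpow V X i |i. i \<ge> 2 * s} \<subseteq> (\<lambda>Z. mmul V (mpow V X (2 * s)) Z) ` Zs"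
    proof clarify
      fix i assume "2 * s \<le> i"
      then have "mpow V X i = mmul V (mpow V X (2 * s)) (mpow V X (i - 2 * s))"
        by (subst mpow_add[symmetric]) (auto simp: fin sX)
      then show "mpow V X i \<in> (\<lambda>Z. mmul V (mpow V X (2 * s)) Z) ` Zs"
        unfolding Zs_def by (auto intro!: image_eqI mat.span_base)
    qed
    have sZ: "mat.subspace Zs" by (simp add: Zs_def)
    show "mat.subspace ((\<lambda>Z. mmul V (mpow V X (2 * s)) Z) ` Zs)"
      unfolding mat.subspace_def
    proof (intro conjI ballI allI)
      show "0 \<in> (\<lambda>Z. mmul V (mpow V X (2 * s)) Z) ` Zs"
        using mat.subspace_0[OF sZ] by (metis image_eqI mmul_zero_right)
    next
      fix x y assume "x \<in> (\<lambda>Z. mmul V (mpow V X (2 * s)) Z) ` Zs" "y \<in> (\<lambda>Z. mmul V (mpow V X (2 * s)) Z) ` Zs"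
      then show "x + y \<in> (\<lambda>Z. mmul V (mpow V X (2 * s)) Z) ` Zs"
        using mat.subspace_add[OF sZ] by (auto simp flip: mmul_add_right)
    next
      fix c x assume "x \<in> (\<lambda>Z. mmul V (mpow V X (2 * s)) Z) ` Zs"
      then show "mscale c x \<in> (\<lambda>Z. mmul V (mpow V X (2 * s)) Z) ` Zs"
        using mat.subspace_scale[OF sZ] by (auto simp flip: mmul_scale_right)
    qed
  qed
  ultimately obtain Z where Z: "Z \<in> Zs" "mpow V X s = mmul V (mpow V X (2 * s)) Z"
    unfolding U_def by blast
  have comm: "mmul V (mpow V X s) Z = mmul V Z (mpow V X s)"
    using Z(1) unfolding Zs_def
  proof (induction rule: mat.span_induct_alt)
    case base then show ?case by (simp del: plus_fun_apply zero_fun_apply)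
  next
    case (step c x y)
    then obtain i where "x = mpow V X i" by blast
    then have "mmul V (mpow V X s) x = mmul V x (mpow V X s)"
      by (simp add: fin sX add.commute flip: mpow_add)
    with step show ?case
      by (simp add: mmul_add_left mmul_add_right mmul_scale_left mmul_scale_right del: plus_fun_apply zero_fun_apply)
  qed
  define E where "E = mmul V (mpow V X s) Z"
  have XE: "mpow V X s = mmul V (mpow V X s) E"
    unfolding E_def using Z(2) by (simp add: mmul_assoc[symmetric] fin mult_2 mpow_add sX)
  have idem: "mmul V E E = E"
  proof -
    have "mmul V E E = mmul V (mmul V Z (mpow V X s)) E" by (simp add: E_def comm)
    also have "\<dots> = mmul V Z (mpow V X s)" using XE by (simp add: mmul_assoc fin)
    finally show ?thesis by (simp add: E_def comm)
  qed
  \<comment> \<open>\<open>A\<close> need not contain the identity, although \<open>Z\<close> may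
    involve it. Since \<open>s \<ge> 1\<close>, the product of \<open>mpow V X s\<close> with any
    power of \<open>X\<close> is a positive power of \<open>X\<close>.\<close>
  have "E \<in> A" unfolding E_def using Z(1) unfolding Zs_def
  proof (induction rule: mat.span_induct_alt)
    case base then show ?case using mat.subspace_0[OF subA] by (simp del: plus_fun_apply zero_fun_apply)
  next
    case (step c x y)
    then obtain i where "x = mpow V X i" by blast
    then have "mmul V (mpow V X s) x = mpow V X (Suc (s + i - 1))"
      using s(2) by (simp add: fin sX flip: mpow_add)
    then have "mmul V (mpow V X s) x \<in> A" using powA by simp
    with step show ?case
      by (simp add: mmul_add_right mmul_scale_right mat.subspace_add[OF subA] mat.subspace_scale[OF subA] del: plus_fun_apply zero_fun_apply)
  qed
  then have "E = 0"
    using idempotent_trace[OF fin _ idem] tr[of E] A by (auto simp: mat_algebra_def)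
  with XE have "mpow V X s = 0" by simp
  then show ?thesis by blast
qed

section \<open>Long products and nilpotency\<close>

text \<open>Products of exactly \<open>k\<close> factors, kept as a mere set and not as a span: this
  makes nilpotency expressible over the integers as well, from where it is carried to other
  coefficients.\<close>

primrec words :: "'i set \<Rightarrow> ('i \<Rightarrow> 'i \<Rightarrow> 'k::comm_ring_1) set \<Rightarrow> nat \<Rightarrow> ('i \<Rightarrow> 'i \<Rightarrow> 'k) set" where
  "words V A 0 = {mone V}"
| "words V A (Suc k) = {mmul V a x |a x. a \<in> A \<and> x \<in> words V A k}"

lemma supported_words: "(\<And>a. a \<in> A \<Longrightarrow> supported V a) \<Longrightarrow> x \<in> words V A k \<Longrightarrow> supported V x"
  by (induction k arbitrary: x) (auto simp: supported_mone intro!: supported_mmul)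

text \<open>Nakayama's lemma: the descending chain of powers of the algebra stabilises at a module that is
  reproduced by a nil algebra, and the generators of such a module can be removed one by one.\<close>

lemma nil_algebra_nilpotent:
  fixes A :: "('i \<Rightarrow> 'i \<Rightarrow> 'k::field) set"
  assumes fin: "finite V" and A: "mat_algebra V A" and nil: "\<And>X. X \<in> A \<Longrightarrow> \<exists>s. mpow V X s = 0"
  shows "\<exists>D. words V A D \<subseteq> {0}"
proof -
  have subA: "mat.subspace A" and supA: "\<And>a. a \<in> A \<Longrightarrow> supported V a"
    and mulA: "\<And>a b. a \<in> A \<Longrightarrow> b \<in> A \<Longrightarrow> mmul V a b \<in> A" using A by (auto simp: mat_algebra_def)
  \<comment> \<open>The index is shifted by one because words of length zero consist of the
    identity, which would break the descent.\<close>
  define P where "P = (\<lambda>k. mat.span (words V A (Suc k)))"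
  have supP: "supported V x" if "x \<in> P k" for x k
  proof -
    have "words V A (Suc k) \<subseteq> {f. supported V f}" using supported_words supA by blast
    from mat.span_minimal[OF this subspace_supported] that show ?thesis by (auto simp: P_def)
  qed
  have dec: "words V A (Suc (Suc k)) \<subseteq> words V A (Suc k)" for k
  proof (induction k)
    case 0
    show ?case
    proof
      fix w assume "w \<in> words V A (Suc (Suc 0))"
      then obtain a b where "w = mmul V a (mmul V b (mone V))" "a \<in> A" "b \<in> A"
        unfolding words.simps by blast
      then have "w = mmul V (mmul V a b) (mone V)" "mmul V a b \<in> A"
        by (simp_all add: mmul_assoc fin mulA)
      then show "w \<in> words V A (Suc 0)" unfolding words.simps by blast
    qed
  next
    case (Suc k)
    then show ?case by (subst words.simps(2), subst (2) words.simps(2)) blast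
  qed
  have "\<exists>k. P (Suc k) = P k"
  proof (rule mat.descending_chain_of_subspaces[of "unit_mats V"])
    show "finite (unit_mats V)" using fin by (rule finite_unit_mats)
    show "mat.subspace (P k)" for k by (simp add: P_def)
    show "P k \<subseteq> mat.span (unit_mats V)" for k
      by (intro subsetI supported_in_span[OF fin]) (rule supP)
    show "P (Suc k) \<subseteq> P k" for k unfolding P_def by (rule mat.span_mono) (rule dec)
  qed
  then obtain k where k: "P (Suc k) = P k" by blast
  \<comment> \<open>\<open>L B\<close> is the left module \<open>A B\<close>, without the elements
    of \<open>B\<close> themselves.\<close>
  define L where "L = (\<lambda>B. mat.span {mmul V a u |a u. a \<in> A \<and> u \<in> B})"
  have mulL: "mmul V a x \<in> L B" if "x \<in> L B" "a \<in> A" for a x B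
    using that(1) unfolding L_def
  proof (induction rule: mat.span_induct_alt)
    case base then show ?case by (simp add: mat.span_zero del: plus_fun_apply zero_fun_apply)
  next
    case (step c x y)
    then obtain b u where "x = mmul V b u" "b \<in> A" "u \<in> B" by blast
    then have "mmul V a x = mmul V (mmul V a b) u" "mmul V a b \<in> A" "u \<in> B"
      using that by (simp_all only: mmul_assoc[OF fin] mulA)
    then have "mmul V a x \<in> mat.span {mmul V a u |a u. a \<in> A \<and> u \<in> B}"
      by (auto intro: mat.span_base)
    with step show ?case
      by (simp only: mmul_add_right mmul_scale_right) (intro mat.span_add mat.span_scale; assumption)
  qed
  obtain B where B: "B \<subseteq> P k" "mat.independent B" "P k \<subseteq> mat.span B"
    using mat.basis_exists[of "P k"] by metis
  have finB: "finite B"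
  proof -
    have "B \<subseteq> mat.span (unit_mats V)"
    proof
      fix x assume "x \<in> B"
      then have "supported V x" using B(1) supP by blast
      then show "x \<in> mat.span (unit_mats V)" by (rule supported_in_span[OF fin])
    qed
    then show ?thesis
      using mat.independent_span_bound[OF finite_unit_mats[OF fin] B(2)] by simp
  qed
  \<comment> \<open>Stability of the chain says that \<open>P k\<close> equals the span of
    \<open>A\<close> times \<open>P k\<close>, and \<open>B\<close> spans
    \<open>P k\<close>.\<close>
  have gen: "P k \<subseteq> L B"
  proof -
    have "words V A (Suc (Suc k)) \<subseteq> L B"
    proof
      fix w assume "w \<in> words V A (Suc (Suc k))"
      then obtain a x where w: "w = mmul V a x" "a \<in> A" "x \<in> words V A (Suc k)"
        unfolding words.simps(2)[of V A "Suc k"] by blast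
      then have "x \<in> P k" unfolding P_def by (intro mat.span_base)
      then have "x \<in> mat.span B" using B(3) by blast
      then have "mmul V a x \<in> L B"
      proof (induction rule: mat.span_induct_alt)
        case base then show ?case by (simp add: L_def mat.span_zero del: plus_fun_apply zero_fun_apply)
      next
        case (step c x y)
        have "mmul V a x \<in> L B" unfolding L_def using step(1) w(2) by (auto intro: mat.span_base)
        with step show ?case unfolding L_def
          by (simp only: mmul_add_right mmul_scale_right) (intro mat.span_add mat.span_scale; assumption)
      qed
      then show "w \<in> L B" by (simp add: w)
    qed
    then have "P (Suc k) \<subseteq> L B" unfolding P_def L_def by (intro mat.span_minimal mat.subspace_span)
    with k show ?thesis by simp
  qed
  have "P k \<subseteq> L {}" using finB B(1) gen
  proof (induction B rule: finite_induct)
    case (insert u B)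
    \<comment> \<open>Modulo \<open>L B\<close>, all terms involving \<open>u\<close> collect into
      one multiple \<open>b u\<close>, because \<open>A\<close> is closed under linear
      combinations.\<close>
    have split: "\<exists>b\<in>A. x - mmul V b u \<in> L B" if "x \<in> L (insert u B)" for x
      using that unfolding L_def
    proof (induction rule: mat.span_induct_alt)
      case base then show ?case
        by (intro bexI[of _ 0])
          (simp_all add: mat.span_zero mat.subspace_0[OF subA] del: plus_fun_apply zero_fun_apply)
    next
      case (step c x y)
      then obtain a v where x: "x = mmul V a v" "a \<in> A" "v \<in> insert u B" by blast
      from step obtain b where b: "b \<in> A" "y - mmul V b u \<in> L B" unfolding L_def by blast
      show ?case
      proof (cases "v = u")
        case True
        have "mscale c x + y - mmul V (mscale c a + b) u = y - mmul V b u"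
          by (simp add: x True mmul_add_left mmul_scale_left)
        moreover have "mscale c a + b \<in> A" using x b mat.subspace_add[OF subA] mat.subspace_scale[OF subA] by blast
        ultimately show ?thesis using b(2)
          by (intro bexI[of _ "mscale c a + b"]) (simp_all only: L_def)
      next
        case False
        then have "x \<in> L B" unfolding L_def using x by (auto intro: mat.span_base)
        then have "mscale c x + (y - mmul V b u) \<in> L B" using b(2) unfolding L_def
          by (intro mat.span_add mat.span_scale)
        then show ?thesis using b(1) by (intro bexI[of _ b]) (simp_all only: L_def add_diff_eq)
      qed
    qed
    have "u \<in> P k" using insert by auto
    then have "u \<in> L (insert u B)" using insert.prems by blast
    from split[OF this] obtain b where b: "b \<in> A" "u - mmul V b u \<in> L B" by blast
    have uu: "supported V u" using \<open>u \<in> P k\<close> by (rule supP)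
    have "u - mmul V (mpow V b i) u \<in> L B" for i
    proof (induction i)
      case 0 then show ?case using uu by (simp add: mmul_one_left fin L_def mat.span_zero del: zero_fun_apply)
    next
      case (Suc i)
      have "u - mmul V (mpow V b (Suc i)) u = (u - mmul V b u) + mmul V b (u - mmul V (mpow V b i) u)"
        by (simp add: mpow_Suc mmul_diff_right mmul_assoc fin)
      then show ?case using b(2) mulL[OF Suc b(1)] unfolding L_def by (simp only: mat.span_add)
    qed
    moreover obtain s where "mpow V b s = 0" using nil b(1) by blast
    ultimately have "u \<in> L B" by (metis diff_zero mmul_zero_left)
    then have "mmul V a v \<in> L B" if "a \<in> A" "v \<in> insert u B" for a v
      using that mulL by (auto simp: L_def intro: mat.span_base)
    then have "{mmul V a v |a v. a \<in> A \<and> v \<in> insert u B} \<subseteq> L B" by blast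
    then have "mat.span {mmul V a v |a v. a \<in> A \<and> v \<in> insert u B} \<subseteq> L B"
      by (rule mat.span_minimal) (simp add: L_def)
    then have "L (insert u B) \<subseteq> L B" by (simp only: L_def)
    with insert show ?case by blast
  qed simp
  then have "P k \<subseteq> {0}" by (simp add: L_def)
  then show ?thesis unfolding P_def using mat.span_superset by blast
qed

section \<open>Transfer from integral matrices to a field\<close>

definition of_int_mat :: "('i \<Rightarrow> 'i \<Rightarrow> int) \<Rightarrow> 'i \<Rightarrow> 'i \<Rightarrow> 'k::field" where
  "of_int_mat X = (\<lambda>n m. of_int (X n m))"

lemma of_int_mat_mmul: "of_int_mat (mmul V X Y) = mmul V (of_int_mat X) (of_int_mat Y)"
  by (simp add: of_int_mat_def mmul_def fun_eq_iff)

lemma of_int_mat_mone: "of_int_mat (mone V) = mone V"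
  by (simp add: of_int_mat_def mone_def fun_eq_iff)

lemma of_int_mat_zero: "of_int_mat 0 = 0"
  by (simp add: of_int_mat_def fun_eq_iff)

lemma mmul_span:
  assumes "f \<in> mat.span (of_int_mat ` S)" "g \<in> mat.span (of_int_mat ` S')"
  shows "mmul V f g \<in> mat.span (of_int_mat ` {mmul V X Y |X Y. X \<in> S \<and> Y \<in> S'})"
  using assms(1)
proof (induction rule: mat.span_induct_alt)
  case base then show ?case by (simp add: mat.span_zero del: plus_fun_apply zero_fun_apply)
next
  case (step c x y)
  have "mmul V x g \<in> mat.span (of_int_mat ` {mmul V X Y |X Y. X \<in> S \<and> Y \<in> S'})"
    using assms(2)
  proof (induction rule: mat.span_induct_alt)
    case base then show ?case by (simp add: mat.span_zero del: plus_fun_apply zero_fun_apply)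
  next
    case (step d x' y')
    have "mmul V x x' \<in> mat.span (of_int_mat ` {mmul V X Y |X Y. X \<in> S \<and> Y \<in> S'})"
    proof -
      obtain X Y where "X \<in> S" "x = of_int_mat X" "Y \<in> S'" "x' = of_int_mat Y"
        using \<open>x \<in> of_int_mat ` S\<close> step(1) by blast
      then show ?thesis
        by (intro mat.span_base image_eqI[of _ _ "mmul V X Y"]) (auto simp: of_int_mat_mmul)
    qed
    with step show ?case by (simp only: mmul_add_right mmul_scale_right) (intro mat.span_add mat.span_scale; assumption)
  qed
  with step show ?case by (simp only: mmul_add_left mmul_scale_left) (intro mat.span_add mat.span_scale; assumption)
qed

text \<open>Multiplying out a power of \<open>e\<close> moves all scalars of the field to the front
  and leaves images of integral words of the same length. These vanish at length \<open>D\<close> in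
  any characteristic, while the positive powers of an idempotent all equal \<open>e\<close>.\<close>

lemma idempotent_in_nilpotent_span:
  assumes fin: "finite V" and sup: "supported V e" and idem: "mmul V e e = e" and e: "e \<in> mat.span (of_int_mat ` S)"
    and nil: "words V S D \<subseteq> {0}"
  shows "e = 0"
proof -
  have "mpow V e k \<in> mat.span (of_int_mat ` words V S k)" for k
  proof (induction k)
    case 0 then show ?case by (auto simp: of_int_mat_mone intro: mat.span_base)
  next
    case (Suc k) then show ?case using mmul_span[OF e Suc] by (simp add: mpow_Suc)
  qed
  from this[of D] have "mpow V e D \<in> mat.span (of_int_mat ` {0})"
    using nil by (meson image_mono in_mono mat.span_mono)
  then have "mpow V e D = 0" by (auto simp: of_int_mat_zero)
  \<comment> \<open>One more factor is taken because \<open>D\<close> may be zero, and the zeroth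
    power is the identity rather than \<open>e\<close>.\<close>
  then have "mpow V e (Suc D) = 0" by (simp add: mpow_Suc)
  moreover have "mpow V e (Suc k) = e" for k
    by (induction k) (auto simp: mpow_Suc mmul_one_right fin sup idem)
  ultimately show ?thesis by simp
qed

lemma words_mono: "A \<subseteq> B \<Longrightarrow> words V A k \<subseteq> words V B k"
  by (induction k) auto

lemma words_of_int_mat:
  "of_int_mat ` words V S k \<subseteq> words V (of_int_mat ` S) k"
proof (induction k)
  case (Suc k)
  then show ?case by (auto simp: of_int_mat_mmul) blast
qed (auto simp: of_int_mat_mone)

subsection \<open>Trees over a quiver\<close>

text \<open>Of the morphism to the quiver only this is kept: the label of an arrow determines the
  labels of its endpoints. The combinatorics is thus independent of the relations and of the
  field.\<close>

locale tree_over =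
  fixes T :: "(nat, 'e) pre_digraph" and F :: "(nat, 'e, 'v, 'a) quiver_map"
  assumes tree: "tree_quiver T"
    and tail_vmap: "a \<in> arcs T \<Longrightarrow> b \<in> arcs T \<Longrightarrow> amap F a = amap F b \<Longrightarrow>
      vmap F (tail T a) = vmap F (tail T b)"
    and head_vmap: "a \<in> arcs T \<Longrightarrow> b \<in> arcs T \<Longrightarrow> amap F a = amap F b \<Longrightarrow>
      vmap F (head T a) = vmap F (head T b)"
begin

sublocale fin_digraph T
  using tree by (simp add: tree_quiver_def)

section \<open>Excluding short cycles\<close>

definition arr :: "nat \<Rightarrow> nat \<Rightarrow> bool" where
  "arr u v \<longleftrightarrow> (\<exists>e\<in>arcs T. tail T e = u \<and> head T e = v)"

definition adj :: "nat \<Rightarrow> nat \<Rightarrow> bool" where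
  "adj u v \<longleftrightarrow> arr u v \<or> arr v u"

lemma adj_sym: "adj u v \<Longrightarrow> adj v u" by (auto simp: adj_def)

lemma traversal_cycle:
  assumes "pre_digraph.cycle (traversals T) p" "distinct (map fst p)"
  shows False
  using tree assms by (auto simp: tree_quiver_def)

lemma adj_traversal:
  assumes "adj u v"
  obtains x where "x \<in> arcs (traversals T)" "tail (traversals T) x = u" "head (traversals T) x = v"
    "u \<in> verts (traversals T)" "{tail T (fst x), head T (fst x)} = {u, v}"
proof -
  from assms consider e where "e \<in> arcs T" "tail T e = u" "head T e = v"
    | e where "e \<in> arcs T" "tail T e = v" "head T e = u" by (auto simp: adj_def arr_def)
  then show thesis
  proof cases
    case (1 e) then show thesis by (intro that[of "(e, True)"]) (auto simp: traversals_def)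
  next
    case (2 e) then show thesis by (intro that[of "(e, False)"]) (auto simp: traversals_def)
  qed
qed

lemmas cycle_simps = pre_digraph.cycle_def pre_digraph.awalk_def pre_digraph.cas.simps
  pre_digraph.awalk_verts.simps

lemma no_loop: "e \<in> arcs T \<Longrightarrow> tail T e \<noteq> head T e"
proof
  assume e: "e \<in> arcs T" "tail T e = head T e"
  then have "pre_digraph.cycle (traversals T) [(e, True)]"
    by (auto simp: cycle_simps traversals_def)
  then show False using traversal_cycle by force
qed

lemma arc_unique:
  assumes "e \<in> arcs T" "e' \<in> arcs T" "{tail T e, head T e} = {tail T e', head T e'}"
  shows "e = e'"
proof (rule ccontr)
  assume ne: "e \<noteq> e'"
  \<comment> \<open>\<open>d\<close> is the direction in which \<open>e'\<close> leads from the head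
    of \<open>e\<close> back to its tail.\<close>
  define d where "d = (tail T e = head T e')"
  have "pre_digraph.cycle (traversals T) [(e, True), (e', d)]"
    using assms no_loop[of e] by (auto simp: cycle_simps traversals_def d_def doubleton_eq_iff)
  then show False using traversal_cycle ne by force
qed

lemma adj_irrefl: "\<not> adj u u"
  using no_loop unfolding adj_def arr_def by metis

lemma fst_neqI: "{tail T (fst x), head T (fst x)} = A \<Longrightarrow> {tail T (fst y), head T (fst y)} = B \<Longrightarrow>
    A \<noteq> B \<Longrightarrow> fst x \<noteq> fst y"
  for x y :: "'e \<times> bool"
  by metis

lemma arr_asym: "arr u v \<Longrightarrow> \<not> arr v u"
  using arc_unique no_loop by (auto simp: arr_def) (metis insert_commute)

lemma no_triangle: "adj u v \<Longrightarrow> adj v w \<Longrightarrow> \<not> adj u w"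
proof
  assume a: "adj u v" "adj v w" "adj u w"
  then have ne: "u \<noteq> v" "v \<noteq> w" "u \<noteq> w" using adj_irrefl by auto
  from a(1) obtain x where x: "x \<in> arcs (traversals T)" "tail (traversals T) x = u" "head (traversals T) x = v"
    "u \<in> verts (traversals T)" "{tail T (fst x), head T (fst x)} = {u, v}" by (rule adj_traversal)
  from a(2) obtain y where y: "y \<in> arcs (traversals T)" "tail (traversals T) y = v" "head (traversals T) y = w"
    "v \<in> verts (traversals T)" "{tail T (fst y), head T (fst y)} = {v, w}" by (rule adj_traversal)
  from adj_sym[OF a(3)] obtain z where z: "z \<in> arcs (traversals T)" "tail (traversals T) z = w" "head (traversals T) z = u"
    "w \<in> verts (traversals T)" "{tail T (fst z), head T (fst z)} = {w, u}" by (rule adj_traversal)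
  have "pre_digraph.cycle (traversals T) [x, y, z]"
    using x(1-4) y(1-4) z(1-4) ne by (simp add: cycle_simps)
  moreover have "distinct (map fst [x, y, z])"
    using fst_neqI[OF x(5) y(5)] fst_neqI[OF x(5) z(5)] fst_neqI[OF y(5) z(5)] ne
    by (simp add: doubleton_eq_iff)
  ultimately show False by (rule traversal_cycle)
qed

text \<open>Otherwise \<open>p\<close>, \<open>n\<close>, \<open>p'\<close>, \<open>n'\<close> form
  a cycle of length four. This settles those triangles of coordinates that have two members on one
  side of an equation and the third on the other.\<close>

lemma common_neighbour_unique:
  assumes a: "adj p n" "adj p n'" "adj p' n" "adj p' n'" and "n \<noteq> n'"
  shows "p = p'"
proof (rule ccontr)
  assume "p \<noteq> p'"
  then have ne: "p \<noteq> p'" "n \<noteq> n'" "p \<noteq> n" "p \<noteq> n'" "p' \<noteq> n" "p' \<noteq> n'"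
    using a adj_irrefl \<open>n \<noteq> n'\<close> by auto
  from a(1) obtain x where x: "x \<in> arcs (traversals T)" "tail (traversals T) x = p" "head (traversals T) x = n"
    "p \<in> verts (traversals T)" "{tail T (fst x), head T (fst x)} = {p, n}" by (rule adj_traversal)
  from adj_sym[OF a(3)] obtain y where y: "y \<in> arcs (traversals T)" "tail (traversals T) y = n" "head (traversals T) y = p'"
    "n \<in> verts (traversals T)" "{tail T (fst y), head T (fst y)} = {n, p'}" by (rule adj_traversal)
  from a(4) obtain z where z: "z \<in> arcs (traversals T)" "tail (traversals T) z = p'" "head (traversals T) z = n'"
    "p' \<in> verts (traversals T)" "{tail T (fst z), head T (fst z)} = {p', n'}" by (rule adj_traversal)
  from adj_sym[OF a(2)] obtain w where w: "w \<in> arcs (traversals T)" "tail (traversals T) w = n'" "head (traversals T) w = p"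
    "n' \<in> verts (traversals T)" "{tail T (fst w), head T (fst w)} = {n', p}" by (rule adj_traversal)
  have "pre_digraph.cycle (traversals T) [x, y, z, w]"
    using x(1-4) y(1-4) z(1-4) w(1-4) ne by (simp add: cycle_simps)
  moreover have "distinct (map fst [x, y, z, w])"
    using fst_neqI[OF x(5) y(5)] fst_neqI[OF x(5) z(5)] fst_neqI[OF x(5) w(5)]
      fst_neqI[OF y(5) z(5)] fst_neqI[OF y(5) w(5)] fst_neqI[OF z(5) w(5)] ne
    by (simp add: doubleton_eq_iff)
  ultimately show False by (rule traversal_cycle)
qed

text \<open>If alternate vertices of the hexagon coincide, a common neighbour is duplicated; if
  opposite ones coincide, a triangle arises; otherwise there is a cycle of length six. Such a
  hexagon comes from three coordinates that are pairwise on the same side of some equation.\<close>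

lemma no_hexagon:
  assumes a: "adj p n" "adj p n'" "adj p' n'" "adj p' n''" "adj p'' n''" "adj p'' n"
    and d: "n \<noteq> n'" "n' \<noteq> n''" "n \<noteq> n''"
  shows "p = p'"
proof (rule ccontr)
  assume pp: "p \<noteq> p'"
  have "p' \<noteq> p''" using common_neighbour_unique[of p n n' p'] a d pp by auto
  moreover have "p \<noteq> p''" using common_neighbour_unique[of p n' n'' p'] a d pp by auto
  moreover have "p \<noteq> n''" using a d no_triangle adj_sym adj_irrefl by metis
  moreover have "p' \<noteq> n" using a d no_triangle adj_sym adj_irrefl by metis
  moreover have "p'' \<noteq> n'" using a d no_triangle adj_sym adj_irrefl by metis
  ultimately have ne: "distinct [p, n', p', n'', p'', n]"
    using a d pp adj_irrefl by auto
  from a(2) obtain x1 where x1: "x1 \<in> arcs (traversals T)" "tail (traversals T) x1 = p" "head (traversals T) x1 = n'"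
    "p \<in> verts (traversals T)" "{tail T (fst x1), head T (fst x1)} = {p, n'}" by (rule adj_traversal)
  from adj_sym[OF a(3)] obtain x2 where x2: "x2 \<in> arcs (traversals T)" "tail (traversals T) x2 = n'" "head (traversals T) x2 = p'"
    "n' \<in> verts (traversals T)" "{tail T (fst x2), head T (fst x2)} = {n', p'}" by (rule adj_traversal)
  from a(4) obtain x3 where x3: "x3 \<in> arcs (traversals T)" "tail (traversals T) x3 = p'" "head (traversals T) x3 = n''"
    "p' \<in> verts (traversals T)" "{tail T (fst x3), head T (fst x3)} = {p', n''}" by (rule adj_traversal)
  from adj_sym[OF a(5)] obtain x4 where x4: "x4 \<in> arcs (traversals T)" "tail (traversals T) x4 = n''" "head (traversals T) x4 = p''"
    "n'' \<in> verts (traversals T)" "{tail T (fst x4), head T (fst x4)} = {n'', p''}" by (rule adj_traversal)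
  from a(6) obtain x5 where x5: "x5 \<in> arcs (traversals T)" "tail (traversals T) x5 = p''" "head (traversals T) x5 = n"
    "p'' \<in> verts (traversals T)" "{tail T (fst x5), head T (fst x5)} = {p'', n}" by (rule adj_traversal)
  from adj_sym[OF a(1)] obtain x6 where x6: "x6 \<in> arcs (traversals T)" "tail (traversals T) x6 = n" "head (traversals T) x6 = p"
    "n \<in> verts (traversals T)" "{tail T (fst x6), head T (fst x6)} = {n, p}" by (rule adj_traversal)
  have "pre_digraph.cycle (traversals T) [x1, x2, x3, x4, x5, x6]"
    using x1(1-4) x2(1-4) x3(1-4) x4(1-4) x5(1-4) x6(1-4) ne by (auto simp: cycle_simps)
  moreover have "distinct (map fst [x1, x2, x3, x4, x5, x6])"
    using ne
      fst_neqI[OF x1(5) x2(5)] fst_neqI[OF x1(5) x3(5)] fst_neqI[OF x1(5) x4(5)] fst_neqI[OF x1(5) x5(5)]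
      fst_neqI[OF x1(5) x6(5)] fst_neqI[OF x2(5) x3(5)] fst_neqI[OF x2(5) x4(5)] fst_neqI[OF x2(5) x5(5)]
      fst_neqI[OF x2(5) x6(5)] fst_neqI[OF x3(5) x4(5)] fst_neqI[OF x3(5) x5(5)] fst_neqI[OF x3(5) x6(5)]
      fst_neqI[OF x4(5) x5(5)] fst_neqI[OF x4(5) x6(5)] fst_neqI[OF x5(5) x6(5)]
    by (auto simp: doubleton_eq_iff)
  ultimately show False by (rule traversal_cycle)
qed

text \<open>
  The endomorphism \<open>f\<close> maps the basis vector of \<open>n\<close> to the sum of \<open>f n m\<close> times the basis vector of
  \<open>m\<close>.  The index \<open>(p, q, \<gamma>)\<close> stands for the equation between the coefficients at \<open>q\<close> of the two
  images of the basis vector of \<open>p\<close>: first \<open>\<gamma>\<close> and then \<open>f\<close> (coordinates in \<open>eqn_heads\<close>), or first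
  \<open>f\<close> and then \<open>\<gamma>\<close> (coordinates in \<open>eqn_tails\<close>).
\<close>

definition eqn_heads :: "nat \<times> nat \<times> 'a \<Rightarrow> (nat \<times> nat) set" where
  "eqn_heads = (\<lambda>(p, q, \<gamma>). {(head T a, q) |a. a \<in> arcs T \<and> tail T a = p \<and> amap F a = \<gamma>})"

definition eqn_tails :: "nat \<times> nat \<times> 'a \<Rightarrow> (nat \<times> nat) set" where
  "eqn_tails = (\<lambda>(p, q, \<gamma>). {(p, tail T b) |b. b \<in> arcs T \<and> head T b = q \<and> amap F b = \<gamma>})"

definition eqn :: "nat \<times> nat \<times> 'a \<Rightarrow> (nat \<times> nat) set" where
  "eqn c = eqn_heads c \<union> eqn_tails c"

lemma eqn_disjoint: "eqn_heads c \<inter> eqn_tails c = {}"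
  using no_loop by (auto simp: eqn_heads_def eqn_tails_def split: prod.splits)

lemma finite_eqn: "finite (eqn c)"
  by (cases c) (auto simp: eqn_def eqn_heads_def eqn_tails_def)

text \<open>The coefficient of a coordinate once all terms of the equation are moved to one side.
  The value is meaningful only for members of \<open>eqn c\<close>; elsewhere it is -1 by
  default.\<close>

definition side :: "nat \<times> nat \<times> 'a \<Rightarrow> nat \<times> nat \<Rightarrow> int" where
  "side c x = (if x \<in> eqn_heads c then 1 else - 1)"

abbreviation "N1 \<equiv> pullback_network T F T F"
abbreviation "N2 \<equiv> covering_network T F T F"

text \<open>An arrow \<open>(a, b)\<close> of the pullback network belongs to the equation at the
  mixed corner \<open>(tail T a, head T b)\<close>: its head is among the heads there and its tail
  among the tails. The two kinds of edges are pairs of heads and pairs of tails.\<close>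

lemma link_eqn:
  assumes "link N1 x y"
  shows "\<exists>c. x \<in> eqn c \<and> y \<in> eqn c"
proof -
  from assms consider
      (arc) a b where "a \<in> arcs T" "b \<in> arcs T" "amap F a = amap F b"
        "{x, y} = {(tail T a, tail T b), (head T a, head T b)}"
    | (hor) a b m where "a \<in> arcs T" "b \<in> arcs T" "tail T a = tail T b" "amap F a = amap F b"
        "{x, y} = {(head T a, m), (head T b, m)}"
    | (ver) a b n where "a \<in> arcs T" "b \<in> arcs T" "head T a = head T b" "amap F a = amap F b"
        "{x, y} = {(n, tail T a), (n, tail T b)}"
    unfolding link_def pullback_network_def by (auto; metis)
  then show ?thesis
  proof cases
    case arc
    then have "{x, y} \<subseteq> eqn (tail T a, head T b, amap F a)"
      by (auto simp: eqn_def eqn_heads_def eqn_tails_def)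
    then show ?thesis by blast
  next
    case hor
    then have "{x, y} \<subseteq> eqn (tail T a, m, amap F a)"
      by (auto simp: eqn_def eqn_heads_def eqn_tails_def)
    then show ?thesis by blast
  next
    case ver
    then have "{x, y} \<subseteq> eqn (n, head T a, amap F a)"
      by (auto simp: eqn_def eqn_heads_def eqn_tails_def)
    then show ?thesis by blast
  qed
qed

lemma in_eqn:
  "(n, m) \<in> eqn (p, q, \<gamma>) \<Longrightarrow> arr p n \<and> m = q \<or> n = p \<and> arr m q"
  by (auto simp: eqn_def eqn_heads_def eqn_tails_def arr_def)

lemma arc_unique': "e \<in> arcs T \<Longrightarrow> e' \<in> arcs T \<Longrightarrow> tail T e = tail T e' \<Longrightarrow> head T e = head T e' \<Longrightarrow> e = e'"
  by (rule arc_unique) auto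

lemma eqn_label_unique:
  assumes "x \<in> eqn (p, q, \<gamma>)" "x \<in> eqn (p, q, \<gamma>')"
  shows "\<gamma> = \<gamma>'"
  using assms unfolding eqn_def eqn_heads_def eqn_tails_def
  by (auto dest: arc_unique' no_loop)

lemma arr_adj: "arr u v \<Longrightarrow> adj u v" "arr u v \<Longrightarrow> adj v u"
  by (auto simp: adj_def)

lemma arr_irrefl: "\<not> arr u u"
  using adj_irrefl arr_adj by blast

text \<open>Two coordinates of an equation lie on the same side or are joined by an arrow;
  \<open>fwd\<close> and \<open>bwd\<close> say whether that arrow leaves or enters the first one.
  Labels are dropped, so that what remains concerns adjacency in the tree.\<close>

lemma eqn_pair:
  assumes "(n, m) \<in> eqn (p, q, \<gamma>)" "(n', m') \<in> eqn (p, q, \<gamma>)" "(n, m) \<noteq> (n', m')"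
  obtains (heads) "m = q" "m' = q" "n \<noteq> n'" "arr p n" "arr p n'"
  | (tails) "n = p" "n' = p" "m \<noteq> m'" "arr m q" "arr m' q"
  | (bwd) "n' = p" "m = q" "arr n' n" "arr m' m"
  | (fwd) "n = p" "m' = q" "arr n n'" "arr m m'"
  using in_eqn[OF assms(1)] in_eqn[OF assms(2)] assms(3) by blast

text \<open>Every triangle of the pullback network lies in a single equation: otherwise the three equations
  would trace a closed walk in \<open>T\<close> that does not backtrack.\<close>

lemma eqn_unique:
  assumes "x \<in> eqn c" "y \<in> eqn c" "y \<in> eqn c'" "z \<in> eqn c'" "x \<in> eqn d" "z \<in> eqn d"
    and ne: "x \<noteq> y" "y \<noteq> z" "x \<noteq> z"
  shows "c = c'"
proof -
  obtain p q \<gamma> p' q' \<gamma>' p'' q'' \<gamma>'' where c: "c = (p, q, \<gamma>)" "c' = (p', q', \<gamma>')" "d = (p'', q'', \<gamma>'')"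
    by (metis prod.exhaust)
  obtain n m n' m' n'' m'' where x: "x = (n, m)" "y = (n', m')" "z = (n'', m'')" by fastforce
  note facts = arr_irrefl arr_asym arr_adj no_triangle common_neighbour_unique
  \<comment> \<open>The labels can wait: \<open>y\<close> lies in both equations, and a coordinate
    together with the corner determines the label.\<close>
  have "p = p' \<and> q = q'"
    using assms(1,2) ne(1) unfolding c x
  proof (cases rule: eqn_pair)
    case 1: heads
    show ?thesis using assms(3,4) ne(2) unfolding c x
    proof (cases rule: eqn_pair)
      case 2: heads
      show ?thesis using assms(5,6) ne(3) unfolding c x
      proof (cases rule: eqn_pair)
        case heads
        \<comment> \<open>All second coordinates agree here, so the whole configuration lives in the
          first coordinates, where three vertices have pairwise common predecessors.\<close>
        with 1 2 show ?thesis using no_hexagon[of p n n' p' n'' p''] arr_adj by blast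
      qed (use 1 2 arr_irrefl in auto)
    next
      case 2: tails
      show ?thesis using assms(5,6) ne(3) unfolding c x
        by (cases rule: eqn_pair) (use 1 2 facts in metis)+
    next
      case 2: bwd
      show ?thesis using assms(5,6) ne(3) unfolding c x
        by (cases rule: eqn_pair) (use 1 2 facts in metis)+
    next
      case 2: fwd
      show ?thesis using assms(5,6) ne(3) unfolding c x
        by (cases rule: eqn_pair) (use 1 2 facts in metis)+
    qed
  next
    case 1: tails
    show ?thesis using assms(3,4) ne(2) unfolding c x
    proof (cases rule: eqn_pair)
      case 2: tails
      show ?thesis using assms(5,6) ne(3) unfolding c x
      proof (cases rule: eqn_pair)
        case tails
        with 1 2 show ?thesis using no_hexagon[of q m m' q' m'' q''] arr_adj by blast
      qed (use 1 2 arr_irrefl in auto)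
    next
      case 2: heads
      show ?thesis using assms(5,6) ne(3) unfolding c x
        by (cases rule: eqn_pair) (use 1 2 facts in metis)+
    next
      case 2: bwd
      show ?thesis using assms(5,6) ne(3) unfolding c x
        by (cases rule: eqn_pair) (use 1 2 facts in metis)+
    next
      case 2: fwd
      show ?thesis using assms(5,6) ne(3) unfolding c x
        by (cases rule: eqn_pair) (use 1 2 facts in metis)+
    qed
  next
    case 1: bwd
    show ?thesis using assms(3,4) ne(2) unfolding c x
    proof (cases rule: eqn_pair)
      case 2: heads
      show ?thesis using assms(5,6) ne(3) unfolding c x
        by (cases rule: eqn_pair) (use 1 2 facts in metis)+
    next
      case 2: tails
      show ?thesis using assms(5,6) ne(3) unfolding c x
        by (cases rule: eqn_pair) (use 1 2 facts in metis)+
    next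
      case 2: bwd
      show ?thesis using assms(5,6) ne(3) unfolding c x
        by (cases rule: eqn_pair) (use 1 2 facts in metis)+
    next
      case 2: fwd
      show ?thesis using assms(5,6) ne(3) unfolding c x
        by (cases rule: eqn_pair) (use 1 2 facts in metis)+
    qed
  next
    case 1: fwd
    show ?thesis using assms(3,4) ne(2) unfolding c x
    proof (cases rule: eqn_pair)
      case 2: heads
      show ?thesis using assms(5,6) ne(3) unfolding c x
        by (cases rule: eqn_pair) (use 1 2 facts in metis)+
    next
      case 2: tails
      show ?thesis using assms(5,6) ne(3) unfolding c x
        by (cases rule: eqn_pair) (use 1 2 facts in metis)+
    next
      case 2: bwd
      show ?thesis using assms(5,6) ne(3) unfolding c x
        by (cases rule: eqn_pair) (use 1 2 facts in metis)+
    next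
      case 2: fwd
      show ?thesis using assms(5,6) ne(3) unfolding c x
        by (cases rule: eqn_pair) (use 1 2 facts in metis)+
    qed
  qed
  with eqn_label_unique assms(2,3) c show ?thesis by blast
qed

subsection \<open>Complete subnetworks from partners\<close>


abbreviation sgn3 :: "nat \<times> nat \<times> int \<Rightarrow> int" where "sgn3 X \<equiv> snd (snd X)"

lemma proj_simp [simp]: "proj (n, m, j) = (n, m)" by (simp add: proj_def)

text \<open>
  Every signed coordinate of \<open>D\<close> has one partner in each of its equations.  The sign rule says that
  the two contributions to the equation cancel; equivalently, partners on different sides carry equal
  signs (an arrow) and partners on the same side carry opposite signs (an edge).
\<close>

definition partner_system ::
    "(nat \<times> nat \<times> int) set \<Rightarrow> (nat \<times> nat \<times> 'a \<Rightarrow> nat \<times> nat \<times> int \<Rightarrow> nat \<times> nat \<times> int) \<Rightarrow> bool" where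
  "partner_system D pr \<longleftrightarrow> D \<subseteq> verts N2 \<and> (\<forall>c. \<forall>X\<in>D. proj X \<in> eqn c \<longrightarrow>
     pr c X \<in> D \<and> proj (pr c X) \<in> eqn c \<and> proj (pr c X) \<noteq> proj X \<and> pr c (pr c X) = X \<and>
     sgn3 (pr c X) * side c (proj (pr c X)) = - sgn3 X * side c (proj X))"

text \<open>The signed coordinates whose contribution to the equation, sign times
  \<open>side\<close>, is 1; in \<open>minus_part\<close> it is -1.\<close>

definition plus_part :: "(nat \<times> nat \<times> int) set \<Rightarrow> nat \<times> nat \<times> 'a \<Rightarrow> (nat \<times> nat \<times> int) set" where
  "plus_part D c = {X \<in> D. proj X \<in> eqn c \<and> sgn3 X = side c (proj X)}"

definition minus_part :: "(nat \<times> nat \<times> int) set \<Rightarrow> nat \<times> nat \<times> 'a \<Rightarrow> (nat \<times> nat \<times> int) set" where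
  "minus_part D c = {X \<in> D. proj X \<in> eqn c \<and> sgn3 X = - side c (proj X)}"

lemma side_cases: "side c x = 1 \<or> side c x = - 1"
  by (simp add: side_def)

lemma N2_verts: "(n, m, j) \<in> verts N2 \<longleftrightarrow>
    n \<in> verts T \<and> m \<in> verts T \<and> vmap F n = vmap F m \<and> (j = 1 \<or> j = - 1)"
  by (auto simp: covering_network_def Let_def pullback_network_def)

lemma N1_verts: "(n, m) \<in> verts N1 \<longleftrightarrow> n \<in> verts T \<and> m \<in> verts T \<and> vmap F n = vmap F m"
  by (auto simp: pullback_network_def)

lemma N1_edge_heads:
  assumes "a \<in> arcs T" "b \<in> arcs T" "tail T a = tail T b" "amap F a = amap F b" "head T a \<noteq> head T b"
    and "(head T a, m) \<in> verts N1" "(head T b, m) \<in> verts N1"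
  shows "{(head T a, m), (head T b, m)} \<in> edges N1"
proof -
  have "\<exists>e\<in>arcs T. \<exists>f\<in>arcs T. tail T e = tail T f \<and> head T e = head T a \<and> head T f = head T b \<and> amap F e = amap F f"
    using assms by blast
  with assms(5-) show ?thesis
    unfolding N1_verts pullback_network_def network.select_convs
    by (intro UnI1 CollectI exI[of _ "head T a"] exI[of _ "head T b"] exI[of _ m]) simp
qed

lemma N1_edge_tails:
  assumes "a \<in> arcs T" "b \<in> arcs T" "head T a = head T b" "amap F a = amap F b" "tail T a \<noteq> tail T b"
    and "(n, tail T a) \<in> verts N1" "(n, tail T b) \<in> verts N1"
  shows "{(n, tail T a), (n, tail T b)} \<in> edges N1"
proof -
  have "\<exists>e\<in>arcs T. \<exists>f\<in>arcs T. head T e = head T f \<and> tail T e = tail T a \<and> tail T f = tail T b \<and> amap F e = amap F f"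
    using assms by blast
  with assms(5-) show ?thesis
    unfolding N1_verts pullback_network_def network.select_convs
    by (intro UnI2 CollectI exI[of _ n] exI[of _ "tail T a"] exI[of _ "tail T b"]) simp
qed

lemma N2_edgeI:
  "{(n, m), (n', m')} \<in> edges N1 \<Longrightarrow> j \<in> {-1, 1} \<Longrightarrow> {(n, m, j), (n', m', - j)} \<in> edges N2"
  unfolding covering_network_def Let_def network.select_convs by blast

text \<open>The bijection and its inverse together form the involution \<open>pr c\<close>. The
  condition on \<open>proj\<close> prevents the two lifts of one coordinate, which always cancel,
  from being matched with each other.\<close>

lemma partner_system_of_bij:
  assumes D: "D \<subseteq> verts N2"
    and b: "\<And>c. \<exists>\<beta>. bij_betw \<beta> (plus_part D c) (minus_part D c) \<and> (\<forall>X\<in>plus_part D c. proj (\<beta> X) \<noteq> proj X)"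
  shows "\<exists>pr. partner_system D pr"
proof -
  from b obtain \<beta> where \<beta>: "\<And>c. bij_betw (\<beta> c) (plus_part D c) (minus_part D c)"
    and ne: "\<And>c X. X \<in> plus_part D c \<Longrightarrow> proj (\<beta> c X) \<noteq> proj X" by metis
  define pr where "pr = (\<lambda>c X. if X \<in> plus_part D c then \<beta> c X else inv_into (plus_part D c) (\<beta> c) X)"
  have disj: "plus_part D c \<inter> minus_part D c = {}" for c
    by (auto simp: plus_part_def minus_part_def side_def split: if_splits)
  have "pr c X \<in> D \<and> proj (pr c X) \<in> eqn c \<and> proj (pr c X) \<noteq> proj X \<and> pr c (pr c X) = X \<and>
     sgn3 (pr c X) * side c (proj (pr c X)) = - sgn3 X * side c (proj X)"
    if X: "X \<in> D" "proj X \<in> eqn c" for c X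
  proof (cases "X \<in> plus_part D c")
    case True
    then have "\<beta> c X \<in> minus_part D c" using \<beta>[of c] by (auto simp: bij_betw_def)
    moreover from this have "\<beta> c X \<notin> plus_part D c" using disj by blast
    ultimately have m: "pr c X = \<beta> c X" "\<beta> c X \<in> minus_part D c" "pr c (\<beta> c X) = X"
      using \<beta>[of c] True by (simp_all add: pr_def bij_betw_def)
    then show ?thesis using True ne[OF True] side_cases[of c]
      unfolding plus_part_def minus_part_def by (smt (verit) mem_Collect_eq minus_mult_minus mult_minus_left)
  next
    case False
    have "sgn3 X = 1 \<or> sgn3 X = - 1" using X(1) D N2_verts by (cases X) auto
    then have Xm: "X \<in> minus_part D c"
      using False X side_cases[of c "proj X"] by (auto simp: plus_part_def minus_part_def)
    then have "X \<in> \<beta> c ` plus_part D c" using bij_betw_imp_surj_on[OF \<beta>[of c]] by simp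
    then obtain Y where Y: "Y \<in> plus_part D c" "X = \<beta> c Y" by (rule imageE)
    then have m: "pr c X = Y" "pr c Y = X"
      using \<beta>[of c] False by (auto simp: pr_def bij_betw_def)
    then show ?thesis using Y Xm ne[OF Y(1)] side_cases[of c]
      unfolding plus_part_def minus_part_def by (smt (verit) mem_Collect_eq minus_mult_minus mult_minus_left)
  qed
  with D show ?thesis unfolding partner_system_def by blast
qed

text \<open>An arrow is recorded through its head alone, since the involution recovers its tail. The
  functions \<open>tail\<close> and \<open>head\<close> are copied from \<open>N2\<close> because a
  subnetwork has to share them as total functions.\<close>

definition partner_net ::
    "(nat \<times> nat \<times> int) set \<Rightarrow> (nat \<times> nat \<times> 'a \<Rightarrow> nat \<times> nat \<times> int \<Rightarrow> nat \<times> nat \<times> int)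
      \<Rightarrow> (nat \<times> nat \<times> int, 'e \<times> 'e \<times> int) network" where
  "partner_net D pr = \<lparr>verts = D,
     arcs = {(a, b, j). a \<in> arcs T \<and> b \<in> arcs T \<and> amap F a = amap F b \<and> (head T a, head T b, j) \<in> D \<and>
       pr (tail T a, head T b, amap F a) (head T a, head T b, j) = (tail T a, tail T b, j)},
     tail = tail N2, head = head N2,
     edges = {{X, pr c X} |X c. X \<in> D \<and> proj X \<in> eqn c \<and> sgn3 (pr c X) = - sgn3 X}\<rparr>"

lemma partner_net_simps [simp]:
  "verts (partner_net D pr) = D"
  "tail (partner_net D pr) (a, b, j) = (tail T a, tail T b, j)"
  "head (partner_net D pr) (a, b, j) = (head T a, head T b, j)"
  by (simp_all add: partner_net_def covering_network_def Let_def)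

lemma partner_net_edgeI:
  "X \<in> D \<Longrightarrow> proj X \<in> eqn c \<Longrightarrow> sgn3 (pr c X) = - sgn3 X \<Longrightarrow> {X, pr c X} \<in> edges (partner_net D pr)"
  unfolding partner_net_def network.select_convs by blast

lemma arc_eqn:
  assumes "a \<in> arcs T" "b \<in> arcs T" "amap F a = amap F b"
  shows "(head T a, head T b) \<in> eqn_heads (tail T a, head T b, amap F a)"
    "(tail T a, tail T b) \<in> eqn_tails (tail T a, head T b, amap F a)"
  using assms by (auto simp: eqn_heads_def eqn_tails_def)

lemma partner_systemD:
  assumes "partner_system D pr" "X \<in> D" "proj X \<in> eqn c"
  shows "pr c X \<in> D" "proj (pr c X) \<in> eqn c" "proj (pr c X) \<noteq> proj X" "pr c (pr c X) = X"
    "sgn3 (pr c X) * side c (proj (pr c X)) = - sgn3 X * side c (proj X)"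
  using assms unfolding partner_system_def by blast+

lemma partner_sign:
  assumes "partner_system D pr" "X \<in> D" "proj X \<in> eqn c"
  shows "sgn3 X \<noteq> 0" "sgn3 (pr c X) = (if proj X \<in> eqn_heads c \<longleftrightarrow> proj (pr c X) \<in> eqn_heads c then - sgn3 X else sgn3 X)"
proof -
  show "sgn3 X \<noteq> 0" using assms N2_verts unfolding partner_system_def by (cases X) force
  show "sgn3 (pr c X) = (if proj X \<in> eqn_heads c \<longleftrightarrow> proj (pr c X) \<in> eqn_heads c then - sgn3 X else sgn3 X)"
    using partner_systemD(5)[OF assms] by (auto simp: side_def split: if_splits)
qed

text \<open>Opposite signs mean the same side and give an edge. Equal signs mean different sides and
  give an arrow pointing to the partner among the heads, so one may swap \<open>X\<close> with its
  partner.\<close>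

lemma link_partner:
  assumes ps: "partner_system D pr" and X: "X \<in> D" "proj X \<in> eqn c"
  shows "link (partner_net D pr) X (pr c X)"
proof (cases "sgn3 (pr c X) = - sgn3 X")
  case True
  then have "{X, pr c X} \<in> edges (partner_net D pr)" by (rule partner_net_edgeI[OF X])
  then show ?thesis by (simp add: link_def)
next
  case False
  have *: "\<exists>a b. (a, b, sgn3 X) \<in> arcs (partner_net D pr) \<and> X = (head T a, head T b, sgn3 X) \<and> pr c X = (tail T a, tail T b, sgn3 X)"
    if X: "X \<in> D" "proj X \<in> eqn_heads c" "proj (pr c X) \<in> eqn_tails c" "sgn3 (pr c X) = sgn3 X" for X
  proof -
    obtain p q \<gamma> where c: "c = (p, q, \<gamma>)" by (metis prod.exhaust)
    obtain a where a: "a \<in> arcs T" "tail T a = p" "amap F a = \<gamma>" "proj X = (head T a, q)"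
      using X(2) by (auto simp: c eqn_heads_def)
    obtain b where b: "b \<in> arcs T" "head T b = q" "amap F b = \<gamma>" "proj (pr c X) = (p, tail T b)"
      using X(3) by (auto simp: c eqn_tails_def)
    have "X = (head T a, head T b, sgn3 X)" using a b by (cases X) simp
    moreover have "pr c X = (tail T a, tail T b, sgn3 X)" using a b X(4) by (cases "pr c X") simp
    ultimately have eq: "X = (head T a, head T b, sgn3 X)" "pr c X = (tail T a, tail T b, sgn3 X)" .
    then have "(a, b, sgn3 X) \<in> arcs (partner_net D pr)"
      using a b X(1) unfolding partner_net_def by (simp add: c)
    with eq show ?thesis by blast
  qed
  note P = partner_systemD[OF ps X] and S = partner_sign[OF ps X]
  from False S have same: "sgn3 (pr c X) = sgn3 X" by (auto split: if_splits)
  from False S P(2) X(2) consider "proj X \<in> eqn_heads c" "proj (pr c X) \<in> eqn_tails c"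
    | "proj X \<in> eqn_tails c" "proj (pr c X) \<in> eqn_heads c"
    by (auto simp: eqn_def split: if_splits)
  then show ?thesis
  proof cases
    case 1
    from *[OF X(1) this same] obtain a b where
      "(a, b, sgn3 X) \<in> arcs (partner_net D pr)" "X = (head T a, head T b, sgn3 X)" "pr c X = (tail T a, tail T b, sgn3 X)"
      by blast
    then show ?thesis unfolding link_def by (metis partner_net_simps(2,3))
  next
    case 2
    have "\<exists>a b. (a, b, sgn3 (pr c X)) \<in> arcs (partner_net D pr) \<and> pr c X = (head T a, head T b, sgn3 (pr c X)) \<and>
        pr c (pr c X) = (tail T a, tail T b, sgn3 (pr c X))"
      by (rule *) (use 2 P same in auto)
    then show ?thesis unfolding link_def P(4) by (metis partner_net_simps(2,3))
  qed
qed

lemma link_sym: "link N x y \<Longrightarrow> link N y x"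
  by (auto simp: link_def insert_commute)

lemma link_partnerD:
  assumes ps: "partner_system D pr" and l: "link (partner_net D pr) X Y"
  shows "\<exists>c. X \<in> D \<and> proj X \<in> eqn c \<and> Y = pr c X"
proof -
  have *: ?thesis if "Z \<in> D" "proj Z \<in> eqn c" "{X, Y} = {Z, pr c Z}" for Z c
  proof (cases "X = Z")
    case True
    then show ?thesis using that by (metis doubleton_eq_iff)
  next
    case False
    then have "X = pr c Z" "Y = Z" using that(3) by (auto simp: doubleton_eq_iff)
    then show ?thesis using partner_systemD[OF ps that(1,2)] by metis
  qed
  from l consider
      a where "a \<in> arcs (partner_net D pr)" "{X, Y} = {head (partner_net D pr) a, tail (partner_net D pr) a}"
    | "{X, Y} \<in> edges (partner_net D pr)"
    unfolding link_def by blast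
  then show ?thesis
  proof cases
    case (1 a)
    obtain e f j where a: "a = (e, f, j)" by (metis prod.exhaust)
    have "e \<in> arcs T" "f \<in> arcs T" "amap F e = amap F f" "(head T e, head T f, j) \<in> D"
      "pr (tail T e, head T f, amap F e) (head T e, head T f, j) = (tail T e, tail T f, j)"
      using 1(1) by (auto simp: a partner_net_def)
    then show ?thesis
      using 1(2) arc_eqn(1)[of e f]
      by (intro *[of "(head T e, head T f, j)" "(tail T e, head T f, amap F e)"]) (auto simp: a eqn_def)
  next
    case 2
    then show ?thesis using * by (auto simp: partner_net_def)
  qed
qed

lemma partner_net_subnetwork:
  assumes ps: "partner_system D pr"
  shows "subnetwork (partner_net D pr) N2"
  unfolding subnetwork_def
proof (intro conjI)
  have D: "D \<subseteq> verts N2" using ps by (simp add: partner_system_def)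
  show "verts (partner_net D pr) \<subseteq> verts N2" using D by simp
  show "tail (partner_net D pr) = tail N2" "head (partner_net D pr) = head N2"
    by (simp_all add: partner_net_def)
  show "arcs (partner_net D pr) \<subseteq> arcs N2"
  proof clarify
    fix a b j assume "(a, b, j) \<in> arcs (partner_net D pr)"
    then have "a \<in> arcs T" "b \<in> arcs T" "amap F a = amap F b" "(head T a, head T b, j) \<in> verts N2"
      using D by (auto simp: partner_net_def)
    then show "(a, b, j) \<in> arcs N2"
      by (simp add: N2_verts) (auto simp: covering_network_def Let_def pullback_network_def)
  qed
  show "\<forall>a\<in>arcs (partner_net D pr). tail (partner_net D pr) a \<in> verts (partner_net D pr) \<and>
      head (partner_net D pr) a \<in> verts (partner_net D pr)"
  proof clarify
    fix a b j assume "(a, b, j) \<in> arcs (partner_net D pr)"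
    then have *: "a \<in> arcs T" "b \<in> arcs T" "amap F a = amap F b" "(head T a, head T b, j) \<in> D"
      "pr (tail T a, head T b, amap F a) (head T a, head T b, j) = (tail T a, tail T b, j)"
      by (auto simp: partner_net_def)
    have "proj (head T a, head T b, j) \<in> eqn (tail T a, head T b, amap F a)"
      using arc_eqn(1)[OF *(1-3)] by (simp add: eqn_def)
    then have "pr (tail T a, head T b, amap F a) (head T a, head T b, j) \<in> D"
      using partner_systemD(1)[OF ps *(4)] by blast
    then show "tail (partner_net D pr) (a, b, j) \<in> verts (partner_net D pr) \<and>
      head (partner_net D pr) (a, b, j) \<in> verts (partner_net D pr)" using * by simp
  qed
  show "\<forall>e\<in>edges (partner_net D pr). e \<subseteq> verts (partner_net D pr)"
    using partner_systemD(1)[OF ps] by (auto simp: partner_net_def)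
  show "edges (partner_net D pr) \<subseteq> edges N2"
  proof
    fix e assume "e \<in> edges (partner_net D pr)"
    then obtain X c where X: "X \<in> D" "proj X \<in> eqn c" "sgn3 (pr c X) = - sgn3 X" "e = {X, pr c X}"
      by (auto simp: partner_net_def)
    note P = partner_systemD[OF ps X(1,2)] and S = partner_sign[OF ps X(1,2)]
    obtain n m j where x: "X = (n, m, j)" by (metis prod.exhaust)
    obtain n' m' where y: "pr c X = (n', m', - j)" using X(3) x by (metis prod.exhaust snd_conv)
    have "(n, m, j) \<in> verts N2" "(n', m', - j) \<in> verts N2" using P(1) X(1) D x y by auto
    then have V: "(n, m) \<in> verts N1" "(n', m') \<in> verts N1" "j \<in> {-1, 1}" by (auto simp: N1_verts N2_verts)
    obtain p q \<gamma> where c: "c = (p, q, \<gamma>)" by (metis prod.exhaust)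
    have ne: "(n, m) \<noteq> (n', m')" using P(3) x y by auto
    have pj: "proj X = (n, m)" "proj (pr c X) = (n', m')" by (simp add: x, simp add: y)
    \<comment> \<open>Partners of opposite sign lie on the same side, which is exactly where the
      edges of the pullback network are.\<close>
    have "proj X \<in> eqn_heads c \<longleftrightarrow> proj (pr c X) \<in> eqn_heads c"
      using S X(3) by (simp split: if_splits)
    then have "(n, m) \<in> eqn_heads c \<and> (n', m') \<in> eqn_heads c \<or> (n, m) \<in> eqn_tails c \<and> (n', m') \<in> eqn_tails c"
      using P(2) X(2) unfolding pj eqn_def by blast
    then have "{(n, m), (n', m')} \<in> edges N1"
    proof
      assume "(n, m) \<in> eqn_heads c \<and> (n', m') \<in> eqn_heads c"
      then obtain a b where "m' = m" "a \<in> arcs T" "b \<in> arcs T" "tail T a = tail T b"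
          "head T a = n" "head T b = n'" "amap F a = amap F b"
        unfolding c eqn_heads_def by auto
      then show ?thesis using V ne N1_edge_heads[of a b m] by simp
    next
      assume "(n, m) \<in> eqn_tails c \<and> (n', m') \<in> eqn_tails c"
      then obtain a b where "n' = n" "a \<in> arcs T" "b \<in> arcs T" "head T a = head T b"
          "tail T a = m" "tail T b = m'" "amap F a = amap F b"
        unfolding c eqn_tails_def by auto
      then show ?thesis using V ne N1_edge_tails[of a b n] by simp
    qed
    from N2_edgeI[OF this V(3)] show "e \<in> edges N2"
      unfolding X(4) unfolding y unfolding x .
  qed
qed

text \<open>The arrows into \<open>n\<close> correspond to the equations with \<open>(n, m)\<close>
  among the heads, the arrows out of \<open>m\<close> to those with \<open>(n, m)\<close> among the
  tails. A partner on the other side is the arrow alternative of completeness, a partner on the same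
  side the edge alternative.\<close>

lemma partner_net_complete:
  assumes ps: "partner_system D pr"
  shows "complete_subnetwork T F T F (partner_net D pr)"
  unfolding complete_subnetwork_def
proof (clarify, intro conjI ballI impI)
  fix n m j a
  assume X: "(n, m, j) \<in> verts (partner_net D pr)" and a: "a \<in> arcs T" "head T a = n"
  define c where "c = (tail T a, m, amap F a)"
  have h: "(n, m) \<in> eqn_heads c" using a by (auto simp: c_def eqn_heads_def)
  have XD: "(n, m, j) \<in> D" "proj (n, m, j) \<in> eqn c" using X h by (auto simp: eqn_def)
  note P = partner_systemD[OF ps XD] and S = partner_sign[OF ps XD]
  obtain n' m' j' where y: "pr c (n, m, j) = (n', m', j')" by (metis prod.exhaust)
  show "(\<exists>b\<in>arcs T. head T b = m \<and> (a, b, j) \<in> arcs (partner_net D pr)) \<or>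
       (\<exists>c\<in>arcs T. tail T c = tail T a \<and> amap F a = amap F c \<and> (head T c, m, - j) \<in> verts (partner_net D pr) \<and>
          {(n, m, j), (head T c, m, - j)} \<in> edges (partner_net D pr))"
  proof (cases "(n', m') \<in> eqn_heads c")
    case True
    then obtain e where e: "e \<in> arcs T" "tail T e = tail T a" "amap F a = amap F e" "n' = head T e" "m' = m"
      by (auto simp: c_def eqn_heads_def)
    have j': "j' = - j" using S(2) h True y by simp
    have "{(n, m, j), (head T e, m, - j)} \<in> edges (partner_net D pr)"
      using partner_net_edgeI[OF XD, of pr] y e j' by simp
    then show ?thesis using e P(1) y j' by auto
  next
    case False
    then have "(n', m') \<in> eqn_tails c" using P(2) y by (auto simp: eqn_def)
    then obtain b where b: "b \<in> arcs T" "head T b = m" "amap F a = amap F b" "n' = tail T a" "m' = tail T b"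
      by (auto simp: c_def eqn_tails_def)
    have "j' = j" using S(2) h False y by simp
    then have "(a, b, j) \<in> arcs (partner_net D pr)"
      using a b XD y unfolding partner_net_def c_def by auto
    then show ?thesis using b by blast
  qed
next
  fix n m j b
  assume X: "(n, m, j) \<in> verts (partner_net D pr)" and b: "b \<in> arcs T" "tail T b = m"
  define c where "c = (n, head T b, amap F b)"
  have h: "(n, m) \<in> eqn_tails c" using b by (auto simp: c_def eqn_tails_def)
  have nh: "(n, m) \<notin> eqn_heads c" using h eqn_disjoint by blast
  have XD: "(n, m, j) \<in> D" "proj (n, m, j) \<in> eqn c" using X h by (auto simp: eqn_def)
  note P = partner_systemD[OF ps XD] and S = partner_sign[OF ps XD]
  obtain n' m' j' where y: "pr c (n, m, j) = (n', m', j')" by (metis prod.exhaust)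
  show "(\<exists>a\<in>arcs T. tail T a = n \<and> (a, b, j) \<in> arcs (partner_net D pr)) \<or>
       (\<exists>d\<in>arcs T. head T d = head T b \<and> amap F b = amap F d \<and> (n, tail T d, - j) \<in> verts (partner_net D pr) \<and>
          {(n, m, j), (n, tail T d, - j)} \<in> edges (partner_net D pr))"
  proof (cases "(n', m') \<in> eqn_heads c")
    case False
    then have "(n', m') \<in> eqn_tails c" using P(2) y by (auto simp: eqn_def)
    then obtain e where e: "e \<in> arcs T" "head T e = head T b" "amap F b = amap F e" "n' = n" "m' = tail T e"
      by (auto simp: c_def eqn_tails_def)
    have j': "j' = - j" using S(2) nh False y by simp
    have "{(n, m, j), (n, tail T e, - j)} \<in> edges (partner_net D pr)"
      using partner_net_edgeI[OF XD, of pr] y e j' by simp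
    then show ?thesis using e P(1) y j' by auto
  next
    case True
    then obtain a where a: "a \<in> arcs T" "tail T a = n" "amap F a = amap F b" "n' = head T a" "m' = head T b"
      by (auto simp: c_def eqn_heads_def)
    have "j' = j" using S(2) nh True y by simp
    then have "(a, b, j) \<in> arcs (partner_net D pr)"
      using a b XD y P(1,4) unfolding partner_net_def c_def by auto
    then show ?thesis using a by blast
  qed
qed

text \<open>Two links at \<open>Y\<close> that belong to a triangle come from the same equation, in
  which \<open>Y\<close> has only one partner; then the outer vertices coincide.\<close>

lemma partner_net_R2_free:
  assumes ps: "partner_system D pr"
  shows "R2_free T F T F (partner_net D pr)"
  unfolding R2_free_def Let_def
proof clarify
  fix X Y Z
  assume l: "link (partner_net D pr) X Y" "link (partner_net D pr) Y Z"
    and ne: "proj X \<noteq> proj Y" "proj Y \<noteq> proj Z" "proj X \<noteq> proj Z"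
    and l3: "link N1 (proj X) (proj Z)"
  from link_partnerD[OF ps link_sym[OF l(1)]] obtain c where c: "Y \<in> D" "proj Y \<in> eqn c" "X = pr c Y" by blast
  from link_partnerD[OF ps l(2)] obtain c' where c': "proj Y \<in> eqn c'" "Z = pr c' Y" by blast
  from link_eqn[OF l3] obtain d where d: "proj X \<in> eqn d" "proj Z \<in> eqn d" by blast
  have "c = c'"
    using eqn_unique[OF _ c(2) c'(1) _ d ne] partner_systemD(2)[OF ps] c c' by metis
  then show False using c c' ne by simp
qed

section \<open>Connected components of partner systems\<close>

definition component :: "(nat \<times> nat \<times> 'a \<Rightarrow> nat \<times> nat \<times> int \<Rightarrow> nat \<times> nat \<times> int)
      \<Rightarrow> nat \<times> nat \<times> int \<Rightarrow> (nat \<times> nat \<times> int) set" where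
  "component pr X = {Y. (\<lambda>Y Z. \<exists>c. proj Y \<in> eqn c \<and> Z = pr c Y)\<^sup>*\<^sup>* X Y}"

text \<open>A subset closed under \<open>pr\<close> is a partner system for the same
  \<open>pr\<close>, so a component inherits everything known about partner nets and gains
  connectedness. Reachability is directed, but links are symmetric.\<close>

lemma component:
  assumes ps: "partner_system D pr" and X: "X \<in> D"
  shows "component pr X \<subseteq> D" "X \<in> component pr X" "partner_system (component pr X) pr"
    "connected_network (partner_net (component pr X) pr)"
proof -
  let ?C = "component pr X" and ?R = "\<lambda>Y Z. \<exists>c. proj Y \<in> eqn c \<and> Z = pr c Y"
  show sub: "?C \<subseteq> D"
  proof
    fix Y assume "Y \<in> ?C"
    then have "?R\<^sup>*\<^sup>* X Y" by (simp add: component_def)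
    then show "Y \<in> D" by induction (use X partner_systemD(1)[OF ps] in auto)
  qed
  show XC: "X \<in> ?C" by (simp add: component_def)
  have cl: "pr c Y \<in> ?C" if "Y \<in> ?C" "proj Y \<in> eqn c" for c Y
  proof -
    have "?R\<^sup>*\<^sup>* X Y" using that(1) by (simp add: component_def)
    moreover have "?R Y (pr c Y)" using that(2) by blast
    ultimately have "?R\<^sup>*\<^sup>* X (pr c Y)" by (rule rtranclp.rtrancl_into_rtrancl)
    then show ?thesis by (simp add: component_def)
  qed
  show ps': "partner_system ?C pr"
    using sub cl ps unfolding partner_system_def by blast
  have reach: "(link (partner_net ?C pr))\<^sup>*\<^sup>* X Y" if "Y \<in> ?C" for Y
  proof -
    from that have "?R\<^sup>*\<^sup>* X Y" by (simp add: component_def)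
    then show ?thesis
    proof induction
      case (step Y Z)
      then have "Y \<in> ?C" by (simp add: component_def)
      from step(2) obtain c where "proj Y \<in> eqn c" "Z = pr c Y" by blast
      then have "link (partner_net ?C pr) Y Z" using link_partner[OF ps' \<open>Y \<in> ?C\<close>] by simp
      with step(3) show ?case by (rule rtranclp.rtrancl_into_rtrancl)
    qed simp
  qed
  have "symp (link (partner_net ?C pr))" using link_sym by (auto simp: symp_def)
  then have "(link (partner_net ?C pr))\<^sup>*\<^sup>* Y X" if "Y \<in> ?C" for Y
    using reach[OF that] by (metis sympD symp_rtranclp)
  with reach show "connected_network (partner_net ?C pr)"
    unfolding connected_network_def partner_net_simps by (meson rtranclp_trans)
qed

subsection \<open>Endomorphisms\<close>


text \<open>Stated with sums over arrows, which is the form matching the module action and matrix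
  products; \<open>endo_iff\<close> gives the form with signed coordinates. The coefficient ring is
  left open because integral solutions are needed too.\<close>

definition endo :: "(nat \<Rightarrow> nat \<Rightarrow> 'k::comm_ring_1) \<Rightarrow> bool" where
  "endo f \<longleftrightarrow> (\<forall>n m. f n m \<noteq> 0 \<longrightarrow> (n, m) \<in> verts N1) \<and>
     (\<forall>p q \<gamma>. (\<Sum>a\<in>{a \<in> arcs T. tail T a = p \<and> amap F a = \<gamma>}. f (head T a) q) =
        (\<Sum>b\<in>{b \<in> arcs T. head T b = q \<and> amap F b = \<gamma>}. f p (tail T b)))"

lemma eqn_sum:
  fixes f :: "nat \<Rightarrow> nat \<Rightarrow> 'k::comm_ring_1"
  shows "(\<Sum>x\<in>eqn (p, q, \<gamma>). of_int (side (p, q, \<gamma>) x) * f (fst x) (snd x)) =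
     (\<Sum>a\<in>{a \<in> arcs T. tail T a = p \<and> amap F a = \<gamma>}. f (head T a) q) -
     (\<Sum>b\<in>{b \<in> arcs T. head T b = q \<and> amap F b = \<gamma>}. f p (tail T b))"
proof -
  let ?c = "(p, q, \<gamma>)"
  have fin: "finite (eqn_heads ?c)" "finite (eqn_tails ?c)"
    using finite_eqn[of ?c] by (auto simp: eqn_def)
  have h: "(\<Sum>x\<in>eqn_heads ?c. f (fst x) (snd x)) = (\<Sum>a\<in>{a \<in> arcs T. tail T a = p \<and> amap F a = \<gamma>}. f (head T a) q)"
  proof -
    have "eqn_heads ?c = (\<lambda>a. (head T a, q)) ` {a \<in> arcs T. tail T a = p \<and> amap F a = \<gamma>}"
      by (auto simp: eqn_heads_def)
    moreover have "inj_on (\<lambda>a. (head T a, q)) {a \<in> arcs T. tail T a = p \<and> amap F a = \<gamma>}"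
      using arc_unique' by (auto simp: inj_on_def)
    ultimately show ?thesis by (simp add: sum.reindex)
  qed
  have t: "(\<Sum>x\<in>eqn_tails ?c. f (fst x) (snd x)) = (\<Sum>b\<in>{b \<in> arcs T. head T b = q \<and> amap F b = \<gamma>}. f p (tail T b))"
  proof -
    have "eqn_tails ?c = (\<lambda>b. (p, tail T b)) ` {b \<in> arcs T. head T b = q \<and> amap F b = \<gamma>}"
      by (auto simp: eqn_tails_def)
    moreover have "inj_on (\<lambda>b. (p, tail T b)) {b \<in> arcs T. head T b = q \<and> amap F b = \<gamma>}"
      using arc_unique' by (auto simp: inj_on_def)
    ultimately show ?thesis by (simp add: sum.reindex)
  qed
  have "(\<Sum>x\<in>eqn ?c. of_int (side ?c x) * f (fst x) (snd x)) =
      (\<Sum>x\<in>eqn_heads ?c. of_int (side ?c x) * f (fst x) (snd x)) + (\<Sum>x\<in>eqn_tails ?c. of_int (side ?c x) * f (fst x) (snd x))"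
    unfolding eqn_def using eqn_disjoint fin by (intro sum.union_disjoint) auto
  also have "(\<Sum>x\<in>eqn_heads ?c. of_int (side ?c x) * f (fst x) (snd x)) = (\<Sum>x\<in>eqn_heads ?c. f (fst x) (snd x))"
    by (rule sum.cong) (auto simp: side_def)
  also have "(\<Sum>x\<in>eqn_tails ?c. of_int (side ?c x) * f (fst x) (snd x)) = (\<Sum>x\<in>eqn_tails ?c. - f (fst x) (snd x))"
    using eqn_disjoint[of ?c] by (intro sum.cong) (auto simp: side_def)
  finally show ?thesis using h t by (simp add: sum_negf)
qed

lemma endo_iff:
  fixes f :: "nat \<Rightarrow> nat \<Rightarrow> 'k::comm_ring_1"
  shows "endo f \<longleftrightarrow> (\<forall>n m. f n m \<noteq> 0 \<longrightarrow> (n, m) \<in> verts N1) \<and>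
    (\<forall>c. (\<Sum>x\<in>eqn c. of_int (side c x) * f (fst x) (snd x)) = 0)"
  unfolding endo_def split_paired_All eqn_sum by auto

lemma endo_support_card:
  fixes f :: "nat \<Rightarrow> nat \<Rightarrow> 'k::idom"
  assumes "endo f"
  shows "card ({(n, m). f n m \<noteq> 0} \<inter> eqn c) \<noteq> 1"
proof
  assume "card ({(n, m). f n m \<noteq> 0} \<inter> eqn c) = 1"
  then obtain x where x: "{(n, m). f n m \<noteq> 0} \<inter> eqn c = {x}" by (auto simp: card_1_singleton_iff)
  then have "x \<in> {(n, m). f n m \<noteq> 0} \<inter> eqn c" by blast
  then have x': "x \<in> eqn c" "f (fst x) (snd x) \<noteq> 0" by (auto simp: case_prod_beta)
  have "(\<Sum>y\<in>eqn c. of_int (side c y) * f (fst y) (snd y)) =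
      (\<Sum>y\<in>{x}. of_int (side c y) * f (fst y) (snd y))"
  proof (rule sum.mono_neutral_right)
    show "\<forall>i\<in>eqn c - {x}. of_int (side c i) * f (fst i) (snd i) = 0"
    proof
      fix i assume "i \<in> eqn c - {x}"
      then have "f (fst i) (snd i) = 0" using x by auto
      then show "of_int (side c i) * f (fst i) (snd i) = 0" by simp
    qed
  qed (use x' finite_eqn in auto)
  also have "\<dots> \<noteq> 0" using x' by (simp add: side_def)
  finally show False using assms unfolding endo_iff by blast
qed

section \<open>Integral endomorphisms from signed coordinates\<close>

definition sign_sum :: "(nat \<times> nat \<times> int) set \<Rightarrow> nat \<Rightarrow> nat \<Rightarrow> int" where
  "sign_sum D n m = (\<Sum>X\<in>{X \<in> D. proj X = (n, m)}. sgn3 X)"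

lemma finite_N2: "finite (verts N2)"
proof -
  have "verts N2 \<subseteq> verts T \<times> verts T \<times> {-1, 1}"
    by (auto simp: N2_verts)
  then show ?thesis by (rule finite_subset) simp
qed

lemma sign_sum_eq:
  assumes "D \<subseteq> verts N2"
  shows "sign_sum D n m = (if (n, m, 1) \<in> D then 1 else 0) - (if (n, m, - 1) \<in> D then 1 else 0)"
proof -
  have "{X \<in> D. proj X = (n, m)} = (if (n, m, 1) \<in> D then {(n, m, 1)} else {}) \<union> (if (n, m, - 1) \<in> D then {(n, m, - 1)} else {})"
    using assms N2_verts by (force simp: proj_def split: if_splits)
  then show ?thesis unfolding sign_sum_def by auto
qed

lemma endo_sign_sum:
  assumes ps: "partner_system D pr"
  shows "endo (sign_sum D)"
  unfolding endo_iff
proof (intro conjI allI impI)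
  have D: "D \<subseteq> verts N2" using ps by (simp add: partner_system_def)
  then have fin: "finite D" using finite_N2 finite_subset by blast
  show "(n, m) \<in> verts N1" if "sign_sum D n m \<noteq> 0" for n m
  proof -
    have "(n, m, 1) \<in> D \<or> (n, m, - 1) \<in> D" using that sign_sum_eq[OF D] by (auto split: if_splits)
    then show ?thesis using D by (auto simp: N1_verts N2_verts)
  qed
  fix c
  define S where "S = {X \<in> D. proj X \<in> eqn c}"
  let ?h = "\<lambda>X. side c (proj X) * sgn3 X"
  have "(\<Sum>x\<in>eqn c. of_int (side c x) * sign_sum D (fst x) (snd x)) = (\<Sum>x\<in>eqn c. \<Sum>X\<in>{X \<in> S. proj X = x}. ?h X)"
  proof (rule sum.cong[OF refl])
    fix x assume x: "x \<in> eqn c"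
    have "{X \<in> D. proj X = (fst x, snd x)} = {X \<in> S. proj X = x}" using x by (auto simp: S_def)
    then show "of_int (side c x) * sign_sum D (fst x) (snd x) = (\<Sum>X\<in>{X \<in> S. proj X = x}. ?h X)"
      unfolding sign_sum_def by (simp add: sum_distrib_left)
  qed
  also have "\<dots> = sum ?h S"
    by (rule sum.group) (use fin finite_eqn in \<open>auto simp: S_def\<close>)
  \<comment> \<open>\<open>pr c\<close> permutes the terms and negates each of them, so the integer
    sum equals its own negative.\<close>
  also have "\<dots> = 0"
  proof -
    have "bij_betw (pr c) S S"
      by (rule bij_betwI[of _ _ _ "pr c"]) (use partner_systemD[OF ps] in \<open>auto simp: S_def\<close>)
    then have "sum ?h S = (\<Sum>X\<in>S. ?h (pr c X))" by (rule sum.reindex_bij_betw[symmetric])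
    also have "\<dots> = (\<Sum>X\<in>S. - ?h X)"
    proof (rule sum.cong[OF refl])
      fix X assume "X \<in> S"
      then have "sgn3 (pr c X) * side c (proj (pr c X)) = - sgn3 X * side c (proj X)"
        using partner_systemD(5)[OF ps] by (simp add: S_def)
      then show "?h (pr c X) = - ?h X" by (simp add: mult.commute)
    qed
    also have "\<dots> = - sum ?h S" by (rule sum_negf)
    finally show ?thesis by simp
  qed
  finally show "(\<Sum>x\<in>eqn c. of_int (side c x) * sign_sum D (fst x) (snd x)) = 0" .
qed

lemma partner_net_graph_map:
  assumes ps: "partner_system D pr" and inv: "involution_free (partner_net D pr)" and X: "X \<in> D"
  shows "generalised_graph_map T F T F (partner_net (component pr X) pr)"
proof -
  note C = component[OF ps X]
  have "involution_free (partner_net (component pr X) pr)"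
    using inv C(1) unfolding involution_free_def partner_net_simps by blast
  then show ?thesis
    unfolding generalised_graph_map_def
    using C partner_net_subnetwork[OF C(3)] partner_net_complete[OF C(3)] partner_net_R2_free[OF C(3)] by auto
qed

text \<open>A vanishing sign sum says that each coordinate occurs with both lifts or with neither,
  which is invariance under the involution.\<close>

lemma partner_net_ghost:
  assumes ps: "partner_system D pr" and X: "X \<in> D" and z: "sign_sum (component pr X) = (\<lambda>_ _. 0)"
  shows "ghost T F T F (partner_net (component pr X) pr)"
proof -
  note C = component[OF ps X]
  have sub: "component pr X \<subseteq> verts N2" using C(3) by (simp add: partner_system_def)
  have both: "(n, m, 1) \<in> component pr X \<longleftrightarrow> (n, m, - 1) \<in> component pr X" for n m
    using sign_sum_eq[OF sub, of n m] z by (auto split: if_splits)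
  have "involution_invariant N2 (partner_net (component pr X) pr)"
    unfolding involution_invariant_def partner_net_simps
  proof
    show "component pr X \<subseteq> {x \<in> verts N2. proj x \<in> proj ` component pr X}" using sub by auto
    show "{x \<in> verts N2. proj x \<in> proj ` component pr X} \<subseteq> component pr X"
    proof clarify
      fix n m j n' m' j'
      assume a: "(n, m, j) \<in> verts N2" "(n', m', j') \<in> component pr X" "proj (n, m, j) = proj (n', m', j')"
      then have "(n, m, j') \<in> component pr X" by simp
      moreover have "j' = 1 \<or> j' = - 1" "j = 1 \<or> j = - 1" using a sub by (auto simp: N2_verts)
      ultimately show "(n, m, j) \<in> component pr X" using both by auto
    qed
  qed
  then show ?thesis
    unfolding ghost_def
    using C partner_net_subnetwork[OF C(3)] partner_net_complete[OF C(3)] partner_net_R2_free[OF C(3)] by auto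
qed

text \<open>The lift of \<open>x\<close> that contributes positively to an equation is paired with the negative lift of
  the image of \<open>x\<close> under a derangement.\<close>

lemma partner_system_lift:
  assumes S: "S \<subseteq> verts N1" and card: "\<And>c. card (S \<inter> eqn c) \<noteq> 1"
  shows "\<exists>pr. partner_system {(n, m, j). (n, m) \<in> S \<and> j \<in> {-1, 1}} pr"
proof (rule partner_system_of_bij)
  let ?D = "{(n, m, j). (n, m) \<in> S \<and> j \<in> {-1, 1 :: int}}"
  show "?D \<subseteq> verts N2" using S by (auto simp: N1_verts N2_verts)
  fix c
  obtain \<sigma> where \<sigma>: "bij_betw \<sigma> (S \<inter> eqn c) (S \<inter> eqn c)" "\<And>x. x \<in> S \<inter> eqn c \<Longrightarrow> \<sigma> x \<noteq> x"
    using derangement_exists[OF _ card[of c]] finite_eqn[of c] by blast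
  let ?up = "\<lambda>x. (fst x, snd x, side c x)" and ?down = "\<lambda>x. (fst x, snd x, - side c x)"
  have bp: "bij_betw proj (plus_part ?D c) (S \<inter> eqn c)"
    by (rule bij_betwI[of _ _ _ ?up]) (use side_cases[of c] in \<open>auto simp: plus_part_def\<close>)
  have bm: "bij_betw ?down (S \<inter> eqn c) (minus_part ?D c)"
    by (rule bij_betwI[of _ _ _ proj]) (use side_cases[of c] in \<open>auto simp: minus_part_def side_def\<close>)
  have "bij_betw (?down \<circ> \<sigma> \<circ> proj) (plus_part ?D c) (minus_part ?D c)"
    using bij_betw_trans[OF bij_betw_trans[OF bp \<sigma>(1)] bm] by (simp add: comp_assoc)
  moreover have "proj ((?down \<circ> \<sigma> \<circ> proj) X) \<noteq> proj X" if "X \<in> plus_part ?D c" for X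
  proof -
    have "proj X \<in> S \<inter> eqn c" using bp that by (auto simp: bij_betw_def)
    then show ?thesis using \<sigma>(2)[of "proj X"] by simp
  qed
  ultimately show "\<exists>\<beta>. bij_betw \<beta> (plus_part ?D c) (minus_part ?D c) \<and> (\<forall>X\<in>plus_part ?D c. proj (\<beta> X) \<noteq> proj X)"
    by blast
qed

text \<open>The equation says that as many terms contribute 1 as contribute -1, so any bijection
  between them will do. It moves every coordinate, since each coordinate has only one lift here and
  that lift cannot contribute both values.\<close>

lemma partner_system_signed:
  fixes f :: "nat \<Rightarrow> nat \<Rightarrow> int"
  assumes f: "endo f" and unit: "\<And>n m. f n m \<in> {-1, 0, 1}"
  shows "\<exists>pr. partner_system {(n, m, j). j = f n m \<and> j \<noteq> 0} pr"
proof (rule partner_system_of_bij)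
  let ?D = "{(n, m, j). j = f n m \<and> j \<noteq> 0}"
  show sub: "?D \<subseteq> verts N2" using f unit by (force simp: endo_def N1_verts N2_verts)
  fix c
  have fin: "finite ?D" using sub finite_N2 finite_subset by blast
  have fp: "finite (plus_part ?D c)" "finite (minus_part ?D c)"
    using fin by (auto simp: plus_part_def minus_part_def)
  let ?h = "\<lambda>X. side c (proj X) * sgn3 X"
  have split: "{X \<in> ?D. proj X \<in> eqn c} = plus_part ?D c \<union> minus_part ?D c"
    using unit side_cases[of c] unfolding plus_part_def minus_part_def by force
  have "plus_part ?D c \<inter> minus_part ?D c = {}"
    by (auto simp: plus_part_def minus_part_def side_def split: if_splits)
  then have "(\<Sum>X\<in>{X \<in> ?D. proj X \<in> eqn c}. ?h X) = sum ?h (plus_part ?D c) + sum ?h (minus_part ?D c)"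
    unfolding split using fp by (intro sum.union_disjoint)
  also have "sum ?h (plus_part ?D c) = (\<Sum>X\<in>plus_part ?D c. 1)"
    by (rule sum.cong) (auto simp: plus_part_def side_def split: if_splits)
  also have "sum ?h (minus_part ?D c) = (\<Sum>X\<in>minus_part ?D c. - 1)"
    by (rule sum.cong) (auto simp: minus_part_def side_def split: if_splits)
  also have "(\<Sum>X\<in>{X \<in> ?D. proj X \<in> eqn c}. ?h X) = (\<Sum>x\<in>{x \<in> eqn c. f (fst x) (snd x) \<noteq> 0}. side c x * f (fst x) (snd x))"
    by (rule sum.reindex_bij_witness[of _ "\<lambda>x. (fst x, snd x, f (fst x) (snd x))" proj]) auto
  also have "\<dots> = (\<Sum>x\<in>eqn c. side c x * f (fst x) (snd x))"
    by (rule sum.mono_neutral_left) (auto simp: finite_eqn)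
  also have "\<dots> = 0"
  proof -
    have "(\<Sum>x\<in>eqn c. of_int (side c x) * f (fst x) (snd x)) = 0" using f unfolding endo_iff by blast
    then show ?thesis by simp
  qed
  finally have "card (plus_part ?D c) = card (minus_part ?D c)" by simp
  then obtain \<beta> where \<beta>: "bij_betw \<beta> (plus_part ?D c) (minus_part ?D c)"
    using finite_same_card_bij[OF fp] by blast
  have "proj (\<beta> X) \<noteq> proj X" if "X \<in> plus_part ?D c" for X
  proof
    assume eq: "proj (\<beta> X) = proj X"
    have m: "\<beta> X \<in> minus_part ?D c" using \<beta> that by (auto simp: bij_betw_def)
    then have "\<beta> X \<in> ?D" "X \<in> ?D" using that by (simp_all add: plus_part_def minus_part_def)
    with eq have "\<beta> X = X" by (cases "\<beta> X"; cases X) auto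
    with m that show False by (auto simp: plus_part_def minus_part_def side_def split: if_splits)
  qed
  with \<beta> show "\<exists>\<beta>. bij_betw \<beta> (plus_part ?D c) (minus_part ?D c) \<and> (\<forall>X\<in>plus_part ?D c. proj (\<beta> X) \<noteq> proj X)"
    by blast
qed

definition graph_support :: "(nat \<times> nat) set" where
  "graph_support = {(n, m). \<exists>G. generalised_graph_map T F T F G \<and> (\<exists>j\<in>{-1, 1}. (n, m, j) \<in> verts G)}"

text \<open>The first pairing uses both lifts of every coordinate, and ghost-freeness makes the sign
  sum \<open>f\<close> of a component non-zero. The second pairing uses one lift per coordinate in
  the support of \<open>f\<close>, so its components are involution-free. Both supports stay inside
  \<open>S\<close>; the entry 1 or -1 is provided as a pivot.\<close>

lemma graph_map_in_support:
  assumes gf: "ghost_free T F T F" and S: "S \<subseteq> verts N1" "S \<noteq> {}" and card: "\<And>c. card (S \<inter> eqn c) \<noteq> 1"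
  shows "\<exists>f :: nat \<Rightarrow> nat \<Rightarrow> int. endo f \<and> (\<forall>n m. f n m \<noteq> 0 \<longrightarrow> (n, m) \<in> S \<inter> graph_support) \<and> (\<exists>n m. f n m \<in> {-1, 1})"
proof -
  let ?D = "{(n, m, j). (n, m) \<in> S \<and> j \<in> {-1, 1 :: int}}"
  obtain pr where ps: "partner_system ?D pr" using partner_system_lift[OF S(1) card] by blast
  obtain n0 m0 where "(n0, m0) \<in> S" using S(2) by auto
  then have X0: "(n0, m0, 1) \<in> ?D" by simp
  let ?C = "component pr (n0, m0, 1)"
  note C = component[OF ps X0]
  have subC: "?C \<subseteq> verts N2" using C(3) by (simp add: partner_system_def)
  define f where "f = sign_sum ?C"
  have ef: "endo f" unfolding f_def by (rule endo_sign_sum[OF C(3)])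
  have unit: "f n m \<in> {-1, 0, 1}" for n m
    unfolding f_def sign_sum_eq[OF subC] by simp
  have fS: "(n, m) \<in> S" if "f n m \<noteq> 0" for n m
  proof -
    have "(n, m, 1) \<in> ?C \<or> (n, m, - 1) \<in> ?C"
      using that unfolding f_def sign_sum_eq[OF subC] by (auto split: if_splits)
    then show ?thesis using C(1) by auto
  qed
  have "f \<noteq> (\<lambda>_ _. 0)"
    using gf partner_net_ghost[OF ps X0] unfolding f_def ghost_free_def by blast
  then obtain n m where nm: "f n m \<noteq> 0" by (auto simp: fun_eq_iff)
  let ?E = "{(n, m, j). j = f n m \<and> j \<noteq> 0}"
  obtain pr' where ps': "partner_system ?E pr'" using partner_system_signed[OF ef unit] by blast
  have inv: "involution_free (partner_net ?E pr')"
    unfolding involution_free_def by auto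
  have X1: "(n, m, f n m) \<in> ?E" using nm by simp
  let ?C' = "component pr' (n, m, f n m)"
  note C' = component[OF ps' X1]
  have subC': "?C' \<subseteq> verts N2" using C'(3) by (simp add: partner_system_def)
  have gm: "generalised_graph_map T F T F (partner_net ?C' pr')" by (rule partner_net_graph_map[OF ps' inv X1])
  define g where "g = sign_sum ?C'"
  have "endo g" unfolding g_def by (rule endo_sign_sum[OF C'(3)])
  moreover have "(n', m') \<in> S \<inter> graph_support" if "g n' m' \<noteq> 0" for n' m'
  proof -
    have "(n', m', 1) \<in> ?C' \<or> (n', m', - 1) \<in> ?C'"
      using that unfolding g_def sign_sum_eq[OF subC'] by (auto split: if_splits)
    then obtain j where j: "j \<in> {-1, 1}" "(n', m', j) \<in> ?C'" by blast
    then have "f n' m' \<noteq> 0" using C'(1) by auto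
    moreover have "(n', m') \<in> graph_support"
      unfolding graph_support_def using gm j by (auto intro!: exI[of _ "partner_net ?C' pr'"])
    ultimately show ?thesis using fS by simp
  qed
  \<comment> \<open>No cancellation occurs at the starting coordinate, because its opposite lift is
    absent.\<close>
  moreover have "g n m \<in> {-1, 1}"
  proof -
    have "(n, m, f n m) \<in> ?C'" "(n, m, - f n m) \<notin> ?C'" using C' nm by auto
    then show ?thesis using unit[of n m] nm unfolding g_def sign_sum_eq[OF subC'] by auto
  qed
  ultimately show ?thesis by blast
qed


section \<open>The algebra of endomorphisms and its integral generators\<close>

abbreviation "V \<equiv> verts T"

lemma endo_supported: "endo f \<Longrightarrow> supported V f"
  by (auto simp: endo_def supported_def N1_verts)

lemma endo_zero: "endo (0 :: nat \<Rightarrow> nat \<Rightarrow> 'k::comm_ring_1)"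
  by (simp add: endo_def)

lemma endo_add:
  fixes f g :: "nat \<Rightarrow> nat \<Rightarrow> 'k::comm_ring_1"
  assumes "endo f" "endo g"
  shows "endo (f + g)"
  using assms unfolding endo_def by (auto simp: sum.distrib) (metis add.right_neutral)+

lemma endo_scale: "endo f \<Longrightarrow> endo (mscale c f)"
  unfolding endo_def mscale_def sum_distrib_left[symmetric] by (metis mult_zero_right)

lemma endo_diff:
  fixes f g :: "nat \<Rightarrow> nat \<Rightarrow> 'k::comm_ring_1"
  assumes "endo f" "endo g"
  shows "endo (f - g)"
proof -
  have "f - g = f + mscale (- 1) g" by (simp add: fun_eq_iff mscale_def)
  then show ?thesis using assms by (simp only: endo_add endo_scale)
qed

lemma endo_of_int_mat:
  assumes "endo f"
  shows "endo (of_int_mat f :: nat \<Rightarrow> nat \<Rightarrow> 'k::field)"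
proof -
  have "f n m \<noteq> 0" if "(of_int (f n m) :: 'k) \<noteq> 0" for n m using that by (intro notI) simp
  with assms show ?thesis unfolding endo_def of_int_mat_def of_int_sum[symmetric] by simp
qed

lemma endo_mone: "endo (mone V :: nat \<Rightarrow> nat \<Rightarrow> 'k::comm_ring_1)"
  unfolding endo_def
proof (intro conjI allI impI)
  fix n m assume "mone V n m \<noteq> (0 :: 'k)"
  then show "(n, m) \<in> verts N1" by (auto simp: mone_def N1_verts split: if_splits)
next
  fix p q \<gamma>
  let ?A = "{a \<in> arcs T. tail T a = p \<and> head T a = q \<and> amap F a = \<gamma>}"
  have "(\<Sum>a\<in>{a \<in> arcs T. tail T a = p \<and> amap F a = \<gamma>}. mone V (head T a) q) = (\<Sum>a\<in>?A. 1 :: 'k)"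
    by (rule sum.mono_neutral_cong_right) (auto simp: mone_def)
  moreover have "(\<Sum>b\<in>{b \<in> arcs T. head T b = q \<and> amap F b = \<gamma>}. mone V p (tail T b)) = (\<Sum>a\<in>?A. 1 :: 'k)"
    by (rule sum.mono_neutral_cong_right) (auto simp: mone_def)
  ultimately show "(\<Sum>a\<in>{a \<in> arcs T. tail T a = p \<and> amap F a = \<gamma>}. mone V (head T a) q) =
      (\<Sum>b\<in>{b \<in> arcs T. head T b = q \<and> amap F b = \<gamma>}. mone V p (tail T b) :: 'k)" by simp
qed

text \<open>Both sides equal the sum of \<open>f p (tail T b) * g (head T b) q\<close> over all
  arrows \<open>b\<close> labelled \<open>\<gamma>\<close>: grouping by heads uses the equations of
  \<open>f\<close>, grouping by tails those of \<open>g\<close>.\<close>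

lemma endo_mmul:
  fixes f g :: "nat \<Rightarrow> nat \<Rightarrow> 'k::comm_ring_1"
  assumes f: "endo f" and g: "endo g"
  shows "endo (mmul V f g)"
  unfolding endo_def
proof (intro conjI allI impI)
  fix n m assume "mmul V f g n m \<noteq> 0"
  then obtain k where "f n k * g k m \<noteq> 0" unfolding mmul_def by (meson sum.neutral)
  then have "f n k \<noteq> 0" "g k m \<noteq> 0" by auto
  then have "(n, k) \<in> verts N1" "(k, m) \<in> verts N1" using f g unfolding endo_def by blast+
  then show "(n, m) \<in> verts N1" by (simp add: N1_verts)
next
  fix p q \<gamma>
  let ?A = "{a \<in> arcs T. amap F a = \<gamma>}"
  have ef: "(\<Sum>a\<in>{a \<in> arcs T. tail T a = p \<and> amap F a = \<gamma>}. f (head T a) k) =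
      (\<Sum>b\<in>{b \<in> arcs T. head T b = k \<and> amap F b = \<gamma>}. f p (tail T b))" for k
    using f unfolding endo_def by blast
  have eg: "(\<Sum>a\<in>{a \<in> arcs T. tail T a = k \<and> amap F a = \<gamma>}. g (head T a) q) =
      (\<Sum>b\<in>{b \<in> arcs T. head T b = q \<and> amap F b = \<gamma>}. g k (tail T b))" for k
    using g unfolding endo_def by blast
  have "(\<Sum>a\<in>{a \<in> arcs T. tail T a = p \<and> amap F a = \<gamma>}. mmul V f g (head T a) q) =
      (\<Sum>k\<in>V. (\<Sum>a\<in>{a \<in> arcs T. tail T a = p \<and> amap F a = \<gamma>}. f (head T a) k) * g k q)"
    unfolding mmul_def sum_distrib_right by (rule sum.swap)
  also have "\<dots> = (\<Sum>k\<in>V. \<Sum>b\<in>{b \<in> ?A. head T b = k}. f p (tail T b) * g (head T b) q)"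
    unfolding ef sum_distrib_right by (intro sum.cong) auto
  also have "\<dots> = (\<Sum>b\<in>?A. f p (tail T b) * g (head T b) q)"
    by (rule sum.group) auto
  also have "\<dots> = (\<Sum>k\<in>V. \<Sum>b\<in>{b \<in> ?A. tail T b = k}. f p (tail T b) * g (head T b) q)"
    by (rule sum.group[symmetric]) auto
  also have "\<dots> = (\<Sum>k\<in>V. f p k * (\<Sum>a\<in>{a \<in> arcs T. tail T a = k \<and> amap F a = \<gamma>}. g (head T a) q))"
    unfolding sum_distrib_left by (intro sum.cong) auto
  also have "\<dots> = (\<Sum>b\<in>{b \<in> arcs T. head T b = q \<and> amap F b = \<gamma>}. mmul V f g p (tail T b))"
    unfolding eg mmul_def sum_distrib_left by (rule sum.swap)
  finally show "(\<Sum>a\<in>{a \<in> arcs T. tail T a = p \<and> amap F a = \<gamma>}. mmul V f g (head T a) q) =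
      (\<Sum>b\<in>{b \<in> arcs T. head T b = q \<and> amap F b = \<gamma>}. mmul V f g p (tail T b))" .
qed

definition graph_endos :: "(nat \<Rightarrow> nat \<Rightarrow> int) set" where
  "graph_endos = {g. endo g \<and> (\<forall>n m. g n m \<noteq> 0 \<longrightarrow> (n, m) \<in> graph_support)}"

lemma endo_in_span:
  fixes f :: "nat \<Rightarrow> nat \<Rightarrow> 'k::field"
  assumes gf: "ghost_free T F T F" and f: "endo f"
  shows "f \<in> mat.span (of_int_mat ` graph_endos)"
  using f
proof (induction "card {(n, m). f n m \<noteq> 0}" arbitrary: f rule: less_induct)
  case less
  let ?S = "\<lambda>f. {(n, m). f n m \<noteq> (0 :: 'k)}"
  have sub: "?S f \<subseteq> verts N1" using less.prems unfolding endo_def by auto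
  have fin: "finite (?S f)"
    by (rule finite_subset[of _ "V \<times> V"]) (use sub in \<open>auto simp: N1_verts\<close>)
  show ?case
  proof (cases "?S f = {}")
    case True
    then have "f = 0" by (auto simp: fun_eq_iff)
    then show ?thesis by (simp only: mat.span_zero)
  next
    case False
    from graph_map_in_support[OF gf sub False endo_support_card[OF less.prems]]
    obtain g :: "nat \<Rightarrow> nat \<Rightarrow> int" and n m where g: "endo g"
      "\<And>n m. g n m \<noteq> 0 \<Longrightarrow> (n, m) \<in> ?S f \<inter> graph_support" "g n m \<in> {-1, 1}" by blast
    \<comment> \<open>\<open>g n m\<close> is its own inverse, so subtracting \<open>c\<close> times
      \<open>g\<close> clears the entry \<open>(n, m)\<close>, whatever the field.\<close>
    define c where "c = f n m * of_int (g n m)"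
    define h where "h = f - mscale c (of_int_mat g)"
    have eh: "endo h" unfolding h_def using less.prems g(1)
      by (intro endo_diff endo_scale endo_of_int_mat)
    have "h n m = 0" using g(3) by (auto simp: h_def c_def mscale_def of_int_mat_def)
    moreover have "?S h \<subseteq> ?S f"
    proof clarify
      fix n m assume a: "h n m \<noteq> 0" "f n m = 0"
      then have "g n m \<noteq> 0" by (auto simp: h_def mscale_def of_int_mat_def)
      with g(2) a show False by auto
    qed
    moreover have "(n, m) \<in> ?S f" using g(2)[of n m] g(3) by auto
    ultimately have "?S h \<subset> ?S f" by blast
    then have "h \<in> mat.span (of_int_mat ` graph_endos)"
      using less.hyps[OF psubset_card_mono[OF fin]] eh by blast
    moreover have "of_int_mat g \<in> mat.span (of_int_mat ` graph_endos)"
      using g(1,2) by (intro mat.span_base) (auto simp: graph_endos_def)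
    ultimately have "h + mscale c (of_int_mat g) \<in> mat.span (of_int_mat ` graph_endos)"
      by (intro mat.span_add mat.span_scale)
    then show ?thesis by (simp add: h_def)
  qed
qed

lemma endo_support:
  fixes f :: "nat \<Rightarrow> nat \<Rightarrow> 'k::field"
  assumes gf: "ghost_free T F T F" and f: "endo f" and nz: "f n m \<noteq> 0"
  shows "(n, m) \<in> graph_support"
proof (rule ccontr)
  assume nm: "(n, m) \<notin> graph_support"
  from endo_in_span[OF gf f] have "f n m = 0"
  proof (induction rule: mat.span_induct_alt)
    case base then show ?case by simp
  next
    case (step c x y)
    then obtain X where X: "X \<in> graph_endos" "x = of_int_mat X" by blast
    then have "X n m = 0" using nm by (auto simp: graph_endos_def)
    then have "x n m = 0" by (simp add: X of_int_mat_def)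
    with step show ?case by (simp add: mscale_def)
  qed
  with nz show False by simp
qed

lemma graph_support_verts:
  assumes "(n, m) \<in> graph_support"
  shows "n \<in> V" "m \<in> V"
proof -
  obtain G j where "subnetwork G N2" "(n, m, j) \<in> verts G"
    using assms by (auto simp: graph_support_def generalised_graph_map_def)
  then have "(n, m, j) \<in> verts N2" by (auto simp: subnetwork_def)
  then show "n \<in> V" "m \<in> V" by (simp_all add: N2_verts)
qed

lemma tree_induct:
  assumes "r \<in> V" "n \<in> V" "P r" and "\<And>a. a \<in> arcs T \<Longrightarrow> P (tail T a) \<longleftrightarrow> P (head T a)"
  shows "P n"
proof -
  have "connected T" using tree by (simp add: tree_quiver_def)
  then have "r \<rightarrow>\<^sup>*\<^bsub>with_proj (mk_symmetric T)\<^esub> n"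
    using assms(1,2) by (auto simp: connected_def strongly_connected_def)
  then have "(r, n) \<in> rtrancl_on V (parcs (mk_symmetric T))"
    by (simp add: reachable_def)
  then show ?thesis
  proof (induction rule: rtrancl_on_induct)
    case base then show ?case using assms(3) by simp
  next
    case (step y z)
    then show ?case using assms(4) by (auto simp: parcs_mk_symmetric)
  qed
qed

end

section \<open>Consequences of the two conditions on graph maps\<close>

locale tree_over_restricted = tree_over T F
  for T :: "(nat, 'e) pre_digraph" and F :: "(nat, 'e, 'v, 'a) quiver_map" +
  assumes gf: "ghost_free T F T F"
    and heads_not_supported: "a \<in> arcs T \<Longrightarrow> b \<in> arcs T \<Longrightarrow> amap F a = amap F b \<Longrightarrow>
      tail T a = tail T b \<Longrightarrow> head T a \<noteq> head T b \<Longrightarrow> (head T a, head T b) \<notin> graph_support"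
    and tails_not_supported: "a \<in> arcs T \<Longrightarrow> b \<in> arcs T \<Longrightarrow> amap F a = amap F b \<Longrightarrow>
      head T a = head T b \<Longrightarrow> tail T a \<noteq> tail T b \<Longrightarrow> (tail T a, tail T b) \<notin> graph_support"
    and support_asym: "n \<noteq> m \<Longrightarrow> (n, m) \<in> graph_support \<Longrightarrow> (m, n) \<notin> graph_support"
begin

text \<open>In the equation given by the tail, the head and the label of \<open>a\<close>, every
  coordinate other than the two diagonal ones is a pair of distinct heads or of distinct tails of
  equally labelled arrows, so it lies outside the support.\<close>

lemma endo_diag_arc:
  fixes f :: "nat \<Rightarrow> nat \<Rightarrow> 'k::field"
  assumes f: "endo f" and a: "a \<in> arcs T"
  shows "f (tail T a) (tail T a) = f (head T a) (head T a)"
proof -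
  let ?p = "tail T a" and ?q = "head T a" and ?g = "amap F a"
  have "(\<Sum>b\<in>{b \<in> arcs T. tail T b = ?p \<and> amap F b = ?g}. f (head T b) ?q) = (\<Sum>b\<in>{a}. f (head T b) ?q)"
  proof (rule sum.mono_neutral_right)
    show "\<forall>b\<in>{b \<in> arcs T. tail T b = ?p \<and> amap F b = ?g} - {a}. f (head T b) ?q = 0"
    proof
      fix b assume b: "b \<in> {b \<in> arcs T. tail T b = ?p \<and> amap F b = ?g} - {a}"
      then have "head T b \<noteq> ?q" using arc_unique'[of a b] a by auto
      then show "f (head T b) ?q = 0" using endo_support[OF gf f] heads_not_supported[of b a] a b by fastforce
    qed
  qed (use a in auto)
  moreover have "(\<Sum>b\<in>{b \<in> arcs T. head T b = ?q \<and> amap F b = ?g}. f ?p (tail T b)) = (\<Sum>b\<in>{a}. f ?p (tail T b))"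
  proof (rule sum.mono_neutral_right)
    show "\<forall>b\<in>{b \<in> arcs T. head T b = ?q \<and> amap F b = ?g} - {a}. f ?p (tail T b) = 0"
    proof
      fix b assume b: "b \<in> {b \<in> arcs T. head T b = ?q \<and> amap F b = ?g} - {a}"
      then have "tail T b \<noteq> ?p" using arc_unique'[of a b] a by auto
      then show "f ?p (tail T b) = 0" using endo_support[OF gf f] tails_not_supported[of a b] a b by fastforce
    qed
  qed (use a in auto)
  ultimately show ?thesis using f unfolding endo_def by simp
qed

lemma endo_diag:
  fixes f :: "nat \<Rightarrow> nat \<Rightarrow> 'k::field"
  assumes f: "endo f" and "r \<in> V" "n \<in> V"
  shows "f n n = f r r"
  using assms(2,3) by (rule tree_induct) (auto simp: endo_diag_arc[OF f])

text \<open>An off-diagonal summand \<open>f n k * g k n\<close> would need both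
  \<open>(n, k)\<close> and \<open>(k, n)\<close> in the support of endomorphisms.\<close>

lemma endo_mmul_diag:
  fixes f g :: "nat \<Rightarrow> nat \<Rightarrow> 'k::field"
  assumes "endo f" "endo g" "n \<in> V"
  shows "mmul V f g n n = f n n * g n n"
proof -
  have "mmul V f g n n = (\<Sum>k\<in>{n}. f n k * g k n)"
    unfolding mmul_def
  proof (rule sum.mono_neutral_right)
    show "\<forall>k\<in>V - {n}. f n k * g k n = 0"
      using endo_support[OF gf assms(1)] endo_support[OF gf assms(2)] support_asym
      by (metis Diff_iff mult_eq_0_iff singletonI)
  qed (use assms in auto)
  then show ?thesis by simp
qed

definition radical_endos :: "(nat \<Rightarrow> nat \<Rightarrow> 'k::comm_ring_1) set" where
  "radical_endos = {f. endo f \<and> (\<forall>n. f n n = 0)}"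

lemma radical_algebra: "mat_algebra V (radical_endos :: (nat \<Rightarrow> nat \<Rightarrow> 'k::field) set)"
  unfolding mat_algebra_def
proof (intro conjI ballI)
  show "mat.subspace (radical_endos :: (nat \<Rightarrow> nat \<Rightarrow> 'k) set)"
    unfolding mat.subspace_def radical_endos_def
    by (auto simp: endo_zero mscale_def intro: endo_add endo_scale[unfolded mscale_def])
  fix f :: "nat \<Rightarrow> nat \<Rightarrow> 'k" assume f: "f \<in> radical_endos"
  then show "supported V f" by (simp add: radical_endos_def endo_supported)
  fix g :: "nat \<Rightarrow> nat \<Rightarrow> 'k" assume g: "g \<in> radical_endos"
  have e: "endo (mmul V f g)" using f g by (simp add: radical_endos_def endo_mmul)
  have "mmul V f g n n = 0" for n
  proof (cases "n \<in> V")
    case True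
    then show ?thesis using f g endo_mmul_diag[of f g n] by (simp add: radical_endos_def)
  next
    case False
    then show ?thesis using endo_supported[OF e] by (auto simp: supported_def)
  qed
  with e show "mmul V f g \<in> radical_endos" by (simp add: radical_endos_def)
qed

text \<open>The detour through the rationals is needed because in positive characteristic an idempotent
  of trace zero need not vanish.\<close>

lemma radical_nilpotent: "\<exists>D. words V (radical_endos :: (nat \<Rightarrow> nat \<Rightarrow> int) set) D \<subseteq> {0}"
proof -
  obtain D where D: "words V (radical_endos :: (nat \<Rightarrow> nat \<Rightarrow> rat) set) D \<subseteq> {0}"
  proof -
    have "\<exists>s. mpow V X s = 0" if "X \<in> (radical_endos :: (nat \<Rightarrow> nat \<Rightarrow> rat) set)" for X
      by (rule traceless_algebra_nil[OF finite_verts radical_algebra _ that]) (simp add: radical_endos_def)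
    from nil_algebra_nilpotent[OF finite_verts radical_algebra this] show ?thesis using that by blast
  qed
  have "of_int_mat ` (radical_endos :: (nat \<Rightarrow> nat \<Rightarrow> int) set) \<subseteq> (radical_endos :: (nat \<Rightarrow> nat \<Rightarrow> rat) set)"
    by (auto simp: radical_endos_def endo_of_int_mat) (simp add: of_int_mat_def)
  then have "words V (of_int_mat ` (radical_endos :: (nat \<Rightarrow> nat \<Rightarrow> int) set)) D
      \<subseteq> words V (radical_endos :: (nat \<Rightarrow> nat \<Rightarrow> rat) set) D"
    by (rule words_mono)
  then have "of_int_mat ` words V (radical_endos :: (nat \<Rightarrow> nat \<Rightarrow> int) set) D \<subseteq> {0 :: nat \<Rightarrow> nat \<Rightarrow> rat}"
    using words_of_int_mat[of V "radical_endos :: (nat \<Rightarrow> nat \<Rightarrow> int) set" D] D by blast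
  \<comment> \<open>Integers embed into the rationals, so the vanishing of a rational word is the
    vanishing of the integral one.\<close>
  then show ?thesis by (intro exI[of _ D]) (auto simp: of_int_mat_def fun_eq_iff)
qed

text \<open>The integral generators need a zero diagonal over the integers, not just in the given
  field. So each generator is corrected by its own diagonal value before the combination is
  formed.\<close>

lemma endo_minus_diag_in_span:
  fixes f :: "nat \<Rightarrow> nat \<Rightarrow> 'k::field"
  assumes f: "endo f" and r: "r \<in> V"
  shows "f - mscale (f r r) (mone V) \<in> mat.span (of_int_mat ` radical_endos)"
  using endo_in_span[OF gf f]
proof (induction rule: mat.span_induct_alt)
  case base
  have "0 - mscale ((0 :: nat \<Rightarrow> nat \<Rightarrow> 'k) r r) (mone V) = 0" by (simp add: mscale_def fun_eq_iff)
  then show ?case by (simp only: mat.span_zero)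
next
  case (step c x y)
  then obtain X where X: "endo X" "x = of_int_mat X" by (auto simp: graph_endos_def)
  define Y where "Y = X - mscale (X r r) (mone V)"
  have eY: "endo Y" unfolding Y_def using X(1) by (intro endo_diff endo_scale endo_mone)
  have "Y n n = 0" for n
  proof (cases "n \<in> V")
    case True
    \<comment> \<open>The diagonal of \<open>X\<close> is compared over the rationals: over a field
      of positive characteristic it would be known to be constant only modulo the
      characteristic.\<close>
    have "(of_int_mat X :: nat \<Rightarrow> nat \<Rightarrow> rat) n n = of_int_mat X r r"
      by (rule endo_diag[OF endo_of_int_mat[OF X(1)] r True])
    then show ?thesis using True by (simp add: Y_def mscale_def mone_def of_int_mat_def)
  next
    case False
    then show ?thesis using endo_supported[OF eY] by (auto simp: supported_def)
  qed
  with eY have "Y \<in> radical_endos" by (simp add: radical_endos_def)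
  then have *: "of_int_mat Y \<in> mat.span (of_int_mat ` radical_endos :: (nat \<Rightarrow> nat \<Rightarrow> 'k) set)"
    by (intro mat.span_base) auto
  have "c * x r r + y r r = (mscale c x + y) r r" by (simp add: mscale_def)
  have "mscale c x + y - mscale ((mscale c x + y) r r) (mone V) =
      mscale c (of_int_mat Y) + (y - mscale (y r r) (mone V))"
    by (simp add: fun_eq_iff mscale_def X(2) Y_def of_int_mat_def mone_def algebra_simps)
  then show ?case using * step by (simp only: mat.span_add mat.span_scale)
qed

lemma idempotent_endo_zero:
  fixes e :: "nat \<Rightarrow> nat \<Rightarrow> 'k::field"
  assumes e: "endo e" and idem: "mmul V e e = e" and r: "r \<in> V" "e r r = 0"
  shows "e = 0"
proof -
  obtain D where D: "words V (radical_endos :: (nat \<Rightarrow> nat \<Rightarrow> int) set) D \<subseteq> {0}"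
    using radical_nilpotent by blast
  have "e - mscale (e r r) (mone V) = e" by (simp add: fun_eq_iff mscale_def r(2))
  with endo_minus_diag_in_span[OF e r(1)] have "e \<in> mat.span (of_int_mat ` radical_endos)" by simp
  then show ?thesis
    by (rule idempotent_in_nilpotent_span[OF finite_verts endo_supported[OF e] idem _ D])
qed

end

subsection \<open>Direct decompositions\<close>

lemma pm_sum_singles:
  fixes z :: "'n \<Rightarrow>\<^sub>0 'k::field"
  shows "(\<Sum>n\<in>Poly_Mapping.keys z. pm_scale (Poly_Mapping.lookup z n) (Poly_Mapping.single n 1)) = z"
  by (rule poly_mapping_eqI)
    (auto simp: lookup_sum lookup_pm_scale lookup_single when_def sum.delta in_keys_iff if_distrib cong: if_cong)

lemma decomposition_unique:
  assumes vs: "vector_space scale" and d: "direct_decomposition scale Q M U W" and v: "v \<in> verts Q"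
    and m: "u \<in> U v" "u' \<in> U v" "w \<in> W v" "w' \<in> W v" and eq: "u + w = u' + w'"
  shows "u = u'"
proof -
  interpret vector_space scale by fact
  have sub: "subspace (U v)" "subspace (W v)" and int: "U v \<inter> W v = {0}"
    using d v by (auto simp: direct_decomposition_def subrep_def)
  have "u - u' \<in> U v" by (rule subspace_diff[OF sub(1) m(1,2)])
  moreover have "u - u' = w' - w" using eq by (simp add: algebra_simps)
  then have "u - u' \<in> W v" using subspace_diff[OF sub(2) m(4,3)] by simp
  ultimately have "u - u' = 0" using int by blast
  then show ?thesis by simp
qed

lemma direct_decomposition_commute:
  assumes "direct_decomposition scale Q M U W"
  shows "direct_decomposition scale Q M W U"
proof -
  have "{x + y |x y. x \<in> U v \<and> y \<in> W v} = {x + y |x y. x \<in> W v \<and> y \<in> U v}" for v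
    by (safe; metis add.commute)
  with assms show ?thesis unfolding direct_decomposition_def by (simp add: Int_commute)
qed

context tree_over
begin

abbreviation "M \<equiv> tree_module T F"

lemma in_space: "x \<in> space M v \<longleftrightarrow> Poly_Mapping.keys x \<subseteq> {n \<in> V. vmap F n = v}"
  by (simp add: tree_module_def)

text \<open>\<open>e\<close> is the matrix of the projection onto \<open>U\<close> along
  \<open>W\<close>. The components \<open>x n\<close> and \<open>y n\<close> of the basis vectors
  enter as data, so that exchanging them gives the complementary projection.\<close>

lemma decomposition_projection:
  fixes U W :: "'v \<Rightarrow> (nat \<Rightarrow>\<^sub>0 'k::field) set" and x y :: "nat \<Rightarrow> (nat \<Rightarrow>\<^sub>0 'k)"
  assumes wf: "wf_digraph Q" and qm: "quiver_morphism T Q F" and d: "direct_decomposition pm_scale Q M U W"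
    and x: "\<And>n. n \<in> V \<Longrightarrow> x n \<in> U (vmap F n)" and y: "\<And>n. n \<in> V \<Longrightarrow> y n \<in> W (vmap F n)"
    and xy: "\<And>n. n \<in> V \<Longrightarrow> x n + y n = Poly_Mapping.single n 1"
  defines "e \<equiv> \<lambda>n m. if n \<in> V then Poly_Mapping.lookup (x n) m else 0"
  shows "endo e" "mmul V e e = e" "e = 0 \<Longrightarrow> v \<in> verts Q \<Longrightarrow> U v = {0}"
proof -
  interpret pm: vector_space "pm_scale :: 'k \<Rightarrow> (nat \<Rightarrow>\<^sub>0 'k) \<Rightarrow> _" by (rule vector_space_pm_scale)
  note uniq = decomposition_unique[OF vector_space_pm_scale d]
  have Uv: "pm.subspace (U v)" "pm.subspace (W v)" "U v \<subseteq> space M v" if "v \<in> verts Q" for v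
    using d that unfolding direct_decomposition_def subrep_def by blast+
  have actU: "act M \<gamma> u \<in> U (head Q \<gamma>)" if "\<gamma> \<in> arcs Q" "u \<in> U (tail Q \<gamma>)" for \<gamma> u
    using d that by (auto simp: direct_decomposition_def subrep_def)
  have actW: "act M \<gamma> u \<in> W (head Q \<gamma>)" if "\<gamma> \<in> arcs Q" "u \<in> W (tail Q \<gamma>)" for \<gamma> u
    using d that by (auto simp: direct_decomposition_def subrep_def)
  have vQ: "vmap F n \<in> verts Q" if "n \<in> V" for n
    using qm that by (auto simp: quiver_morphism_def)
  have aQ: "amap F a \<in> arcs Q" "tail Q (amap F a) = vmap F (tail T a)" "head Q (amap F a) = vmap F (head T a)"
    if "a \<in> arcs T" for a using qm that by (auto simp: quiver_morphism_def)
  \<comment> \<open>The sum is the image of \<open>u\<close> under the projection; it equals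
    \<open>u\<close> by comparing two decompositions of \<open>u\<close>, the second being
    \<open>u + 0\<close>.\<close>
  have fix_U: "(\<Sum>n\<in>Poly_Mapping.keys u. pm_scale (Poly_Mapping.lookup u n) (x n)) = u"
    if v: "v \<in> verts Q" and u: "u \<in> U v" for u v
  proof -
    have "u \<in> space M v" using Uv(3)[OF v] u by blast
    then have "Poly_Mapping.keys u \<subseteq> {n \<in> V. vmap F n = v}" by (simp only: in_space)
    then have k: "n \<in> V" "vmap F n = v" if "n \<in> Poly_Mapping.keys u" for n using that by auto
    let ?x = "\<Sum>n\<in>Poly_Mapping.keys u. pm_scale (Poly_Mapping.lookup u n) (x n)"
    let ?y = "\<Sum>n\<in>Poly_Mapping.keys u. pm_scale (Poly_Mapping.lookup u n) (y n)"
    have "?x \<in> U v"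
    proof (rule pm.subspace_sum[OF Uv(1)[OF v]])
      fix n assume "n \<in> Poly_Mapping.keys u"
      then show "pm_scale (Poly_Mapping.lookup u n) (x n) \<in> U v"
        using x[OF k(1)] k(2) pm.subspace_scale[OF Uv(1)[OF v]] by simp
    qed
    moreover have "?y \<in> W v"
    proof (rule pm.subspace_sum[OF Uv(2)[OF v]])
      fix n assume "n \<in> Poly_Mapping.keys u"
      then show "pm_scale (Poly_Mapping.lookup u n) (y n) \<in> W v"
        using y[OF k(1)] k(2) pm.subspace_scale[OF Uv(2)[OF v]] by simp
    qed
    moreover have "?x + ?y = u + 0"
    proof -
      have "?x + ?y = (\<Sum>n\<in>Poly_Mapping.keys u. pm_scale (Poly_Mapping.lookup u n) (x n + y n))"
        by (simp add: pm.scale_right_distrib sum.distrib)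
      also have "\<dots> = (\<Sum>n\<in>Poly_Mapping.keys u. pm_scale (Poly_Mapping.lookup u n) (Poly_Mapping.single n 1))"
        by (rule sum.cong) (auto simp: xy k)
      finally show ?thesis by (simp add: pm_sum_singles)
    qed
    ultimately show ?thesis using uniq[OF v _ u] pm.subspace_0[OF Uv(2)[OF v]] by blast
  qed
  have esupp: "n \<in> V \<and> m \<in> V \<and> vmap F n = vmap F m" if "e n m \<noteq> 0" for n m
  proof -
    have n: "n \<in> V" and "Poly_Mapping.lookup (x n) m \<noteq> 0" using that by (auto simp: e_def split: if_splits)
    then have "m \<in> Poly_Mapping.keys (x n)" by (simp add: in_keys_iff)
    moreover have "x n \<in> space M (vmap F n)" using x[OF n] Uv(3)[OF vQ[OF n]] by blast
    ultimately show ?thesis using n by (auto simp: in_space)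
  qed
  show "endo e"
    unfolding endo_def
  proof (intro conjI allI impI)
    show "(n, m) \<in> verts N1" if "e n m \<noteq> 0" for n m using esupp[OF that] by (simp add: N1_verts)
    fix p q \<gamma>
    let ?A = "{a \<in> arcs T. tail T a = p \<and> amap F a = \<gamma>}"
    let ?B = "{b \<in> arcs T. head T b = q \<and> amap F b = \<gamma>}"
    show "(\<Sum>a\<in>?A. e (head T a) q) = (\<Sum>b\<in>?B. e p (tail T b))"
    \<comment> \<open>Otherwise \<open>\<gamma>\<close> cannot act at \<open>p\<close>: no arrow
      labelled \<open>\<gamma>\<close> starts there, and the entries on the other side vanish
      because \<open>e\<close> respects the vertex labels.\<close>
    proof (cases "p \<in> V \<and> \<gamma> \<in> arcs Q \<and> tail Q \<gamma> = vmap F p")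
      case True
      then have p: "p \<in> V" and g: "\<gamma> \<in> arcs Q" "tail Q \<gamma> = vmap F p" by auto
      let ?h = "head Q \<gamma>"
      have hA: "head T a \<in> V" "vmap F (head T a) = ?h" if "a \<in> ?A" for a using that aQ by auto
      have hQ: "?h \<in> verts Q" using wf g(1) by (rule wf_digraph.head_in_verts)
      \<comment> \<open>Both are the component in \<open>U\<close> of the image under
        \<open>\<gamma>\<close> of the basis vector at \<open>p\<close>.\<close>
      have "(\<Sum>a\<in>?A. x (head T a)) = act M \<gamma> (x p)"
      proof -
        have "(\<Sum>a\<in>?A. x (head T a)) \<in> U ?h"
          by (rule pm.subspace_sum[OF Uv(1)[OF hQ]]) (use hA x in fastforce)
        moreover have "(\<Sum>a\<in>?A. y (head T a)) \<in> W ?h"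
          by (rule pm.subspace_sum[OF Uv(2)[OF hQ]]) (use hA y in fastforce)
        moreover have "act M \<gamma> (x p) \<in> U ?h" "act M \<gamma> (y p) \<in> W ?h"
          using x[OF p] y[OF p] g actU actW by auto
        moreover have "(\<Sum>a\<in>?A. x (head T a)) + (\<Sum>a\<in>?A. y (head T a)) = act M \<gamma> (x p) + act M \<gamma> (y p)"
        proof -
          have "(\<Sum>a\<in>?A. x (head T a)) + (\<Sum>a\<in>?A. y (head T a)) = (\<Sum>a\<in>?A. Poly_Mapping.single (head T a) 1)"
            unfolding sum.distrib[symmetric] by (rule sum.cong[OF refl]) (use hA xy in blast)
          also have "\<dots> = act M \<gamma> (Poly_Mapping.single p 1)"
            by (simp add: tree_module_def pm.scale_one)
          also have "\<dots> = act M \<gamma> (x p + y p)" by (simp only: xy[OF p])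
          also have "\<dots> = act M \<gamma> (x p) + act M \<gamma> (y p)"
            by (rule poly_mapping_eqI) (simp add: lookup_act_tree_module lookup_add sum.distrib)
          finally show ?thesis .
        qed
        ultimately show ?thesis using uniq[OF hQ] by blast
      qed
      then have "Poly_Mapping.lookup (\<Sum>a\<in>?A. x (head T a)) q = Poly_Mapping.lookup (act M \<gamma> (x p)) q" by simp
      then have "(\<Sum>a\<in>?A. Poly_Mapping.lookup (x (head T a)) q) = (\<Sum>b\<in>?B. Poly_Mapping.lookup (x p) (tail T b))"
        by (simp add: lookup_sum lookup_act_tree_module)
      moreover have "(\<Sum>a\<in>?A. e (head T a) q) = (\<Sum>a\<in>?A. Poly_Mapping.lookup (x (head T a)) q)"
        by (rule sum.cong) (use hA in \<open>auto simp: e_def\<close>)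
      ultimately show ?thesis using p by (simp add: e_def)
    next
      case False
      then have "?A = {}" using aQ by auto
      then have "(\<Sum>a\<in>?A. e (head T a) q) = 0" by (simp only: sum.empty)
      moreover have "e p (tail T b) = 0" if "b \<in> ?B" for b
      proof (rule ccontr)
        assume "e p (tail T b) \<noteq> 0"
        from esupp[OF this] have "p \<in> V" "vmap F p = vmap F (tail T b)" by auto
        with False that aQ[of b] show False by auto
      qed
      then have "(\<Sum>b\<in>?B. e p (tail T b)) = 0" by (rule sum.neutral[OF ballI])
      ultimately show ?thesis by simp
    qed
  qed
  show "mmul V e e = e"
  proof (intro ext)
    fix k m
    show "mmul V e e k m = e k m"
    proof (cases "k \<in> V")
      case True
      let ?K = "Poly_Mapping.keys (x k)"
      have "x k \<in> space M (vmap F k)" using x[OF True] Uv(3)[OF vQ[OF True]] by blast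
      then have KV: "?K \<subseteq> V" by (auto simp only: in_space)
      have "mmul V e e k m = (\<Sum>n\<in>?K. e k n * e n m)"
        unfolding mmul_def
        by (rule sum.mono_neutral_right) (use KV True in \<open>auto simp: e_def in_keys_iff\<close>)
      also have "\<dots> = (\<Sum>n\<in>?K. Poly_Mapping.lookup (x k) n * Poly_Mapping.lookup (x n) m)"
        by (rule sum.cong) (use KV True in \<open>auto simp: e_def\<close>)
      also have "\<dots> = Poly_Mapping.lookup (\<Sum>n\<in>?K. pm_scale (Poly_Mapping.lookup (x k) n) (x n)) m"
        by (simp add: lookup_sum lookup_pm_scale)
      also have "\<dots> = Poly_Mapping.lookup (x k) m" by (simp add: fix_U[OF vQ[OF True] x[OF True]])
      finally show ?thesis using True by (simp add: e_def)
    qed (simp add: mmul_def e_def)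
  qed
  show "U v = {0}" if e0: "e = 0" and v: "v \<in> verts Q"
  proof -
    have "u = 0" if u: "u \<in> U v" for u
    proof -
      have "pm_scale (Poly_Mapping.lookup u n) (x n) = 0" if "n \<in> Poly_Mapping.keys u" for n
      proof -
        have "u \<in> space M v" using Uv(3)[OF v] u by blast
        then have "n \<in> V" using that by (auto simp only: in_space)
        then have "Poly_Mapping.lookup (x n) m = 0" for m
          using fun_cong[OF fun_cong[OF e0, of n], of m] by (simp add: e_def)
        then have "x n = 0" by (intro poly_mapping_eqI) simp
        then show ?thesis by (simp add: pm.scale_zero_right)
      qed
      then have "(\<Sum>n\<in>Poly_Mapping.keys u. pm_scale (Poly_Mapping.lookup u n) (x n)) = 0"
        by (rule sum.neutral[OF ballI])
      with fix_U[OF v u] show ?thesis by simp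
    qed
    with pm.subspace_0[OF Uv(1)[OF v]] show ?thesis by blast
  qed
qed

end

context tree_over_restricted
begin

lemma idempotent_diag:
  fixes e :: "nat \<Rightarrow> nat \<Rightarrow> 'k::field"
  assumes "endo e" "mmul V e e = e" "r \<in> V"
  shows "e r r = 0 \<or> e r r = 1"
proof -
  have "e r r = e r r * e r r" using endo_mmul_diag[OF assms(1,1,3)] by (simp only: assms(2))
  then have "e r r * (e r r - 1) = 0" by (simp only: right_diff_distrib mult_1_right) simp
  then show ?thesis by simp
qed

lemma decomposition_trivial:
  fixes U W :: "'v \<Rightarrow> (nat \<Rightarrow>\<^sub>0 'k::field) set"
  assumes wf: "wf_digraph Q" and qm: "quiver_morphism T Q F" and d: "direct_decomposition pm_scale Q M U W"
  shows "(\<forall>v\<in>verts Q. U v = {0}) \<or> (\<forall>v\<in>verts Q. W v = {0})"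
proof -
  have "\<exists>x y. x \<in> U (vmap F n) \<and> y \<in> W (vmap F n) \<and> x + y = (Poly_Mapping.single n 1 :: nat \<Rightarrow>\<^sub>0 'k)" if n: "n \<in> V" for n
  proof -
    have "(Poly_Mapping.single n 1 :: nat \<Rightarrow>\<^sub>0 'k) \<in> space M (vmap F n)" using n by (simp add: in_space)
    moreover have "vmap F n \<in> verts Q" using qm n by (auto simp: quiver_morphism_def)
    ultimately show ?thesis using d unfolding direct_decomposition_def by (smt (verit) mem_Collect_eq)
  qed
  then obtain x y :: "nat \<Rightarrow> (nat \<Rightarrow>\<^sub>0 'k)" where
    x: "\<And>n. n \<in> V \<Longrightarrow> x n \<in> U (vmap F n)" and y: "\<And>n. n \<in> V \<Longrightarrow> y n \<in> W (vmap F n)"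
    and xy: "\<And>n. n \<in> V \<Longrightarrow> x n + y n = Poly_Mapping.single n 1" by metis
  have yx: "\<And>n. n \<in> V \<Longrightarrow> y n + x n = Poly_Mapping.single n 1" using xy by (simp add: add.commute)
  define e where "e = (\<lambda>n m. if n \<in> V then Poly_Mapping.lookup (x n) m else 0)"
  define e' where "e' = (\<lambda>n m. if n \<in> V then Poly_Mapping.lookup (y n) m else 0)"
  note E = decomposition_projection[OF wf qm d x y xy, folded e_def]
  note E' = decomposition_projection[OF wf qm direct_decomposition_commute[OF d] y x yx, folded e'_def]
  obtain r where r: "r \<in> V" using tree by (auto simp: tree_quiver_def connected_def strongly_connected_def)
  \<comment> \<open>Each of the two entries is 0 or 1, so exactly one of the projections has a
    vanishing diagonal entry at \<open>r\<close>.\<close>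
  have "e r r + e' r r = 1" using arg_cong[OF xy[OF r], of "\<lambda>z. Poly_Mapping.lookup z r"] r
    by (simp add: e_def e'_def lookup_add)
  with idempotent_diag[OF E(1,2) r] consider "e r r = 0" | "e' r r = 0" by auto
  then show ?thesis
  proof cases
    case 1
    then show ?thesis using E(3) idempotent_endo_zero[OF E(1,2) r] by blast
  next
    case 2
    then show ?thesis using E'(3) idempotent_endo_zero[OF E'(1,2) r] by blast
  qed
qed

end

theorem theoremB:
  fixes Q :: "('v, 'a) pre_digraph" and \<rho> :: "('v, 'a) qpath set"
    and T :: "(nat, 'e) pre_digraph" and F :: "(nat, 'e, 'v, 'a) quiver_map"
  assumes char: "CHAR('k::field) \<noteq> 2"
    and Q: "zero_relation_quiver TYPE('k) Q \<rho>"
    and T: "tree_quiver T"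
    and F: "bound_quiver_morphism TYPE('k) T Q \<rho> F"
    and ghost_free: "ghost_free T F T F"
    and cond1:
      "\<forall>n\<^sub>1 n\<^sub>2 n. \<forall>a \<in> arcs T. \<forall>b \<in> arcs T.
         ((tail T a = n \<and> head T a = n\<^sub>1 \<and> tail T b = n \<and> head T b = n\<^sub>2) \<or>
          (tail T a = n\<^sub>1 \<and> head T a = n \<and> tail T b = n\<^sub>2 \<and> head T b = n)) \<and>
         n\<^sub>1 \<noteq> n\<^sub>2 \<and> amap F a = amap F b \<longrightarrow>
         (\<forall>G. generalised_graph_map T F T F G \<longrightarrow> (\<forall>j \<in> {-1, 1}. (n\<^sub>1, n\<^sub>2, j) \<notin> verts G))"
    and cond2:
      "\<forall>n\<^sub>1 \<in> verts T. \<forall>n\<^sub>2 \<in> verts T. n\<^sub>1 \<noteq> n\<^sub>2 \<longrightarrow>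
         (\<exists>G. generalised_graph_map T F T F G \<and> (\<exists>j \<in> {-1, 1}. (n\<^sub>1, n\<^sub>2, j) \<in> verts G)) \<longrightarrow>
         \<not> (\<exists>G'. generalised_graph_map T F T F G' \<and> (\<exists>j' \<in> {-1, 1}. (n\<^sub>2, n\<^sub>1, j') \<in> verts G'))"
  shows "indecomposable (pm_scale :: 'k \<Rightarrow> _) Q \<rho> (tree_module T F)"
proof -
  have qm: "quiver_morphism T Q F" using F by (simp add: bound_quiver_morphism_def)
  have wf: "wf_digraph Q" using Q by (simp add: zero_relation_quiver_def locally_finite_def)
  interpret tree_over T F
  proof
    show "tree_quiver T" by (rule T)
    show "vmap F (tail T a) = vmap F (tail T b)" "vmap F (head T a) = vmap F (head T b)"
      if "a \<in> arcs T" "b \<in> arcs T" "amap F a = amap F b" for a b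
      using qm that by (metis quiver_morphism_def)+
  qed
  interpret tree_over_restricted T F
  proof
    show "ghost_free T F T F" by (rule ghost_free)
    show "(head T a, head T b) \<notin> graph_support"
      if "a \<in> arcs T" "b \<in> arcs T" "amap F a = amap F b" "tail T a = tail T b" "head T a \<noteq> head T b" for a b
      using cond1 that unfolding graph_support_def by blast
    show "(tail T a, tail T b) \<notin> graph_support"
      if "a \<in> arcs T" "b \<in> arcs T" "amap F a = amap F b" "head T a = head T b" "tail T a \<noteq> tail T b" for a b
      using cond1 that unfolding graph_support_def by blast
    show "(m, n) \<notin> graph_support" if "n \<noteq> m" "(n, m) \<in> graph_support" for n m
    proof -
      have "n \<in> verts T" "m \<in> verts T" using graph_support_verts[OF that(2)] by auto
      with cond2 that show ?thesis unfolding graph_support_def by blast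
    qed
  qed
  obtain r where r: "r \<in> verts T" using T by (auto simp: tree_quiver_def connected_def strongly_connected_def)
  have "(Poly_Mapping.single r 1 :: nat \<Rightarrow>\<^sub>0 'k) \<in> space (tree_module T F) (vmap F r)" using r by (simp add: in_space)
  moreover have "(Poly_Mapping.single r 1 :: nat \<Rightarrow>\<^sub>0 'k) \<noteq> 0"
    by (metis lookup_single_eq lookup_zero zero_neq_one)
  ultimately have "space (tree_module T F) (vmap F r) \<noteq> {0 :: nat \<Rightarrow>\<^sub>0 'k}" by blast
  moreover have "vmap F r \<in> verts Q" using qm r by (auto simp: quiver_morphism_def)
  ultimately have "\<exists>v\<in>verts Q. space (tree_module T F) v \<noteq> {0 :: nat \<Rightarrow>\<^sub>0 'k}" by blast
  then show ?thesis
    unfolding indecomposable_def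
    using bound_rep_tree_module[OF Q T F] decomposition_trivial[OF wf qm] by blast
qed

end
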